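(* Let $T$ be a tree such that every vertex of $T$ has at least three neighbours, and let $G$ be a nondiscrete $(\mathrm{P})$-closed subgroup of $\mathrm{Aut}(T)$, such that $G$ does not preserve any proper subtree of $T$. Then the following are equivalent: (i) Every proper open subgroup of $G$ has bounded action on $T$, and the point stabilisers in $G$ (stabilisers of distinct vertices of $T$) are pairwise incomparable with respect to the subgroup inclusion partial order. (ii) There are adjacent vertices $v,w$ of $T$ such that $G_v$ and $G_w$ are distinct maximal subgroups of $G$. (iii) $G$ preserves the natural bipartition of the vertices of $T$ (each part being $G$-invariant) and acts primitively on each part. (iv) Letting $\Delta=(\Gamma,(X_a),(G(v)))$ be the local action diagram of $(T,G)$, then $|V\Gamma|=2$ and for all $v\in V\Gamma$, $G(v)$ is primitive but not regular. Moreover, if (i)--(iv) hold then $G$ is simple; $\Gamma$ consists of a single undirected edge with two distinct endpoints; the action of $G$ on $T$ is geometrically dense; and $G$ is an amalgamated free product $G_v\ast_{G_{(v,w)}}G_w$ (with $v,w$ adjacent vertices as in (ii)).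
   Context: Graphs. A graph $\Gamma$ has a vertex set $V\Gamma$, an arc set $A\Gamma$, an origin map $o:A\Gamma\to V\Gamma$ and a reversal map $a\mapsto\overline a$ on $A\Gamma$ with $\overline{\overline a}=a$; $t(a):=o(\overline a)$. An arc with $o(a)=t(a)$ is a loop; for a loop both $\overline a=a$ and $\overline a\neq a$ are allowed. $o^{-1}(v)$ is the set of arcs with origin $v$. A tree is a nonempty connected graph without loops, multiple edges or cycles; subtrees are nonempty connected subgraphs; ends are equivalence classes of rays, two rays being equivalent if they share infinitely many vertices. In a tree, $(v,w)$ denotes the arc from $v$ to an adjacent vertex $w$, and $G_{(v,w)}$ its stabiliser. The natural bipartition of $VT$ has two vertices in the same part iff their distance is even. Permutation groups carry the permutation topology (pointwise stabilisers of finite sets form a base of neighbourhoods of the identity), and $\mathrm{Aut}(T)\le\mathrm{Sym}(VT)$ the subspace topology; "nondiscrete" and "open" refer to this. $G\backslash T$ is the graph of $G$-orbits on vertices and arcs. A group acting on $T$ has bounded action if its orbits on vertices have finite diameter. It is geometrically dense if it preserves no proper subtree and fixes no end. Property $(\mathrm{P})$. For a nonempty (finite or infinite) simple path $L$ in $T$, let $\pi_L:VT\to VL$ be the closest point projection and $G_{(L)}$ the pointwise stabiliser of $L$; for $x\in VL$ let $\phi_x:G_{(L)}\to\mathrm{Sym}(\pi_L^{-1}(x))$ be given by the action. $G$ has property $(\mathrm{P})$ if for every such $L$ the homomorphism $G_{(L)}\to\prod_{x\in VL}\phi_x(G_{(L)})$ is surjective. $G$ is $(\mathrm{P})$-closed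 if it is closed in $\mathrm{Aut}(T)$ and has $(\mathrm{P})$. Local action diagram of $(T,G)$: $\Gamma=G\backslash T$ with quotient map $\pi$; one chooses $v^*\in\pi^{-1}(v)$ for each $v\in V\Gamma$, sets $X_a=\{b\in o^{-1}(v^* ):\pi(b)=a\}$ for $a\in o^{-1}(v)$, and lets $G(v)$ be the closure in $\mathrm{Sym}(X_v)$ of the permutation group induced by $G_{v^*}$ on $X_v=o^{-1}(v^* )$. A transitive permutation group is primitive if it preserves no equivalence relation other than the trivial and universal ones; it is regular if it is transitive with trivial point stabilisers. *)

theory Defs
  imports "HOL-Analysis.Analysis" "HOL-Algebra.Group_Action"
begin

section \<open>Graphs and trees\<close>

record ('v, 'a) arc_graph =
  verts :: "'v set"
  arcs :: "'a set"
  orig :: "'a \<Rightarrow> 'v"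
  opp :: "'a \<Rightarrow> 'a"

definition term_of :: "('v, 'a) arc_graph \<Rightarrow> 'a \<Rightarrow> 'v" where
  "term_of T a = orig T (opp T a)"

definition is_graph :: "('v, 'a) arc_graph \<Rightarrow> bool" where
  "is_graph T \<longleftrightarrow>
     orig T ` arcs T \<subseteq> verts T \<and> opp T ` arcs T \<subseteq> arcs T \<and>
     (\<forall>a\<in>arcs T. opp T (opp T a) = a)"

definition out_arcs :: "('v, 'a) arc_graph \<Rightarrow> 'v \<Rightarrow> 'a set" where
  "out_arcs T v = {a \<in> arcs T. orig T a = v}"

definition adj_rel :: "('v, 'a) arc_graph \<Rightarrow> ('v \<times> 'v) set" where
  "adj_rel T = {(orig T a, term_of T a) | a. a \<in> arcs T}"

definition nbrs :: "('v, 'a) arc_graph \<Rightarrow> 'v \<Rightarrow> 'v set" where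
  "nbrs T v = {w. (v, w) \<in> adj_rel T}"

definition is_connected :: "('v, 'a) arc_graph \<Rightarrow> bool" where
  "is_connected T \<longleftrightarrow> (\<forall>v\<in>verts T. \<forall>w\<in>verts T. (v, w) \<in> (adj_rel T)\<^sup>*)"

text \<open>Only meaningful when the two vertices are joined by a walk.\<close>
definition gdist :: "('v, 'a) arc_graph \<Rightarrow> 'v \<Rightarrow> 'v \<Rightarrow> nat" where
  "gdist T v w = (LEAST n. (v, w) \<in> adj_rel T ^^ n)"

definition is_cycle :: "('v, 'a) arc_graph \<Rightarrow> 'v list \<Rightarrow> bool" where
  "is_cycle T xs \<longleftrightarrow>
     3 \<le> length xs \<and> distinct xs \<and>
     (\<forall>i. Suc i < length xs \<longrightarrow> (xs ! i, xs ! Suc i) \<in> adj_rel T) \<and>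
     (last xs, hd xs) \<in> adj_rel T"

definition is_tree :: "('v, 'a) arc_graph \<Rightarrow> bool" where
  "is_tree T \<longleftrightarrow>
     is_graph T \<and> verts T \<noteq> {} \<and> is_connected T \<and>
     (\<forall>a\<in>arcs T. orig T a \<noteq> term_of T a) \<and>
     (\<forall>a\<in>arcs T. \<forall>b\<in>arcs T. orig T a = orig T b \<and> term_of T a = term_of T b \<longrightarrow> a = b) \<and>
     \<not> (\<exists>xs. is_cycle T xs)"

definition is_subgraph :: "('v, 'a) arc_graph \<Rightarrow> ('v, 'a) arc_graph \<Rightarrow> bool" where
  "is_subgraph S T \<longleftrightarrow>
     is_graph S \<and> verts S \<subseteq> verts T \<and> arcs S \<subseteq> arcs T \<and>
     (\<forall>a\<in>arcs S. orig S a = orig T a \<and> opp S a = opp T a)"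

definition is_subtree :: "('v, 'a) arc_graph \<Rightarrow> ('v, 'a) arc_graph \<Rightarrow> bool" where
  "is_subtree S T \<longleftrightarrow> is_subgraph S T \<and> verts S \<noteq> {} \<and> is_connected S"

definition is_proper_subtree :: "('v, 'a) arc_graph \<Rightarrow> ('v, 'a) arc_graph \<Rightarrow> bool" where
  "is_proper_subtree S T \<longleftrightarrow> is_subtree S T \<and> (verts S \<noteq> verts T \<or> arcs S \<noteq> arcs T)"

definition bipartition :: "('v, 'a) arc_graph \<Rightarrow> 'v set set" where
  "bipartition T = verts T // {(v, w). v \<in> verts T \<and> w \<in> verts T \<and> even (gdist T v w)}"

definition rays :: "('v, 'a) arc_graph \<Rightarrow> (nat \<Rightarrow> 'v) set" where
  "rays T = {r. inj r \<and> range r \<subseteq> verts T \<and> (\<forall>n. (r n, r (Suc n)) \<in> adj_rel T)}"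

definition ends :: "('v, 'a) arc_graph \<Rightarrow> (nat \<Rightarrow> 'v) set set" where
  "ends T = rays T // {(r, s). r \<in> rays T \<and> s \<in> rays T \<and> infinite (range r \<inter> range s)}"

text \<open>
  Finite, one-way infinite and two-way infinite simple paths, given by their vertex sets;
  \<open>I\<close> is a nonempty interval of integers indexing the vertices.
\<close>
definition is_simple_path :: "('v, 'a) arc_graph \<Rightarrow> 'v set \<Rightarrow> bool" where
  "is_simple_path T L \<longleftrightarrow>
     (\<exists>(I :: int set) p. I \<noteq> {} \<and> (\<forall>i\<in>I. \<forall>j\<in>I. {i..j} \<subseteq> I) \<and> inj_on p I \<and>
        p ` I = L \<and> L \<subseteq> verts T \<and>
        (\<forall>i. i \<in> I \<and> i + 1 \<in> I \<longrightarrow> (p i, p (i + 1)) \<in> adj_rel T))"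

definition closest_point :: "('v, 'a) arc_graph \<Rightarrow> 'v set \<Rightarrow> 'v \<Rightarrow> 'v" where
  "closest_point T L v = arg_min_on (gdist T v) L"


section \<open>Permutation groups\<close>

text \<open>As in \<open>BijGroup\<close>, permutations of \<open>X\<close> are extensional functions.\<close>

definition fixator :: "('x \<Rightarrow> 'x) set \<Rightarrow> 'x set \<Rightarrow> ('x \<Rightarrow> 'x) set" where
  "fixator H F = {h \<in> H. \<forall>x\<in>F. h x = x}"

text \<open>The group topology in which the pointwise stabilisers of finite sets form a base of
  neighbourhoods of the identity.\<close>
definition perm_topology :: "'x set \<Rightarrow> ('x \<Rightarrow> 'x) topology" where
  "perm_topology X = topology (\<lambda>U. U \<subseteq> Bij X \<and>
     (\<forall>g\<in>U. \<exists>F. finite F \<and> F \<subseteq> X \<and> g <#\<^bsub>BijGroup X\<^esub> fixator (Bij X) F \<subseteq> U))"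

lemma openin_perm_topology:
  "openin (perm_topology X) U \<longleftrightarrow> U \<subseteq> Bij X \<and>
     (\<forall>g\<in>U. \<exists>F. finite F \<and> F \<subseteq> X \<and> g <#\<^bsub>BijGroup X\<^esub> fixator (Bij X) F \<subseteq> U)"
proof -
  let ?N = "\<lambda>g F. g <#\<^bsub>BijGroup X\<^esub> fixator (Bij X) F"
  have anti: "?N g (F \<union> F') \<subseteq> ?N g F \<inter> ?N g F'" for g F F'
    unfolding l_coset_def fixator_def by blast
  have "istopology (\<lambda>U. U \<subseteq> Bij X \<and> (\<forall>g\<in>U. \<exists>F. finite F \<and> F \<subseteq> X \<and> ?N g F \<subseteq> U))"
    unfolding istopology_def
  proof (intro conjI allI impI)
    fix S S'
    assume S: "S \<subseteq> Bij X \<and> (\<forall>g\<in>S. \<exists>F. finite F \<and> F \<subseteq> X \<and> ?N g F \<subseteq> S)"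
      and S': "S' \<subseteq> Bij X \<and> (\<forall>g\<in>S'. \<exists>F. finite F \<and> F \<subseteq> X \<and> ?N g F \<subseteq> S')"
    show "S \<inter> S' \<subseteq> Bij X" using S by blast
    show "\<forall>g\<in>S \<inter> S'. \<exists>F. finite F \<and> F \<subseteq> X \<and> ?N g F \<subseteq> S \<inter> S'"
    proof
      fix g assume "g \<in> S \<inter> S'"
      then obtain F F' where "finite F" "F \<subseteq> X" "?N g F \<subseteq> S" "finite F'" "F' \<subseteq> X" "?N g F' \<subseteq> S'"
        using S S' by (meson IntD1 IntD2)
      then show "\<exists>F. finite F \<and> F \<subseteq> X \<and> ?N g F \<subseteq> S \<inter> S'"
        using anti[of g F F'] by (intro exI[of _ "F \<union> F'"]) auto
    qed
  next
    fix \<K> assume K: "\<forall>K\<in>\<K>. K \<subseteq> Bij X \<and> (\<forall>g\<in>K. \<exists>F. finite F \<and> F \<subseteq> X \<and> ?N g F \<subseteq> K)"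
    show "\<Union>\<K> \<subseteq> Bij X" using K by blast
    show "\<forall>g\<in>\<Union>\<K>. \<exists>F. finite F \<and> F \<subseteq> X \<and> ?N g F \<subseteq> \<Union>\<K>"
    proof
      fix g assume "g \<in> \<Union>\<K>"
      then obtain K0 where "K0 \<in> \<K>" "g \<in> K0" by blast
      moreover then obtain F where "finite F" "F \<subseteq> X" "?N g F \<subseteq> K0" using K by meson
      ultimately show "\<exists>F. finite F \<and> F \<subseteq> X \<and> ?N g F \<subseteq> \<Union>\<K>" by blast
    qed
  qed
  then show ?thesis
    unfolding perm_topology_def by (simp add: topology_inverse')
qed

lemma topspace_perm_topology [simp]: "topspace (perm_topology X) = Bij X"
proof
  show "topspace (perm_topology X) \<subseteq> Bij X"
    using openin_perm_topology openin_topspace by blast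
  have "g <#\<^bsub>BijGroup X\<^esub> fixator (Bij X) {} \<subseteq> Bij X" if "g \<in> Bij X" for g
    using that by (auto simp: l_coset_def fixator_def BijGroup_def compose_Bij)
  then have "openin (perm_topology X) (Bij X)"
    unfolding openin_perm_topology by blast
  then show "Bij X \<subseteq> topspace (perm_topology X)" by (rule openin_subset)
qed

definition transitive_on :: "'x set \<Rightarrow> ('x \<Rightarrow> 'x) set \<Rightarrow> bool" where
  "transitive_on X H \<longleftrightarrow> (\<forall>x\<in>X. \<forall>y\<in>X. \<exists>h\<in>H. h x = y)"

definition primitive_on :: "'x set \<Rightarrow> ('x \<Rightarrow> 'x) set \<Rightarrow> bool" where
  "primitive_on X H \<longleftrightarrow> transitive_on X H \<and>
     (\<forall>R. equiv X R \<and> (\<forall>h\<in>H. \<forall>(x, y)\<in>R. (h x, h y) \<in> R) \<longrightarrow> R = Id_on X \<or> R = X \<times> X)"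

definition regular_on :: "'x set \<Rightarrow> ('x \<Rightarrow> 'x) set \<Rightarrow> bool" where
  "regular_on X H \<longleftrightarrow> transitive_on X H \<and> (\<forall>x\<in>X. {h \<in> H. h x = x} = {\<lambda>x\<in>X. x})"


section \<open>Abstract groups\<close>

text \<open>The library locale \<open>simple_group\<close> requires \<open>1 < order G\<close>, which excludes
  infinite groups since their \<open>order\<close> is \<open>0\<close>.\<close>
definition is_simple :: "('g, 'm) monoid_scheme \<Rightarrow> bool" where
  "is_simple K \<longleftrightarrow> group K \<and> carrier K \<noteq> {\<one>\<^bsub>K\<^esub>} \<and>
     (\<forall>N. N \<lhd> K \<longrightarrow> N = {\<one>\<^bsub>K\<^esub>} \<or> N = carrier K)"

definition maximal_subgroup :: "'g set \<Rightarrow> ('g, 'm) monoid_scheme \<Rightarrow> bool" where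
  "maximal_subgroup M K \<longleftrightarrow> subgroup M K \<and> M \<noteq> carrier K \<and>
     (\<forall>H. subgroup H K \<and> M \<subseteq> H \<longrightarrow> H = M \<or> H = carrier K)"

text \<open>
  For groups \<open>A\<close> and \<open>B\<close> with a common subgroup \<open>C\<close>, the amalgamated free product is the group
  presented by the disjoint union of \<open>A\<close> and \<open>B\<close> with the relations of \<open>A\<close>, those of \<open>B\<close>, and
  the identification of the two copies of \<open>C\<close>. It is built as the quotient of the monoid of
  words by the generated congruence; inverses of letters exist already in \<open>A\<close> and \<open>B\<close>.
\<close>

definition amalg_words :: "('g, 'm) monoid_scheme \<Rightarrow> ('g, 'm) monoid_scheme \<Rightarrow> ('g + 'g) list set"
  where "amalg_words A B = lists (carrier A <+> carrier B)"

inductive amalg_cong ::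
  "('g, 'm) monoid_scheme \<Rightarrow> ('g, 'm) monoid_scheme \<Rightarrow> 'g set
    \<Rightarrow> ('g + 'g) list \<Rightarrow> ('g + 'g) list \<Rightarrow> bool" for A B C where
  refl: "u \<in> amalg_words A B \<Longrightarrow> amalg_cong A B C u u"
| sym: "amalg_cong A B C u v \<Longrightarrow> amalg_cong A B C v u"
| trans: "amalg_cong A B C u v \<Longrightarrow> amalg_cong A B C v w \<Longrightarrow> amalg_cong A B C u w"
| append: "amalg_cong A B C u v \<Longrightarrow> amalg_cong A B C u' v' \<Longrightarrow> amalg_cong A B C (u @ u') (v @ v')"
| one_left: "amalg_cong A B C [Inl \<one>\<^bsub>A\<^esub>] []"
| one_right: "amalg_cong A B C [Inr \<one>\<^bsub>B\<^esub>] []"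
| mult_left: "a \<in> carrier A \<Longrightarrow> a' \<in> carrier A \<Longrightarrow>
    amalg_cong A B C [Inl a, Inl a'] [Inl (a \<otimes>\<^bsub>A\<^esub> a')]"
| mult_right: "b \<in> carrier B \<Longrightarrow> b' \<in> carrier B \<Longrightarrow>
    amalg_cong A B C [Inr b, Inr b'] [Inr (b \<otimes>\<^bsub>B\<^esub> b')]"
| amalg: "c \<in> C \<Longrightarrow> amalg_cong A B C [Inl c] [Inr c]"

definition amalg_class ::
  "('g, 'm) monoid_scheme \<Rightarrow> ('g, 'm) monoid_scheme \<Rightarrow> 'g set \<Rightarrow> ('g + 'g) list
    \<Rightarrow> ('g + 'g) list set" where
  "amalg_class A B C u = {v. amalg_cong A B C u v}"

definition amalg_product ::
  "('g, 'm) monoid_scheme \<Rightarrow> ('g, 'm) monoid_scheme \<Rightarrow> 'g set \<Rightarrow> ('g + 'g) list set monoid" where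
  "amalg_product A B C =
     \<lparr>carrier = amalg_class A B C ` amalg_words A B,
      mult = (\<lambda>U V. \<Union>u\<in>U. \<Union>v\<in>V. amalg_class A B C (u @ v)),
      one = amalg_class A B C []\<rparr>"

lemma amalg_class_eq:
  assumes "amalg_cong A B C u v"
  shows "amalg_class A B C u = amalg_class A B C v"
  unfolding amalg_class_def
  using amalg_cong.trans[OF assms] amalg_cong.trans[OF amalg_cong.sym[OF assms]] by blast

lemma amalg_product_mult:
  assumes "u \<in> amalg_words A B" "v \<in> amalg_words A B"
  shows "amalg_class A B C u \<otimes>\<^bsub>amalg_product A B C\<^esub> amalg_class A B C v = amalg_class A B C (u @ v)"
proof -
  have eq: "amalg_class A B C (u' @ v') = amalg_class A B C (u @ v)"
    if "u' \<in> amalg_class A B C u" "v' \<in> amalg_class A B C v" for u' v'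
  proof -
    have "amalg_cong A B C u u'" "amalg_cong A B C v v'"
      using that by (simp_all add: amalg_class_def)
    then show ?thesis
      by (rule amalg_class_eq[OF amalg_cong.append, symmetric])
  qed
  have "u \<in> amalg_class A B C u" "v \<in> amalg_class A B C v"
    using assms by (simp_all add: amalg_class_def amalg_cong.refl)
  then have "(\<Union>u'\<in>amalg_class A B C u. \<Union>v'\<in>amalg_class A B C v. amalg_class A B C (u' @ v'))
      = amalg_class A B C (u @ v)"
    using eq by blast
  then show ?thesis by (simp add: amalg_product_def)
qed

lemma group_amalg_product:
  assumes "group A" "group B"
  shows "group (amalg_product A B C)"
proof (rule groupI)
  let ?P = "amalg_product A B C" and ?c = "amalg_class A B C" and ?W = "amalg_words A B"
  interpret A: group A by fact
  interpret B: group B by fact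
  have car: "carrier ?P = ?c ` ?W" and one: "\<one>\<^bsub>?P\<^esub> = ?c []"
    by (simp_all add: amalg_product_def)
  have app: "u @ v \<in> ?W" if "u \<in> ?W" "v \<in> ?W" for u v
    using that by (auto simp: amalg_words_def)
  have nil: "[] \<in> ?W" by (simp add: amalg_words_def)
  show "x \<otimes>\<^bsub>?P\<^esub> y \<in> carrier ?P" if "x \<in> carrier ?P" "y \<in> carrier ?P" for x y
    using that by (auto simp: car amalg_product_mult app)
  show "\<one>\<^bsub>?P\<^esub> \<in> carrier ?P" by (simp add: car one nil)
  show "x \<otimes>\<^bsub>?P\<^esub> y \<otimes>\<^bsub>?P\<^esub> z = x \<otimes>\<^bsub>?P\<^esub> (y \<otimes>\<^bsub>?P\<^esub> z)"
    if "x \<in> carrier ?P" "y \<in> carrier ?P" "z \<in> carrier ?P" for x y z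
    using that by (auto simp: car amalg_product_mult app)
  show "\<one>\<^bsub>?P\<^esub> \<otimes>\<^bsub>?P\<^esub> x = x" if "x \<in> carrier ?P" for x
    using that by (auto simp: car one amalg_product_mult nil)
  have linv: "\<exists>u'\<in>?W. amalg_cong A B C (u' @ u) []" if "u \<in> ?W" for u
    using that unfolding amalg_words_def
  proof (induction u rule: lists.induct)
    case Nil
    then show ?case by (auto intro!: bexI[of _ "[]"] amalg_cong.refl simp: amalg_words_def)
  next
    case (Cons l u)
    then obtain u' where u': "u' \<in> ?W" "amalg_cong A B C (u' @ u) []" and u: "u \<in> ?W"
      by (auto simp: amalg_words_def)
    have "\<exists>l'\<in>carrier A <+> carrier B. amalg_cong A B C [l', l] []"
    proof (cases l)
      case (Inl a)
      then have a: "a \<in> carrier A" using Cons.hyps by auto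
      then have "amalg_cong A B C [Inl (inv\<^bsub>A\<^esub> a), Inl a] [Inl \<one>\<^bsub>A\<^esub>]"
        using amalg_cong.mult_left[of "inv\<^bsub>A\<^esub> a" A a B C] by simp
      then have "amalg_cong A B C [Inl (inv\<^bsub>A\<^esub> a), Inl a] []"
        by (rule amalg_cong.trans[OF _ amalg_cong.one_left])
      then show ?thesis using a Inl by (intro bexI[of _ "Inl (inv\<^bsub>A\<^esub> a)"]) auto
    next
      case (Inr b)
      then have b: "b \<in> carrier B" using Cons.hyps by auto
      then have "amalg_cong A B C [Inr (inv\<^bsub>B\<^esub> b), Inr b] [Inr \<one>\<^bsub>B\<^esub>]"
        using amalg_cong.mult_right[of "inv\<^bsub>B\<^esub> b" B b A C] by simp
      then have "amalg_cong A B C [Inr (inv\<^bsub>B\<^esub> b), Inr b] []"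
        by (rule amalg_cong.trans[OF _ amalg_cong.one_right])
      then show ?thesis using b Inr by (intro bexI[of _ "Inr (inv\<^bsub>B\<^esub> b)"]) auto
    qed
    then obtain l' where l': "l' \<in> carrier A <+> carrier B" "amalg_cong A B C [l', l] []" by blast
    have "amalg_cong A B C (u' @ [l', l] @ u) (u' @ [] @ u)"
      using u u' l' by (intro amalg_cong.append amalg_cong.refl) auto
    then have "amalg_cong A B C ((u' @ [l']) @ l # u) []"
      using amalg_cong.trans[OF _ u'(2)] by simp
    moreover have "u' @ [l'] \<in> ?W" using u' l' by (auto simp: amalg_words_def)
    ultimately show ?case unfolding amalg_words_def by blast
  qed
  have inv: "\<exists>u'\<in>?W. ?c u' \<otimes>\<^bsub>?P\<^esub> ?c u = \<one>\<^bsub>?P\<^esub>" if "u \<in> ?W" for u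
  proof -
    obtain u' where u': "u' \<in> ?W" "amalg_cong A B C (u' @ u) []"
      using linv[OF \<open>u \<in> ?W\<close>] by blast
    then have "?c u' \<otimes>\<^bsub>?P\<^esub> ?c u = \<one>\<^bsub>?P\<^esub>"
      by (simp only: amalg_product_mult[OF u'(1) that] one amalg_class_eq[OF u'(2)])
    with u'(1) show ?thesis by blast
  qed
  show "\<exists>y\<in>carrier ?P. y \<otimes>\<^bsub>?P\<^esub> x = \<one>\<^bsub>?P\<^esub>" if x: "x \<in> carrier ?P" for x
  proof -
    obtain u where u: "u \<in> ?W" "x = ?c u" using x unfolding car by blast
    then show ?thesis using inv[OF u(1)] unfolding car by blast
  qed
qed

text \<open>\<open>K\<close> is the internal amalgamated free product of its subgroups \<open>A\<close> and \<open>B\<close> over \<open>C\<close>: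
  the inclusions extend to an isomorphism from the abstract amalgamated product.\<close>
definition is_amalgamated_product ::
  "('g, 'm) monoid_scheme \<Rightarrow> 'g set \<Rightarrow> 'g set \<Rightarrow> 'g set \<Rightarrow> bool" where
  "is_amalgamated_product K A B C \<longleftrightarrow>
     subgroup A K \<and> subgroup B K \<and> subgroup C K \<and> C \<subseteq> A \<and> C \<subseteq> B \<and>
     (let KA = K\<lparr>carrier := A\<rparr>; KB = K\<lparr>carrier := B\<rparr>
      in \<exists>f \<in> iso (amalg_product KA KB C) K.
           (\<forall>a\<in>A. f (amalg_class KA KB C [Inl a]) = a) \<and>
           (\<forall>b\<in>B. f (amalg_class KA KB C [Inr b]) = b))"


section \<open>Groups acting on trees\<close>

definition auts :: "('v, 'a) arc_graph \<Rightarrow> ('v \<Rightarrow> 'v) set" where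
  "auts T = {g \<in> Bij (verts T). \<forall>v\<in>verts T. \<forall>w\<in>verts T.
     (g v, g w) \<in> adj_rel T \<longleftrightarrow> (v, w) \<in> adj_rel T}"

definition aut_group :: "('v, 'a) arc_graph \<Rightarrow> ('v \<Rightarrow> 'v) monoid" where
  "aut_group T = (BijGroup (verts T))\<lparr>carrier := auts T\<rparr>"

abbreviation grp :: "('v, 'a) arc_graph \<Rightarrow> ('v \<Rightarrow> 'v) set \<Rightarrow> ('v \<Rightarrow> 'v) monoid" where
  "grp T G \<equiv> (aut_group T)\<lparr>carrier := G\<rparr>"

text \<open>A tree has no multiple edges, so an automorphism (a permutation of the vertices)
  determines the image of every arc.\<close>
definition arc_act :: "('v, 'a) arc_graph \<Rightarrow> ('v \<Rightarrow> 'v) \<Rightarrow> 'a \<Rightarrow> 'a" where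
  "arc_act T g a =
     (THE b. b \<in> arcs T \<and> orig T b = g (orig T a) \<and> term_of T b = g (term_of T a))"

lemma arc_act:
  assumes "is_tree T" "g \<in> auts T" "a \<in> arcs T"
  shows "arc_act T g a \<in> arcs T" "orig T (arc_act T g a) = g (orig T a)"
    "term_of T (arc_act T g a) = g (term_of T a)"
proof -
  have "(orig T a, term_of T a) \<in> adj_rel T" using assms(3) by (auto simp: adj_rel_def)
  moreover have "orig T a \<in> verts T" "term_of T a \<in> verts T"
    using assms(1,3) unfolding is_tree_def is_graph_def term_of_def by auto
  ultimately have "(g (orig T a), g (term_of T a)) \<in> adj_rel T"
    using assms(2) by (auto simp: auts_def)
  then have "\<exists>!b. b \<in> arcs T \<and> orig T b = g (orig T a) \<and> term_of T b = g (term_of T a)"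
    using assms(1) unfolding adj_rel_def is_tree_def by force
  from theI'[OF this]
  show "arc_act T g a \<in> arcs T" "orig T (arc_act T g a) = g (orig T a)"
    "term_of T (arc_act T g a) = g (term_of T a)"
    unfolding arc_act_def by auto
qed

abbreviation vorbit :: "('v, 'a) arc_graph \<Rightarrow> ('v \<Rightarrow> 'v) set \<Rightarrow> 'v \<Rightarrow> 'v set" where
  "vorbit T G \<equiv> orbit (grp T G) (\<lambda>g. g)"

abbreviation vstab :: "('v, 'a) arc_graph \<Rightarrow> ('v \<Rightarrow> 'v) set \<Rightarrow> 'v \<Rightarrow> ('v \<Rightarrow> 'v) set" where
  "vstab T G \<equiv> stabilizer (grp T G) (\<lambda>g. g)"

abbreviation aorbit :: "('v, 'a) arc_graph \<Rightarrow> ('v \<Rightarrow> 'v) set \<Rightarrow> 'a \<Rightarrow> 'a set" where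
  "aorbit T G \<equiv> orbit (grp T G) (arc_act T)"

abbreviation astab :: "('v, 'a) arc_graph \<Rightarrow> ('v \<Rightarrow> 'v) set \<Rightarrow> 'a \<Rightarrow> ('v \<Rightarrow> 'v) set" where
  "astab T G \<equiv> stabilizer (grp T G) (arc_act T)"

definition group_topology :: "('v, 'a) arc_graph \<Rightarrow> ('v \<Rightarrow> 'v) set \<Rightarrow> ('v \<Rightarrow> 'v) topology" where
  "group_topology T G = subtopology (perm_topology (verts T)) G"

definition nondiscrete :: "('v, 'a) arc_graph \<Rightarrow> ('v \<Rightarrow> 'v) set \<Rightarrow> bool" where
  "nondiscrete T G \<longleftrightarrow> group_topology T G \<noteq> discrete_topology G"

definition property_P :: "('v, 'a) arc_graph \<Rightarrow> ('v \<Rightarrow> 'v) set \<Rightarrow> bool" where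
  "property_P T G \<longleftrightarrow>
     (\<forall>L. is_simple_path T L \<longrightarrow>
       (let fibre = (\<lambda>x. {v \<in> verts T. closest_point T L v = x});
            \<phi> = (\<lambda>x g. restrict g (fibre x))
        in (\<lambda>g. \<lambda>x\<in>L. \<phi> x g) ` fixator G L = (\<Pi>\<^sub>E x\<in>L. \<phi> x ` fixator G L)))"

definition P_closed :: "('v, 'a) arc_graph \<Rightarrow> ('v \<Rightarrow> 'v) set \<Rightarrow> bool" where
  "P_closed T G \<longleftrightarrow> closedin (group_topology T (auts T)) G \<and> property_P T G"

definition bounded_action :: "('v, 'a) arc_graph \<Rightarrow> ('v \<Rightarrow> 'v) set \<Rightarrow> bool" where
  "bounded_action T H \<longleftrightarrow>
     (\<forall>v\<in>verts T. \<exists>n. \<forall>x\<in>vorbit T H v. \<forall>y\<in>vorbit T H v. gdist T x y \<le> n)"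

definition preserves :: "('v, 'a) arc_graph \<Rightarrow> ('v \<Rightarrow> 'v) set \<Rightarrow> ('v, 'a) arc_graph \<Rightarrow> bool" where
  "preserves T G S \<longleftrightarrow> (\<forall>g\<in>G. g ` verts S = verts S \<and> arc_act T g ` arcs S = arcs S)"

definition preserves_no_proper_subtree :: "('v, 'a) arc_graph \<Rightarrow> ('v \<Rightarrow> 'v) set \<Rightarrow> bool" where
  "preserves_no_proper_subtree T G \<longleftrightarrow> \<not> (\<exists>S. is_proper_subtree S T \<and> preserves T G S)"

definition fixes_end :: "('v, 'a) arc_graph \<Rightarrow> ('v \<Rightarrow> 'v) set \<Rightarrow> (nat \<Rightarrow> 'v) set \<Rightarrow> bool" where
  "fixes_end T G e \<longleftrightarrow> (\<forall>g\<in>G. (\<lambda>r. g \<circ> r) ` e = e)"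

definition geometrically_dense :: "('v, 'a) arc_graph \<Rightarrow> ('v \<Rightarrow> 'v) set \<Rightarrow> bool" where
  "geometrically_dense T G \<longleftrightarrow>
     preserves_no_proper_subtree T G \<and> \<not> (\<exists>e\<in>ends T. fixes_end T G e)"

text \<open>The origin (reverse) of an orbit of arcs is the orbit formed by the origins (reverses) of
  its members, so both maps are images.\<close>
definition quotient_graph ::
  "('v, 'a) arc_graph \<Rightarrow> ('v \<Rightarrow> 'v) set \<Rightarrow> ('v set, 'a set) arc_graph" where
  "quotient_graph T G =
     \<lparr>verts = orbits (grp T G) (verts T) (\<lambda>g. g),
      arcs = orbits (grp T G) (arcs T) (arc_act T),
      orig = (\<lambda>A. orig T ` A),
      opp = (\<lambda>A. opp T ` A)\<rparr>"

lemma quotient_graph_orig: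
  assumes "is_tree T" "G \<subseteq> auts T" "a \<in> arcs T"
  shows "orig (quotient_graph T G) (aorbit T G a) = vorbit T G (orig T a)"
  using arc_act(2)[OF assms(1) _ assms(3)] assms(2)
  by (force simp: quotient_graph_def orbit_def)

lemma arc_act_opp:
  assumes "is_tree T" "g \<in> auts T" "a \<in> arcs T"
  shows "arc_act T g (opp T a) = opp T (arc_act T g a)"
proof -
  have G: "is_graph T" using assms(1) by (simp add: is_tree_def)
  have oa: "opp T a \<in> arcs T" "opp T (opp T a) = a"
    using G assms(3) by (auto simp: is_graph_def)
  let ?b = "arc_act T g a" and ?b' = "arc_act T g (opp T a)"
  have b: "opp T ?b \<in> arcs T" "opp T (opp T ?b) = ?b"
    using G arc_act(1)[OF assms] by (auto simp: is_graph_def)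
  have "orig T ?b' = orig T (opp T ?b)" "term_of T ?b' = term_of T (opp T ?b)"
    using arc_act[OF assms] arc_act[OF assms(1,2) oa(1)] oa b by (simp_all add: term_of_def)
  then show ?thesis
    using assms(1) b(1) arc_act(1)[OF assms(1,2) oa(1)] unfolding is_tree_def by blast
qed

lemma quotient_graph_opp:
  assumes "is_tree T" "G \<subseteq> auts T" "a \<in> arcs T"
  shows "opp (quotient_graph T G) (aorbit T G a) = aorbit T G (opp T a)"
  using arc_act_opp[OF assms(1) _ assms(3)] assms(2)
  by (force simp: quotient_graph_def orbit_def)

definition is_single_edge :: "('v, 'a) arc_graph \<Rightarrow> bool" where
  "is_single_edge \<Gamma> \<longleftrightarrow>
     (\<exists>x y a. x \<noteq> y \<and> verts \<Gamma> = {x, y} \<and> arcs \<Gamma> = {a, opp \<Gamma> a} \<and> opp \<Gamma> (opp \<Gamma> a) = a \<and>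
        orig \<Gamma> a = x \<and> term_of \<Gamma> a = y)"


section \<open>Local action diagrams\<close>

record ('v, 'a, 'x) local_action_diagram =
  base_graph :: "('v, 'a) arc_graph"
  colour_set :: "'a \<Rightarrow> 'x set"
  local_action :: "'v \<Rightarrow> ('x \<Rightarrow> 'x) set"

definition vertex_colours :: "('v, 'a, 'x) local_action_diagram \<Rightarrow> 'v \<Rightarrow> 'x set" where
  "vertex_colours \<Delta> v = (\<Union>a\<in>out_arcs (base_graph \<Delta>) v. colour_set \<Delta> a)"

definition is_transversal :: "('v, 'a) arc_graph \<Rightarrow> ('v \<Rightarrow> 'v) set \<Rightarrow> ('v set \<Rightarrow> 'v) \<Rightarrow> bool" where
  "is_transversal T G s \<longleftrightarrow>
     (\<forall>v\<in>verts (quotient_graph T G). s v \<in> verts T \<and> vorbit T G (s v) = v)"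

text \<open>\<open>s v\<close> is the chosen preimage \<open>v\<^sup>*\<close> of the vertex \<open>v\<close> of the quotient graph.\<close>
definition diagram_of ::
  "('v, 'a) arc_graph \<Rightarrow> ('v \<Rightarrow> 'v) set \<Rightarrow> ('v set \<Rightarrow> 'v)
    \<Rightarrow> ('v set, 'a set, 'a) local_action_diagram" where
  "diagram_of T G s =
     \<lparr>base_graph = quotient_graph T G,
      colour_set =
        (\<lambda>a. {b \<in> out_arcs T (s (orig (quotient_graph T G) a)). aorbit T G b = a}),
      local_action =
        (\<lambda>v. let X = out_arcs T (s v)
             in perm_topology X closure_of
                  ((\<lambda>g. restrict (arc_act T g) X) ` vstab T G (s v)))\<rparr>"

lemma vertex_colours_diagram_of:
  assumes "is_tree T" "G \<subseteq> auts T" "is_transversal T G s" "v \<in> verts (quotient_graph T G)"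
  shows "vertex_colours (diagram_of T G s) v = out_arcs T (s v)"
proof -
  have "vorbit T G (s v) = v" using assms(3,4) by (simp add: is_transversal_def)
  then have "orig (quotient_graph T G) (aorbit T G b) = v" if "b \<in> out_arcs T (s v)" for b
    using that quotient_graph_orig[OF assms(1,2), of b] by (auto simp: out_arcs_def)
  moreover have "aorbit T G b \<in> arcs (quotient_graph T G)" if "b \<in> out_arcs T (s v)" for b
    using that by (auto simp: quotient_graph_def orbits_def out_arcs_def)
  ultimately show ?thesis
    by (force simp: vertex_colours_def diagram_of_def out_arcs_def)
qed

end

theory Submission
  imports Defs
begin

text \<open>
  Everything about \<open>T\<close> is expressed through the half-trees at an edge. By independence, the
  stabiliser of an edge is the product of the fixators of its two half-trees.

  If two adjacent stabilisers are distinct and maximal, they generate \<open>G\<close>, so the orbits of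
  their vertices are the parts of the bipartition, with primitive action. Primitivity on the parts
  forces primitive local actions, because an invariant structure on the star of a vertex spreads
  to one of the parts; a regular local action would yield an invariant colouring. Conversely, a
  primitive nonregular local action and independence at an edge provide an element fixing the far
  end of a path and moving its start to another vertex at distance 2, so a nontrivial invariant
  relation on a part contains all pairs at distance 2. An open subgroup with unbounded orbits
  contains the stabilisers of consecutive edges on a path, hence two adjacent vertex stabilisers;
  a bounded overgroup of a vertex stabiliser preserves the centre of an orbit, which is a vertex
  or an edge.

  A nontrivial normal subgroup is transitive on both parts and therefore contains a translation;
  every element supported on a suitable half-tree is a commutator with this translation.
\<close>

section \<open>Permutation groups\<close>

text \<open>Nonregularity is used through one fact about a primitive group: points with equal
  stabilisers form an invariant relation, so once some stabiliser moves a further point, no two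
  points share their stabiliser, and maximality makes each stabiliser move every other point. This
  is what lets two edge stabilisers at a vertex generate the vertex stabiliser. The colouring in the
  regular case needs compatible choices of group elements at all vertices; cycles would obstruct
  them, whereas in a tree they can be made outwards from a root. Parity of distances has two tasks:
  vertex stabilisers generate only elements of even displacement, which makes the parts invariant,
  and an element fixing a vertex cannot exchange two adjacent vertices, so a stabiliser preserving a
  centre that is an edge fixes both its ends. Closedness of \<open>G\<close> is what admits the
  infinite product behind the commutator. A half-tree is a component left by deleting one edge;
  additivity of distance across that edge replaces most arguments with geodesics.\<close>

lemma BijGroup_simps:
  "carrier (BijGroup X) = Bij X" "\<one>\<^bsub>BijGroup X\<^esub> = (\<lambda>x\<in>X. x)"
  "g \<in> Bij X \<Longrightarrow> h \<in> Bij X \<Longrightarrow> g \<otimes>\<^bsub>BijGroup X\<^esub> h = compose X g h"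
  by (simp_all add: BijGroup_def)

lemma primitive_on_restrict: "primitive_on X ((\<lambda>g. restrict g X) ` A) \<longleftrightarrow> primitive_on X A"
proof -
  have "equiv X R \<and> (\<forall>h\<in>(\<lambda>g. restrict g X) ` A. \<forall>(x, y)\<in>R. (h x, h y) \<in> R) \<longleftrightarrow>
      equiv X R \<and> (\<forall>h\<in>A. \<forall>(x, y)\<in>R. (h x, h y) \<in> R)" for R
    unfolding equiv_def by fastforce
  moreover have "transitive_on X ((\<lambda>g. restrict g X) ` A) \<longleftrightarrow> transitive_on X A"
    by (auto simp: transitive_on_def)
  ultimately show ?thesis unfolding primitive_on_def by (simp only:)
qed

text \<open>The permutations that agree with \<open>g\<close> on \<open>F\<close> form an open
  neighbourhood of \<open>g\<close>, so \<open>H\<close> meets it.\<close>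

lemma closure_perm_agree:
  assumes "g \<in> perm_topology X closure_of H" "finite F" "F \<subseteq> X"
  obtains h where "h \<in> H" "\<And>x. x \<in> F \<Longrightarrow> h x = g x"
proof -
  have g: "g \<in> Bij X" using assms(1) by (simp add: in_closure_of)
  let ?U = "{k \<in> Bij X. \<forall>x\<in>F. k x = g x}"
  have op: "openin (perm_topology X) ?U"
    unfolding openin_perm_topology
  proof (intro conjI ballI)
    fix k assume k: "k \<in> ?U"
    have "k <#\<^bsub>BijGroup X\<^esub> fixator (Bij X) F \<subseteq> ?U"
      using k assms(3) by (auto simp: l_coset_def fixator_def BijGroup_def compose_Bij compose_eq subset_iff)
    then show "\<exists>F. finite F \<and> F \<subseteq> X \<and> k <#\<^bsub>BijGroup X\<^esub> fixator (Bij X) F \<subseteq> ?U"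
      using assms by blast
  qed auto
  have "g \<in> ?U" using g by simp
  then have "\<exists>h. h \<in> H \<and> h \<in> ?U"
    using assms(1)[unfolded in_closure_of, THEN conjunct2, rule_format, OF conjI[OF _ op]] by blast
  then show ?thesis using that by blast
qed

lemma primitive_on_mono: "primitive_on X H \<Longrightarrow> H \<subseteq> H' \<Longrightarrow> primitive_on X H'"
  unfolding primitive_on_def transitive_on_def by (meson subsetD)

text \<open>Transitivity concerns the image of one point and invariance of a relation the images of
  two, and on finitely many points the closure cannot be told from \<open>H\<close>.\<close>

lemma primitive_on_closure:
  assumes "H \<subseteq> Bij X"
  shows "primitive_on X (perm_topology X closure_of H) \<longleftrightarrow> primitive_on X H"
proof
  let ?C = "perm_topology X closure_of H"
  show "primitive_on X ?C" if "primitive_on X H"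
    using primitive_on_mono[OF that] closure_of_subset[of H "perm_topology X"] assms by simp
  assume C: "primitive_on X ?C"
  show "primitive_on X H"
    unfolding primitive_on_def
  proof (intro conjI allI impI)
    show "transitive_on X H"
      unfolding transitive_on_def
    proof (intro ballI)
      fix x y assume xy: "x \<in> X" "y \<in> X"
      then have "\<exists>g\<in>?C. g x = y" using C unfolding primitive_on_def transitive_on_def by blast
      then obtain g where g: "g \<in> ?C" "g x = y" by blast
      obtain h where "h \<in> H" "h x = g x" by (rule closure_perm_agree[OF g(1), of "{x}"]) (use xy in auto)
      then show "\<exists>h\<in>H. h x = y" using g by auto
    qed
    fix R assume R: "equiv X R \<and> (\<forall>h\<in>H. \<forall>(x, y)\<in>R. (h x, h y) \<in> R)"
    have "\<forall>g\<in>?C. \<forall>(x, y)\<in>R. (g x, g y) \<in> R"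
    proof clarify
      fix g x y assume g: "g \<in> ?C" and xy: "(x, y) \<in> R"
      have "x \<in> X" "y \<in> X" using R xy unfolding equiv_def by auto
      then have sub: "{x, y} \<subseteq> X" by simp
      obtain h where h: "h \<in> H" "\<And>z. z \<in> {x, y} \<Longrightarrow> h z = g z"
        by (rule closure_perm_agree[OF g _ sub]) auto
      have "(h x, h y) \<in> R" using R xy h(1) by blast
      then show "(g x, g y) \<in> R" using h by simp
    qed
    then show "R = Id_on X \<or> R = X \<times> X" using C R unfolding primitive_on_def by blast
  qed
qed

text \<open>Fixing \<open>x\<close> while moving \<open>y\<close> is visible on two points, so an
  element of the closure doing this is matched by one of \<open>H\<close>. This turns regularity of
  the closed local action into a statement about \<open>H\<close> alone.\<close>

lemma regular_on_closure:
  assumes H: "H \<subseteq> Bij X" "(\<lambda>x\<in>X. x) \<in> H" and tr: "transitive_on X H"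
  shows "regular_on X (perm_topology X closure_of H) \<longleftrightarrow> (\<forall>h\<in>H. \<forall>x\<in>X. \<forall>y\<in>X. h x = x \<longrightarrow> h y = y)"
proof
  let ?C = "perm_topology X closure_of H"
  have HC: "H \<subseteq> ?C" using closure_of_subset[of H "perm_topology X"] H by simp
  show "\<forall>h\<in>H. \<forall>x\<in>X. \<forall>y\<in>X. h x = x \<longrightarrow> h y = y" if "regular_on X ?C"
  proof (intro ballI impI)
    fix h x y assume *: "h \<in> H" "x \<in> X" "y \<in> X" "h x = x"
    then have "h \<in> {h \<in> ?C. h x = x}" using HC by blast
    then have "h \<in> {\<lambda>x\<in>X. x}" using that *(2) unfolding regular_on_def by blast
    then show "h y = y" using * by simp
  qed
  assume rig: "\<forall>h\<in>H. \<forall>x\<in>X. \<forall>y\<in>X. h x = x \<longrightarrow> h y = y"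
  have "{g \<in> ?C. g x = x} = {\<lambda>x\<in>X. x}" if x: "x \<in> X" for x
  proof
    show "{\<lambda>x\<in>X. x} \<subseteq> {g \<in> ?C. g x = x}" using HC H x by auto
    show "{g \<in> ?C. g x = x} \<subseteq> {\<lambda>x\<in>X. x}"
    proof clarify
      fix g assume g: "g \<in> ?C" "g x = x"
      have "g \<in> Bij X" using g(1) by (simp add: in_closure_of)
      then have "g \<in> extensional X" by (rule Bij_imp_extensional)
      moreover have "g y = y" if y: "y \<in> X" for y
      proof -
        obtain h where "h \<in> H" "\<And>z. z \<in> {x, y} \<Longrightarrow> h z = g z"
          by (rule closure_perm_agree[OF g(1), of "{x, y}"]) (use x y in auto)
        then show ?thesis using rig x y g(2) by (metis insertCI)
      qed
      ultimately show "g = (\<lambda>x\<in>X. x)" by (auto intro: extensionalityI[of _ X])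
    qed
  qed
  moreover have "transitive_on X ?C" using tr HC unfolding transitive_on_def by blast
  ultimately show "regular_on X ?C" by (simp add: regular_on_def)
qed

text \<open>An invariant relation on \<open>Y\<close> pulls back along \<open>\<beta>\<close> to one
  on \<open>X\<close>. Both actions are merely families indexed by \<open>K\<close>, so the lemma
  serves equally for arcs against neighbours and for conjugation between two stars.\<close>

lemma primitive_on_transfer:
  assumes Y: "Y = \<beta> ` X"
    and eqv: "\<And>k x. k \<in> K \<Longrightarrow> x \<in> X \<Longrightarrow> h k x \<in> X \<and> \<beta> (h k x) = g k (\<beta> x)"
    and prim: "primitive_on X (h ` K)"
  shows "primitive_on Y (g ` K)"
  unfolding primitive_on_def
proof (intro conjI allI impI)
  show "transitive_on Y (g ` K)"
    unfolding transitive_on_def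
  proof (intro ballI)
    fix y y' assume "y \<in> Y" "y' \<in> Y"
    then obtain x x' where x: "x \<in> X" "x' \<in> X" "y = \<beta> x" "y' = \<beta> x'" unfolding Y by blast
    then have "\<exists>k\<in>K. h k x = x'" using prim unfolding primitive_on_def transitive_on_def by blast
    then obtain k where k: "k \<in> K" "h k x = x'" by blast
    have "g k y = y'" using eqv[OF k(1) x(1)] k(2) x(3,4) by simp
    then show "\<exists>f\<in>g ` K. f y = y'" using k(1) by blast
  qed
  fix R assume R: "equiv Y R \<and> (\<forall>f\<in>g ` K. \<forall>(x, y)\<in>R. (f x, f y) \<in> R)"
  have RE: "R \<subseteq> Y \<times> Y" "refl_on Y R" "sym R" "trans R" using R by (simp_all add: equiv_def)
  define R' where "R' = {(x, x'). x \<in> X \<and> x' \<in> X \<and> (\<beta> x, \<beta> x') \<in> R}"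
  have "equiv X R'"
  proof (rule equivI)
    show "refl_on X R'" using RE(2) Y by (auto simp: R'_def refl_on_def)
    show "sym R'" using RE(3) by (auto simp: R'_def sym_def)
    show "trans R'" using RE(4) unfolding R'_def trans_def by blast
  qed (auto simp: R'_def)
  moreover have "\<forall>f\<in>h ` K. \<forall>(x, y)\<in>R'. (f x, f y) \<in> R'"
  proof clarify
    fix k x y assume k: "k \<in> K" and "(x, y) \<in> R'"
    then have xy: "x \<in> X" "y \<in> X" "(\<beta> x, \<beta> y) \<in> R" by (auto simp: R'_def)
    then have "(g k (\<beta> x), g k (\<beta> y)) \<in> R" using R k by blast
    then show "(h k x, h k y) \<in> R'" using eqv[OF k xy(1)] eqv[OF k xy(2)] by (simp add: R'_def)
  qed
  ultimately have "R' = Id_on X \<or> R' = X \<times> X" using prim unfolding primitive_on_def by blast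
  then show "R = Id_on Y \<or> R = Y \<times> Y"
  proof
    assume R': "R' = Id_on X"
    have "y = y'" if yy: "(y, y') \<in> R" for y y'
    proof -
      obtain x x' where x: "x \<in> X" "x' \<in> X" "y = \<beta> x" "y' = \<beta> x'" using yy RE(1) unfolding Y by blast
      then have "(x, x') \<in> R'" using yy by (simp add: R'_def)
      then show ?thesis using R' x by auto
    qed
    then have "R = Id_on Y" using RE(1,2) by (auto simp: refl_on_def Id_on_def)
    then show ?thesis ..
  next
    assume R': "R' = X \<times> X"
    have "(y, y') \<in> R" if yy: "y \<in> Y" "y' \<in> Y" for y y'
    proof -
      obtain x x' where x: "x \<in> X" "x' \<in> X" "y = \<beta> x" "y' = \<beta> x'" using yy unfolding Y by blast
      then have "(x, x') \<in> R'" using R' by simp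
      then show ?thesis using x by (simp add: R'_def)
    qed
    then show ?thesis using RE(1) by blast
  qed
qed

section \<open>Half-trees and distances\<close>

text \<open>The component of \<open>y\<close> after deleting the edge between \<open>x\<close> and
  \<open>y\<close> in both directions: the second vertex names the side.\<close>

definition half :: "('v, 'a) arc_graph \<Rightarrow> 'v \<Rightarrow> 'v \<Rightarrow> 'v set" where
  "half T x y = {z. (y, z) \<in> (adj_rel T - {(x, y), (y, x)})\<^sup>*}"

lemma half_refl [simp]: "y \<in> half T x y"
  by (simp add: half_def)

lemma half_step: "z \<in> half T x y \<Longrightarrow> (z, z') \<in> adj_rel T \<Longrightarrow> z' \<in> half T x y \<or> {z, z'} = {x, y}"
  unfolding half_def by (auto intro: rtrancl_into_rtrancl)

locale tree_graph =
  fixes T :: "('v, 'a) arc_graph"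
  assumes tree: "is_tree T"
begin

abbreviation "V \<equiv> verts T"
abbreviation "E \<equiv> adj_rel T"
abbreviation "d \<equiv> gdist T"

lemma adj_verts: "(x, y) \<in> E \<Longrightarrow> x \<in> V" "(x, y) \<in> E \<Longrightarrow> y \<in> V"
  using tree unfolding is_tree_def is_graph_def adj_rel_def term_of_def by auto

lemma adj_sym: "(x, y) \<in> E \<Longrightarrow> (y, x) \<in> E"
proof -
  assume "(x, y) \<in> E"
  then obtain a where a: "a \<in> arcs T" "x = orig T a" "y = term_of T a" by (auto simp: adj_rel_def)
  have "opp T a \<in> arcs T" "opp T (opp T a) = a"
    using tree a unfolding is_tree_def is_graph_def by auto
  then show ?thesis using a by (auto simp: adj_rel_def term_of_def intro!: exI[of _ "opp T a"])
qed

lemma adj_neq: "(x, y) \<in> E \<Longrightarrow> x \<noteq> y"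
  using tree unfolding is_tree_def adj_rel_def by auto

lemma connected: "x \<in> V \<Longrightarrow> y \<in> V \<Longrightarrow> (x, y) \<in> E\<^sup>*"
  using tree unfolding is_tree_def is_connected_def by auto

text \<open>A shortest walk from \<open>y\<close> to \<open>x\<close> avoiding the edge repeats no
  vertex and has at least two steps, so the edge would close it to a cycle.\<close>

lemma bridge:
  assumes "(x, y) \<in> E"
  shows "x \<notin> half T x y"
proof
  let ?R = "E - {(x, y), (y, x)}"
  assume "x \<in> half T x y"
  then obtain k where k: "(y, x) \<in> ?R ^^ k" unfolding half_def by (blast dest: rtrancl_imp_relpow)
  define n where "n = (LEAST n. (y, x) \<in> ?R ^^ n)"
  have n: "(y, x) \<in> ?R ^^ n" unfolding n_def using k by (rule LeastI)
  have min: "n \<le> m" if "(y, x) \<in> ?R ^^ m" for m unfolding n_def using that by (rule Least_le)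
  from n obtain f where f: "f 0 = y" "f n = x" "\<And>i. i < n \<Longrightarrow> (f i, f (Suc i)) \<in> ?R"
    by (auto simp: relpow_fun_conv)
  have seg: "(f i, f j) \<in> ?R ^^ (j - i)" if "i \<le> j" "j \<le> n" for i j
    unfolding relpow_fun_conv using that f(3)
    by (intro exI[of _ "\<lambda>t. f (i + t)"]) auto
  have inj: "f i \<noteq> f j" if "i < j" "j \<le> n" for i j
  proof
    assume eq: "f i = f j"
    have "(y, f i) \<in> ?R ^^ i" "(f i, x) \<in> ?R ^^ (n - j)"
      using seg[of 0 i] seg[of j n] that f eq by auto
    then have "(y, x) \<in> ?R ^^ (i + (n - j))" by (auto simp: relpow_add)
    from min[OF this] that show False by linarith
  qed
  have "n \<noteq> 0" using f adj_neq[OF assms] by (metis)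
  moreover have "n \<noteq> 1"
  proof
    assume "n = 1"
    with f(3)[of 0] f(1,2) show False by simp
  qed
  ultimately have n2: "2 \<le> n" by linarith
  let ?xs = "map f [0..<Suc n]"
  have nth: "?xs ! i = f i" if "i \<le> n" for i
    using that by (metis add_0 diff_zero less_Suc_eq_le nth_map_upt)
  have "is_cycle T ?xs"
    unfolding is_cycle_def
  proof (intro conjI allI impI)
    show "3 \<le> length ?xs" using n2 by simp
    show "distinct ?xs"
      unfolding distinct_map using inj
      by (auto simp: inj_on_def) (metis linorder_neqE_nat le_eq_less_or_eq less_Suc_eq_le)+
    show "(?xs ! i, ?xs ! Suc i) \<in> E" if "Suc i < length ?xs" for i
      using that f(3)[of i] nth[of i] nth[of "Suc i"] by simp
    have "last ?xs = x" using f(2) by simp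
    moreover have "hd ?xs = y" using f(1) by (simp add: hd_map del: upt_Suc)
    ultimately show "(last ?xs, hd ?xs) \<in> E" using assms by simp
  qed
  with tree show False by (auto simp: is_tree_def)
qed

lemma half_verts:
  assumes "(x, y) \<in> E"
  shows "half T x y \<subseteq> V"
proof
  fix z assume "z \<in> half T x y"
  then have "(y, z) \<in> (E - {(x, y), (y, x)})\<^sup>*" by (simp add: half_def)
  then show "z \<in> V" by induction (use adj_verts assms in auto)
qed

text \<open>The deleted edge is the only exit from a half-tree. Most membership claims below amount
  to checking that a step is not this exit.\<close>

lemma half_boundary:
  assumes "(x, y) \<in> E" "z \<in> half T x y" "(z, z') \<in> E" "z' \<notin> half T x y"
  shows "z = y \<and> z' = x"
  using half_step[OF assms(2,3)] assms(4) bridge[OF assms(1)] assms(2) by (auto simp: doubleton_eq_iff)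

lemma half_disjoint:
  assumes "(x, y) \<in> E"
  shows "half T x y \<inter> half T y x = {}"
proof -
  have "z \<notin> half T x y" if "z \<in> half T y x" for z
  proof
    assume z: "z \<in> half T x y"
    have "sym (E - {(x, y), (y, x)})" using adj_sym by (auto simp: sym_def)
    moreover have "(x, z) \<in> (E - {(x, y), (y, x)})\<^sup>*"
      using that by (simp add: half_def insert_commute)
    ultimately have "(z, x) \<in> (E - {(x, y), (y, x)})\<^sup>*"
      by (blast dest: sym_rtrancl symD)
    then have "x \<in> half T x y" using z unfolding half_def by auto
    with bridge[OF assms] show False by simp
  qed
  then show ?thesis by blast
qed

lemma half_union:
  assumes "(x, y) \<in> E"
  shows "half T x y \<union> half T y x = V"
proof
  show "half T x y \<union> half T y x \<subseteq> V" using half_verts assms adj_sym by blast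
  show "V \<subseteq> half T x y \<union> half T y x"
  proof
    fix z assume "z \<in> V"
    then have "(x, z) \<in> E\<^sup>*" using connected adj_verts assms by blast
    then show "z \<in> half T x y \<union> half T y x"
    proof induction
      case (step u w)
      then show ?case using half_step[of u T x y w] half_step[of u T y x w] half_refl
        by (metis Un_iff doubleton_eq_iff)
    qed simp
  qed
qed

lemma not_half_iff: "(x, y) \<in> E \<Longrightarrow> z \<in> V \<Longrightarrow> z \<notin> half T x y \<longleftrightarrow> z \<in> half T y x"
  using half_union half_disjoint by blast

text \<open>A walk that stays in \<open>half T x y\<close> never visits \<open>x\<close>, so it
  cannot use the edge between \<open>u\<close> and \<open>x\<close> either.\<close>

lemma half_mono:
  assumes "(x, y) \<in> E" "(u, x) \<in> E" "u \<noteq> y"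
  shows "half T x y \<subseteq> half T u x"
proof
  fix z assume "z \<in> half T x y"
  then have "(y, z) \<in> (E - {(x, y), (y, x)})\<^sup>*" by (simp add: half_def)
  \<comment> \<open>Both memberships are carried along: the first one is what keeps the walk away
    from \<open>x\<close>.\<close>
  then have "z \<in> half T x y \<and> z \<in> half T u x"
  proof induction
    case base
    have "x \<in> half T u x" by simp
    from half_step[OF this assms(1)] show ?case using assms adj_neq by (auto simp: doubleton_eq_iff)
  next
    case (step p q)
    have q: "q \<in> half T x y" using step half_step[of p T x y q] by (auto simp: doubleton_eq_iff)
    moreover have "q \<in> half T u x"
      using half_step[of p T u x q] step q bridge[OF assms(1)] by (auto simp: doubleton_eq_iff)
    ultimately show ?case by simp
  qed
  then show "z \<in> half T u x" by simp
qed

lemma branches_disjoint: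
  assumes "(v, x) \<in> E" "(v, y) \<in> E" "x \<noteq> y"
  shows "half T v x \<inter> half T v y = {}"
  using half_mono[of v x y] half_disjoint[of v y] assms adj_sym by blast

lemma branch_ex:
  assumes "v \<in> V" "z \<in> V" "z \<noteq> v"
  obtains w where "(v, w) \<in> E" "z \<in> half T v w"
proof -
  have "(v, z) \<in> E\<^sup>*" using connected assms by blast
  then have "z = v \<or> (\<exists>w. (v, w) \<in> E \<and> z \<in> half T v w)"
  proof induction
    case (step p q)
    then show ?case
      by (metis half_boundary half_refl)
  qed simp
  then show ?thesis using that assms by blast
qed

lemma branch_unique:
  "(v, w) \<in> E \<Longrightarrow> (v, w') \<in> E \<Longrightarrow> z \<in> half T v w \<Longrightarrow> z \<in> half T v w' \<Longrightarrow> w = w'"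
  using branches_disjoint by blast

section \<open>Distances and their parity\<close>

lemma dist_walk: "x \<in> V \<Longrightarrow> y \<in> V \<Longrightarrow> (x, y) \<in> E ^^ d x y"
  unfolding gdist_def using connected[of x y] by (metis LeastI_ex rtrancl_power)

lemma dist_le: "(x, y) \<in> E ^^ n \<Longrightarrow> d x y \<le> n"
  unfolding gdist_def by (rule Least_le)

lemma walk_sym: "(x, y) \<in> E ^^ n \<Longrightarrow> (y, x) \<in> E ^^ n"
proof (induction n arbitrary: y)
  case (Suc n)
  then obtain z where "(x, z) \<in> E ^^ n" "(z, y) \<in> E" by auto
  then have "(y, z) \<in> E" "(z, x) \<in> E ^^ n" using Suc.IH adj_sym by auto
  then show ?case by (rule relpow_Suc_I2)
qed simp

lemma dist_sym: "d x y = d y x"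
  unfolding gdist_def using walk_sym by metis

lemma dist_self [simp]: "d x x = 0"
  using dist_le[of x x 0] by simp

lemma dist_triangle: "x \<in> V \<Longrightarrow> y \<in> V \<Longrightarrow> z \<in> V \<Longrightarrow> d x z \<le> d x y + d y z"
  using dist_le[of x z "d x y + d y z"] dist_walk by (auto simp: relpow_add)

lemma dist_0_iff: "x \<in> V \<Longrightarrow> y \<in> V \<Longrightarrow> d x y = 0 \<longleftrightarrow> x = y"
  using dist_walk[of x y] by auto

text \<open>The walk is cut at its last crossing of the edge, which must go from \<open>w\<close> to
  \<open>v\<close>.\<close>

lemma walk_cross:
  assumes "(v, w) \<in> E" "(x, y) \<in> E ^^ n" "x \<in> half T v w" "y \<notin> half T v w"
  shows "\<exists>i j. (x, w) \<in> E ^^ i \<and> (v, y) \<in> E ^^ j \<and> n = i + j + 1"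
  using assms(2,4)
proof (induction n arbitrary: y)
  case 0
  then show ?case using assms by auto
next
  case (Suc n)
  then obtain z where z: "(x, z) \<in> E ^^ n" "(z, y) \<in> E" by auto
  show ?case
  proof (cases "z \<in> half T v w")
    case True
    then have "z = w" "y = v" using half_boundary[OF assms(1) True z(2)] Suc.prems by auto
    then show ?thesis using z by (intro exI[of _ n] exI[of _ 0]) auto
  next
    case False
    then obtain i j where "(x, w) \<in> E ^^ i" "(v, z) \<in> E ^^ j" "n = i + j + 1"
      using Suc.IH z by blast
    then show ?thesis using z by (intro exI[of _ i] exI[of _ "Suc j"]) auto
  qed
qed

text \<open>A shortest walk has to cross the edge, and conversely shortest walks on the two sides
  can be joined by it. This additivity is the substitute for geodesics.\<close>

lemma dist_cross:
  assumes "(v, w) \<in> E" "x \<in> half T v w" "y \<in> half T w v"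
  shows "d x y = d x w + 1 + d v y"
proof -
  have V: "x \<in> V" "y \<in> V" "v \<in> V" "w \<in> V"
    using assms half_verts adj_sym adj_verts by blast+
  have "y \<notin> half T v w" using not_half_iff assms V by blast
  then obtain i j where ij: "(x, w) \<in> E ^^ i" "(v, y) \<in> E ^^ j" "d x y = i + j + 1"
    using walk_cross[OF assms(1) dist_walk assms(2)] V by blast
  have "d x w \<le> i" "d v y \<le> j" using ij dist_le by auto
  moreover have "(w, y) \<in> E ^^ Suc (d v y)"
    using relpow_Suc_I2[OF adj_sym[OF assms(1)] dist_walk] V by blast
  then have "(x, y) \<in> E ^^ (d x w + Suc (d v y))"
    using dist_walk[of x w] V unfolding relpow_add by blast
  then have "d x y \<le> d x w + Suc (d v y)" by (rule dist_le)
  ultimately show ?thesis using ij by linarith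
qed

lemma dist_half:
  assumes "(v, w) \<in> E" "x \<in> half T v w"
  shows "d x v = d x w + 1"
  using dist_cross[OF assms, of v] by simp

text \<open>Describing half-trees by distances makes them invariant under every map that preserves
  distances, see \<open>act_half\<close>.\<close>

lemma half_iff_dist:
  assumes "(v, w) \<in> E" "x \<in> V"
  shows "x \<in> half T v w \<longleftrightarrow> d x w < d x v"
  using dist_half[OF assms(1)] dist_half[of w v x] adj_sym assms not_half_iff[of v w x]
  by fastforce

lemma dist_adj_neq: "(v, w) \<in> E \<Longrightarrow> x \<in> V \<Longrightarrow> even (d x v) \<longleftrightarrow> odd (d x w)"
  using dist_half[of v w x] dist_half[of w v x] adj_sym not_half_iff[of v w x] by fastforce

lemma dist_adj: "(v, w) \<in> E \<Longrightarrow> d v w = 1"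
  using dist_half[of v w w] dist_sym by simp

lemma walk_parity: "x \<in> V \<Longrightarrow> z \<in> V \<Longrightarrow> (x, y) \<in> E ^^ n \<Longrightarrow> even (d z y) \<longleftrightarrow> (even (d z x) \<longleftrightarrow> even n)"
proof (induction n arbitrary: y)
  case (Suc n)
  then obtain u where u: "(x, u) \<in> E ^^ n" "(u, y) \<in> E" by auto
  have "even (d z u) \<longleftrightarrow> (even (d z x) \<longleftrightarrow> even n)" using Suc.IH Suc.prems u by blast
  moreover have "even (d z u) \<longleftrightarrow> odd (d z y)" using dist_adj_neq u Suc.prems by blast
  ultimately show ?case by (cases "even n"; cases "even (d z x)") simp_all
qed simp

lemma dist_parity:
  assumes "x \<in> V" "y \<in> V" "z \<in> V"
  shows "even (d x z) \<longleftrightarrow> (even (d x y) \<longleftrightarrow> even (d y z))"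
  using walk_parity[OF assms(2,1) dist_walk] assms by blast

section \<open>The bipartition and the projection onto an edge\<close>

abbreviation part :: "'v \<Rightarrow> 'v set" where
  "part v \<equiv> {w \<in> V. even (d v w)}"

lemma bipartition_eq_image: "bipartition T = part ` V"
  unfolding bipartition_def quotient_def by (auto simp: Image_def)

lemma bipartition_eq:
  assumes "(v, w) \<in> E"
  shows "bipartition T = {part v, part w}"
proof -
  have vw: "v \<in> V" "w \<in> V" using adj_verts assms by auto
  have "part x = part v \<or> part x = part w" if x: "x \<in> V" for x
  proof (cases "even (d x v)")
    case True
    then have "part x = part v" using dist_parity[OF x vw(1)] by auto
    then show ?thesis by simp
  next
    case False
    then have "even (d x w)" using dist_adj_neq[OF assms x] by simp
    then have "part x = part w" using dist_parity[OF x vw(2)] by auto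
    then show ?thesis by simp
  qed
  then show ?thesis unfolding bipartition_eq_image using vw by auto
qed

text \<open>The distances to the two ends of an edge differ by one, so the choice hidden in
  \<open>closest_point\<close> has a single candidate.\<close>

lemma closest_point_half:
  assumes "(x, y) \<in> E"
  shows "{v \<in> V. closest_point T {x, y} v = x} = half T y x"
    and "{v \<in> V. closest_point T {x, y} v = y} = half T x y"
proof -
  have 1: "closest_point T {x, y} v = y" if "v \<in> half T x y" for v
  proof -
    have "d v y < d v x" using dist_half[OF assms that] by simp
    then show ?thesis
      unfolding closest_point_def arg_min_on_def arg_min_def
      by (intro some_equality) (auto simp: is_arg_min_def)
  qed
  have 2: "closest_point T {x, y} v = x" if "v \<in> half T y x" for v
  proof -
    have "d v x < d v y" using dist_half[OF adj_sym[OF assms] that] by simp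
    then show ?thesis
      unfolding closest_point_def arg_min_on_def arg_min_def
      by (intro some_equality) (auto simp: is_arg_min_def)
  qed
  have "closest_point T {x, y} v = x \<longleftrightarrow> v \<in> half T y x" "closest_point T {x, y} v = y \<longleftrightarrow> v \<in> half T x y"
    if "v \<in> V" for v
    using 1[of v] 2[of v] adj_neq[OF assms] not_half_iff[OF assms that] by auto
  then show "{v \<in> V. closest_point T {x, y} v = x} = half T y x"
    "{v \<in> V. closest_point T {x, y} v = y} = half T x y"
    using half_verts[OF assms] half_verts[OF adj_sym[OF assms]] by blast+
qed

lemma edge_is_simple_path: "(x, y) \<in> E \<Longrightarrow> is_simple_path T {x, y}"
  unfolding is_simple_path_def
  by (rule exI[of _ "{0, 1}"], rule exI[of _ "\<lambda>i. if i = 0 then x else y"])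
    (auto simp: inj_on_def adj_verts dest: adj_neq)

lemma nbrs_iff [simp]: "w \<in> nbrs T v \<longleftrightarrow> (v, w) \<in> E"
  by (simp add: nbrs_def)

text \<open>Dependent choice along the tree: \<open>P\<close> says which values are admissible at a
  vertex, \<open>Q\<close> relates the values at the ends of an edge. Every vertex other than the
  root has only one neighbour nearer to the root, so no two conditions ever compete.\<close>

lemma rooted_choice:
  assumes r: "r \<in> V" and s0: "P r s0"
    and ext: "\<And>x y s. (x, y) \<in> E \<Longrightarrow> P x s \<Longrightarrow> \<exists>t. P y t \<and> Q x y s t"
  obtains f where "\<And>x. x \<in> V \<Longrightarrow> P x (f x)"
    and "\<And>x y. (x, y) \<in> E \<Longrightarrow> d r y = d r x + 1 \<Longrightarrow> Q x y (f x) (f y)"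
proof -
  define par where "par = (\<lambda>y. SOME x. (y, x) \<in> E \<and> r \<in> half T y x)"
  \<comment> \<open>The first argument is meant to be the distance of the vertex from the root; only
    the values \<open>F (d r y) y\<close> matter.\<close>
  define F where "F = rec_nat (\<lambda>_. s0) (\<lambda>n Fn y. SOME t. P y t \<and> Q (par y) y (Fn (par y)) t)"
  have F0: "F 0 = (\<lambda>_. s0)" by (simp add: F_def)
  have FS: "F (Suc n) y = (SOME t. P y t \<and> Q (par y) y (F n (par y)) t)" for n y by (simp add: F_def)
  have par: "(y, par y) \<in> E \<and> r \<in> half T y (par y)" if "y \<in> V" "y \<noteq> r" for y
  proof -
    have "\<exists>x. (y, x) \<in> E \<and> r \<in> half T y x" using branch_ex[of y r] that r by metis
    then show ?thesis unfolding par_def by (rule someI_ex)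
  qed
  have main: "P y (F n y) \<and> (n > 0 \<longrightarrow> Q (par y) y (F (n - 1) (par y)) (F n y))" if "y \<in> V" "d r y = n" for n y
    using that
  proof (induction n arbitrary: y)
    case 0
    then show ?case using dist_0_iff r s0 F0 by simp
  next
    case (Suc n)
    then have "y \<noteq> r" by auto
    then have p: "(y, par y) \<in> E" "r \<in> half T y (par y)" using par Suc by auto
    then have "d r (par y) = n" using dist_half[OF p] Suc by simp
    then have "P (par y) (F n (par y))" using Suc.IH adj_verts[OF p(1)] by simp
    from ext[OF adj_sym[OF p(1)] this]
    have "P y (F (Suc n) y) \<and> Q (par y) y (F n (par y)) (F (Suc n) y)"
      unfolding FS by (rule someI_ex)
    then show ?case by simp
  qed
  show ?thesis
  proof (rule that[of "\<lambda>y. F (d r y) y"])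
    show "P x (F (d r x) x)" if "x \<in> V" for x using main[OF that] by simp
    fix x y assume xy: "(x, y) \<in> E" "d r y = d r x + 1"
    have V: "x \<in> V" "y \<in> V" using adj_verts xy by auto
    have "r \<in> half T y x" using half_iff_dist[OF adj_sym[OF xy(1)] r] xy(2) by simp
    moreover have "y \<noteq> r" using xy(2) by auto
    ultimately have "par y = x" using par[OF V(2)] branch_unique adj_sym[OF xy(1)] by metis
    then show "Q x y (F (d r x) x) (F (d r y) y)" using main[OF V(2), of "d r y"] xy(2) by simp
  qed
qed

lemma mem_part_self [simp]: "v \<in> V \<Longrightarrow> v \<in> part v"
  by simp

lemma part_adj:
  assumes "(x, y) \<in> E" "v \<in> V"
  shows "x \<in> part v \<longleftrightarrow> y \<notin> part v"
  using dist_adj_neq[OF assms] adj_verts assms by auto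

lemma part_in_bipartition: "v \<in> V \<Longrightarrow> part v \<in> bipartition T"
  by (auto simp: bipartition_eq_image)

section \<open>Automorphisms and orbits\<close>

lemma autsD:
  assumes "g \<in> auts T"
  shows "g \<in> Bij V" "x \<in> V \<Longrightarrow> g x \<in> V" "x \<in> V \<Longrightarrow> y \<in> V \<Longrightarrow> (g x, g y) \<in> E \<longleftrightarrow> (x, y) \<in> E"
  using assms Bij_imp_funcset[of g V] by (auto simp: auts_def)

lemma auts_subgroup: "subgroup (auts T) (BijGroup V)"
proof (rule group.subgroupI[OF group_BijGroup])
  show "auts T \<subseteq> carrier (BijGroup V)" by (auto simp: auts_def BijGroup_simps)
  have "(\<lambda>x\<in>V. x) \<in> auts T" using id_Bij by (auto simp: auts_def)
  then show "auts T \<noteq> {}" by blast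
  show "g \<otimes>\<^bsub>BijGroup V\<^esub> h \<in> auts T" if g: "g \<in> auts T" and h: "h \<in> auts T" for g h
    using autsD[OF g] autsD[OF h] by (auto simp: auts_def BijGroup_simps compose_Bij compose_eq)
  show "inv\<^bsub>BijGroup V\<^esub> g \<in> auts T" if g: "g \<in> auts T" for g
  proof -
    have b: "bij_betw g V V" using autsD(1)[OF g] by (auto simp: Bij_def)
    have *: "inv_into V g x \<in> V" "g (inv_into V g x) = x" if "x \<in> V" for x
      using that b bij_betw_inv_into_right[OF b that] inv_into_into[of x g V] by (auto simp: bij_betw_def)
    then show ?thesis
      using autsD(3)[OF g *(1) *(1)] autsD(1)[OF g] restrict_inv_into_Bij[of g V]
      by (auto simp: inv_BijGroup auts_def)
  qed
qed

lemma group_aut_group: "group (aut_group T)"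
  unfolding aut_group_def by (rule subgroup.subgroup_is_group[OF auts_subgroup group_BijGroup])

end

locale tree_action = tree_graph T for T :: "('v, 'a) arc_graph" +
  fixes G :: "('v \<Rightarrow> 'v) set"
  assumes sub: "subgroup G (aut_group T)"
begin

sublocale K: group "grp T G"
  by (rule subgroup.subgroup_is_group[OF sub group_aut_group])

text \<open>Opaque copies of the group operations, since the simplifier rewrites those of \<open>grp T G\<close>
  to those of \<open>aut_group T\<close>.\<close>
definition mul (infixl "\<cdot>" 70) where "g \<cdot> h = g \<otimes>\<^bsub>grp T G\<^esub> h"
definition iv where "iv g = inv\<^bsub>grp T G\<^esub> g"
definition idt where "idt = \<one>\<^bsub>grp T G\<^esub>"

lemma carrier_grp: "carrier (grp T G) = G"
  by simp

lemma G_auts: "g \<in> G \<Longrightarrow> g \<in> auts T"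
  using subgroup.subset[OF sub] by (auto simp: aut_group_def)

lemma G_Bij: "g \<in> G \<Longrightarrow> g \<in> Bij V"
  using G_auts autsD by blast

lemma act_closed [simp]: "g \<in> G \<Longrightarrow> x \<in> V \<Longrightarrow> g x \<in> V"
  using G_auts autsD by blast

lemma act_adj: "g \<in> G \<Longrightarrow> x \<in> V \<Longrightarrow> y \<in> V \<Longrightarrow> (g x, g y) \<in> E \<longleftrightarrow> (x, y) \<in> E"
  using G_auts autsD by blast

lemma act_adjI: "g \<in> G \<Longrightarrow> (x, y) \<in> E \<Longrightarrow> (g x, g y) \<in> E"
  using act_adj adj_verts by blast

lemma mul_closed [simp]: "g \<in> G \<Longrightarrow> h \<in> G \<Longrightarrow> g \<cdot> h \<in> G"
  unfolding mul_def using K.m_closed[unfolded carrier_grp] .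

lemma iv_closed [simp]: "g \<in> G \<Longrightarrow> iv g \<in> G"
  unfolding iv_def using K.inv_closed[unfolded carrier_grp] .

lemma idt_closed [simp]: "idt \<in> G"
  unfolding idt_def using K.one_closed[unfolded carrier_grp] .

lemma act_mul [simp]: "g \<in> G \<Longrightarrow> h \<in> G \<Longrightarrow> x \<in> V \<Longrightarrow> (g \<cdot> h) x = g (h x)"
  using G_Bij by (simp add: mul_def aut_group_def BijGroup_simps compose_eq)

lemma idt_eq: "idt = (\<lambda>x\<in>V. x)"
  by (simp add: idt_def aut_group_def BijGroup_simps)

lemma act_one [simp]: "x \<in> V \<Longrightarrow> idt x = x"
  by (simp add: idt_eq)

lemma act_iv [simp]:
  assumes "g \<in> G" "x \<in> V"
  shows "iv g (g x) = x" "g (iv g x) = x"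
proof -
  have "iv g \<cdot> g = idt" "g \<cdot> iv g = idt"
    unfolding mul_def iv_def idt_def using K.l_inv[of g] K.r_inv[of g] assms(1) by (simp_all only: carrier_grp)
  then show "iv g (g x) = x" "g (iv g x) = x"
    using act_mul[of "iv g" g x] act_mul[of g "iv g" x] assms by simp_all
qed

lemma act_inj [simp]: "g \<in> G \<Longrightarrow> x \<in> V \<Longrightarrow> y \<in> V \<Longrightarrow> g x = g y \<longleftrightarrow> x = y"
  using act_iv(1) by metis

lemma act_eqI: "g \<in> G \<Longrightarrow> h \<in> G \<Longrightarrow> (\<And>x. x \<in> V \<Longrightarrow> g x = h x) \<Longrightarrow> g = h"
  by (rule extensionalityI[of _ V]) (auto intro: Bij_imp_extensional G_Bij)

lemma act_walk: "g \<in> G \<Longrightarrow> (x, y) \<in> E ^^ n \<Longrightarrow> x \<in> V \<Longrightarrow> (g x, g y) \<in> E ^^ n"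
proof (induction n arbitrary: y)
  case (Suc n)
  then obtain z where z: "(x, z) \<in> E ^^ n" "(z, y) \<in> E" by auto
  then have "(g x, g z) \<in> E ^^ n" "(g z, g y) \<in> E" using Suc act_adjI by auto
  then show ?case by auto
qed simp

lemma act_dist [simp]:
  assumes "g \<in> G" "x \<in> V" "y \<in> V"
  shows "d (g x) (g y) = d x y"
proof (rule antisym)
  show "d (g x) (g y) \<le> d x y" using act_walk[OF assms(1) dist_walk] assms dist_le by blast
  have "(iv g (g x), iv g (g y)) \<in> E ^^ d (g x) (g y)"
    by (rule act_walk[OF _ dist_walk]) (use assms in auto)
  then show "d x y \<le> d (g x) (g y)" using assms dist_le by simp
qed

lemma act_half: "g \<in> G \<Longrightarrow> (x, y) \<in> E \<Longrightarrow> z \<in> V \<Longrightarrow> g z \<in> half T (g x) (g y) \<longleftrightarrow> z \<in> half T x y"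
  using half_iff_dist[of x y z] half_iff_dist[of "g x" "g y" "g z"] adj_verts[of x y] act_adjI by simp

lemma vstab_iff [simp]: "g \<in> vstab T G v \<longleftrightarrow> g \<in> G \<and> g v = v"
  by (simp add: stabilizer_def)

lemma vorbit_iff: "w \<in> vorbit T G v \<longleftrightarrow> (\<exists>g\<in>G. g v = w)"
  by (auto simp: orbit_def)

lemma vorbit_eq_iff:
  assumes "v \<in> V" "w \<in> V"
  shows "vorbit T G v = vorbit T G w \<longleftrightarrow> (\<exists>g\<in>G. g v = w)"
proof
  assume "vorbit T G v = vorbit T G w"
  moreover have "w \<in> vorbit T G w" using assms by (auto simp: vorbit_iff intro!: bexI[of _ idt])
  ultimately show "\<exists>g\<in>G. g v = w" by (auto simp: vorbit_iff)
next
  assume "\<exists>g\<in>G. g v = w"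
  then obtain g where g: "g \<in> G" "g v = w" by blast
  show "vorbit T G v = vorbit T G w"
  proof (intro Set.set_eqI iffI)
    fix x assume "x \<in> vorbit T G v"
    then obtain h where "h \<in> G" "h v = x" by (auto simp: vorbit_iff)
    then have "(h \<cdot> iv g) w = x" using g assms by auto
    then show "x \<in> vorbit T G w" unfolding vorbit_iff using \<open>h \<in> G\<close> g by (intro bexI[of _ "h \<cdot> iv g"]) auto
  next
    fix x assume "x \<in> vorbit T G w"
    then obtain h where "h \<in> G" "h w = x" by (auto simp: vorbit_iff)
    then have "(h \<cdot> g) v = x" using g assms by auto
    then show "x \<in> vorbit T G v" unfolding vorbit_iff using \<open>h \<in> G\<close> g by (intro bexI[of _ "h \<cdot> g"]) auto
  qed
qed

lemma subgroupD:
  assumes "subgroup H (grp T G)"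
  shows "h \<in> H \<Longrightarrow> h \<in> G" "g \<in> H \<Longrightarrow> h \<in> H \<Longrightarrow> g \<cdot> h \<in> H" "h \<in> H \<Longrightarrow> iv h \<in> H" "idt \<in> H"
proof -
  have G: "H \<subseteq> G" using subgroup.subset[OF assms] by simp
  then show "h \<in> H \<Longrightarrow> h \<in> G" by blast
  show "g \<in> H \<Longrightarrow> h \<in> H \<Longrightarrow> g \<cdot> h \<in> H" "h \<in> H \<Longrightarrow> iv h \<in> H" "idt \<in> H"
    unfolding mul_def iv_def idt_def
    using subgroup.m_closed[OF assms] K.subgroupE(3)[OF assms] subgroup.one_closed[OF assms]
    by blast+
qed

lemma subgroupI:
  assumes "H \<subseteq> G" "idt \<in> H" "\<And>g h. g \<in> H \<Longrightarrow> h \<in> H \<Longrightarrow> g \<cdot> h \<in> H" "\<And>h. h \<in> H \<Longrightarrow> iv h \<in> H"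
  shows "subgroup H (grp T G)"
proof (rule K.subgroupI)
  show "H \<subseteq> carrier (grp T G)" using assms(1) by simp
qed (use assms in \<open>auto simp only: mul_def iv_def idt_def\<close>)

lemma subgroup_absorb:
  assumes "subgroup H (grp T G)" "h \<in> H" "g \<in> G" "h \<cdot> g \<in> H"
  shows "g \<in> H"
proof -
  have "iv h \<cdot> (h \<cdot> g) = g"
    by (rule act_eqI) (use subgroupD(1)[OF assms(1,2)] assms(3) in auto)
  moreover have "iv h \<cdot> (h \<cdot> g) \<in> H" using subgroupD[OF assms(1)] assms by blast
  ultimately show ?thesis by simp
qed

lemma vstab_subgroup:
  assumes "v \<in> V"
  shows "subgroup (vstab T G v) (grp T G)"
proof (rule subgroupI)
  show "iv h \<in> vstab T G v" if "h \<in> vstab T G v" for h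
    using that assms act_iv(1)[of h v] by simp
qed (use assms in auto)

lemma iv_fix: "g \<in> G \<Longrightarrow> x \<in> V \<Longrightarrow> g x = x \<Longrightarrow> iv g x = x"
  using act_iv(1)[of g x] by simp

section \<open>Primitive actions\<close>

text \<open>The translates of the \<open>H\<close>-orbit of \<open>x\<close> are blocks. If they are
  points, \<open>H\<close> fixes \<open>x\<close>; if there is one block, \<open>H\<close> is
  transitive and contains the stabiliser, hence is \<open>A\<close>. The form relative to a subgroup
  \<open>A\<close> covers both \<open>G\<close> on a part and a vertex stabiliser on its
  star.\<close>

lemma primitive_stab_maximal:
  assumes A: "subgroup A (grp T G)" and X: "X \<subseteq> V" "\<And>a x. a \<in> A \<Longrightarrow> x \<in> X \<Longrightarrow> a x \<in> X"
    and prim: "primitive_on X A" and x: "x \<in> X"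
    and H: "subgroup H (grp T G)" "{a \<in> A. a x = x} \<subseteq> H" "H \<subseteq> A"
  shows "H = {a \<in> A. a x = x} \<or> H = A"
proof -
  note AG = subgroupD[OF A] and HG = subgroupD[OF H(1)]
  have xV: "x \<in> V" using X x by blast
  define R where "R = {(a x, a (h x)) | a h. a \<in> A \<and> h \<in> H}"
  have hx: "h x \<in> V" if "h \<in> H" for h using HG(1)[OF that] xV by simp
  have RI: "(a x, a (h x)) \<in> R" if "a \<in> A" "h \<in> H" for a h using that by (auto simp: R_def)
  \<comment> \<open>Since \<open>H\<close> contains the stabiliser of \<open>x\<close>, membership
    in \<open>H\<close> depends only on the image of \<open>x\<close>.\<close>
  have coset: "b \<in> H" if "b \<in> A" "h \<in> H" "b x = h x" for b h
  proof -
    have "iv h \<cdot> b \<in> {a \<in> A. a x = x}" using that AG HG H(3) xV by auto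
    then show ?thesis using subgroup_absorb[OF H(1) HG(3)[OF that(2)] AG(1)[OF that(1)]] H(2) by blast
  qed
  have "equiv X R"
  proof (rule equivI)
    show "R \<subseteq> X \<times> X" using X(2) x H(3) by (auto simp: R_def)
    show "refl_on X R"
      unfolding refl_on_def
    proof
      fix y assume "y \<in> X"
      then obtain a where "a \<in> A" "a x = y"
        using prim x unfolding primitive_on_def transitive_on_def by meson
      then show "(y, y) \<in> R" using RI[of a idt] HG xV by simp
    qed
    show "sym R"
    proof (rule symI)
      fix p q assume "(p, q) \<in> R"
      then obtain a h where ah: "a \<in> A" "h \<in> H" "p = a x" "q = a (h x)" by (auto simp: R_def)
      then have "((a \<cdot> h) x, (a \<cdot> h) (iv h x)) \<in> R" using AG HG H(3) by (intro RI) auto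
      then show "(q, p) \<in> R" using ah AG HG xV by simp
    qed
    show "trans R"
    proof (rule transI)
      fix p q r assume "(p, q) \<in> R" "(q, r) \<in> R"
      then obtain a h b k where *: "a \<in> A" "h \<in> H" "p = a x" "q = a (h x)" "b \<in> A" "k \<in> H" "q = b x" "r = b (k x)"
        by (auto simp: R_def)
      have "(iv a \<cdot> b) x = h x"
        using act_iv(1)[of a "h x"] *(1,2,4,5,7) AG(1) hx xV by simp
      then have "iv a \<cdot> b \<in> H" using coset[of "iv a \<cdot> b" h] * AG by auto
      then have "(a x, a ((iv a \<cdot> b \<cdot> k) x)) \<in> R" using * HG by (intro RI) auto
      then show "(p, r) \<in> R" using * AG HG xV by simp
    qed
  qed
  moreover have "\<forall>a\<in>A. \<forall>(y, z)\<in>R. (a y, a z) \<in> R"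
  proof (clarify)
    fix a y z assume "a \<in> A" "(y, z) \<in> R"
    then obtain b h where *: "b \<in> A" "h \<in> H" "y = b x" "z = b (h x)" by (auto simp: R_def)
    then have "((a \<cdot> b) x, (a \<cdot> b) (h x)) \<in> R" using \<open>a \<in> A\<close> AG by (intro RI) auto
    then show "(a y, a z) \<in> R" using * \<open>a \<in> A\<close> AG HG xV by simp
  qed
  ultimately consider "R = Id_on X" | "R = X \<times> X" using prim unfolding primitive_on_def by blast
  then show ?thesis
  proof cases
    case 1
    have "h x = x" if "h \<in> H" for h
      using RI[OF AG(4) that] 1 xV HG(1)[OF that] by (auto simp: Id_on_def)
    then show ?thesis using H by blast
  next
    case 2
    have "a \<in> H" if a: "a \<in> A" for a
    proof -
      have "(x, a x) \<in> R" using 2 x X(2) a by simp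
      then obtain b h where *: "b \<in> A" "h \<in> H" "x = b x" "a x = b (h x)" by (auto simp: R_def)
      then have "b \<in> H" using H(2) by auto
      then show "a \<in> H" using coset[OF a, of "b \<cdot> h"] * HG AG xV by auto
    qed
    then show ?thesis using H(3) by blast
  qed
qed

text \<open>This is where nonregularity takes effect. Equality of stabilisers is an invariant
  relation because stabilisers of translated points are conjugate; the pair \<open>x0\<close>,
  \<open>y0\<close> prevents it from being universal, so distinct points have distinct
  stabilisers.\<close>

lemma primitive_stab_moves:
  assumes A: "subgroup A (grp T G)" and X: "X \<subseteq> V" "\<And>a x. a \<in> A \<Longrightarrow> x \<in> X \<Longrightarrow> a x \<in> X"
    and prim: "primitive_on X A"
    and k: "k \<in> A" "x0 \<in> X" "y0 \<in> X" "k x0 = x0" "k y0 \<noteq> y0"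
    and xy: "x \<in> X" "y \<in> X" "x \<noteq> y"
  shows "\<exists>a\<in>A. a x = x \<and> a y \<noteq> y"
proof (rule ccontr)
  assume neg: "\<not> ?thesis"
  note AG = subgroupD[OF A]
  define S where "S = (\<lambda>x. {a \<in> A. a x = x})"
  define R where "R = {(x, y) \<in> X \<times> X. S x = S y}"
  have "equiv X R"
    by (rule equivI) (auto simp: R_def refl_on_def sym_def trans_def)
  moreover have "\<forall>a\<in>A. \<forall>(y, z)\<in>R. (a y, a z) \<in> R"
  proof clarify
    fix a y z assume a: "a \<in> A" and "(y, z) \<in> R"
    then have yz: "y \<in> X" "z \<in> X" "S y = S z" by (auto simp: R_def)
    have conj: "b (a w) = a w \<longleftrightarrow> iv a \<cdot> b \<cdot> a \<in> S w" if "b \<in> A" "w \<in> X" for b w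
    proof -
      have w: "w \<in> V" "a \<in> G" "b \<in> G" using that X a AG by blast+
      have "b (a w) = a w \<longleftrightarrow> iv a (b (a w)) = iv a (a w)"
        by (rule act_inj[symmetric]) (use w in auto)
      then show ?thesis using that a AG w by (simp add: S_def)
    qed
    have "S (a y) = S (a z)" using conj yz by (auto simp: S_def)
    then show "(a y, a z) \<in> R" using yz X(2) a by (simp add: R_def)
  qed
  ultimately have "R = Id_on X \<or> R = X \<times> X" using prim unfolding primitive_on_def by blast
  moreover have "(x0, y0) \<notin> R" using k by (auto simp: R_def S_def)
  ultimately have R: "R = Id_on X" using k by blast
  have yV: "y \<in> V" using xy X by blast
  have sub: "subgroup (S y) (grp T G)"
    by (rule subgroupI) (use AG yV iv_fix in \<open>auto simp: S_def\<close>)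
  \<comment> \<open>If \<open>S x\<close> fixed \<open>y\<close>, then \<open>S y\<close> would
    contain it, and maximality of \<open>S x\<close> leaves two cases: equality contradicts the
    previous step, and \<open>S y = A\<close> contradicts transitivity.\<close>
  have "S y = {a \<in> A. a x = x} \<or> S y = A"
    by (rule primitive_stab_maximal[OF A X(1) _ prim xy(1) sub]) (use X(2) neg in \<open>auto simp: S_def\<close>)
  moreover have "S y \<noteq> S x" using R xy by (auto simp: R_def)
  moreover obtain a where "a \<in> A" "a y = x"
    using prim xy unfolding primitive_on_def transitive_on_def by meson
  then have "S y \<noteq> A" using xy by (auto simp: S_def)
  ultimately show False by (auto simp: S_def)
qed

section \<open>Topology and independence\<close>

text \<open>An automorphism outside a closed \<open>G\<close> has a basic neighbourhood missing
  \<open>G\<close>; such a neighbourhood consists of the permutations agreeing with it on a finite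
  set.\<close>

lemma closed_limit:
  assumes "closedin (group_topology T (auts T)) G" "k \<in> auts T"
    and lim: "\<And>F. finite F \<Longrightarrow> F \<subseteq> V \<Longrightarrow> \<exists>g\<in>G. \<forall>x\<in>F. g x = k x"
  shows "k \<in> G"
proof (rule ccontr)
  assume "k \<notin> G"
  have top: "topspace (group_topology T (auts T)) = auts T"
    using autsD(1) by (auto simp: group_topology_def)
  have "openin (group_topology T (auts T)) (auts T - G)"
    using assms(1) top by (simp add: closedin_def)
  then obtain U where U: "openin (perm_topology V) U" "auts T - G = U \<inter> auts T"
    unfolding group_topology_def openin_subtopology by blast
  have "k \<in> U" using U \<open>k \<notin> G\<close> assms(2) by blast
  then obtain F where F: "finite F" "F \<subseteq> V" "k <#\<^bsub>BijGroup V\<^esub> fixator (Bij V) F \<subseteq> U"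
    using U(1) unfolding openin_perm_topology by blast
  obtain g where g: "g \<in> G" "\<forall>x\<in>F. g x = k x" using lim[OF F(1,2)] by blast
  interpret B: group "BijGroup V" by (rule group_BijGroup)
  have kB: "k \<in> Bij V" and gB: "g \<in> Bij V" using assms(2) autsD(1) G_Bij g by auto
  \<comment> \<open>The quotient of \<open>g\<close> by \<open>k\<close> fixes \<open>F\<close>
    pointwise, which puts \<open>g\<close> into the coset of \<open>k\<close>.\<close>
  let ?h = "inv\<^bsub>BijGroup V\<^esub> k \<otimes>\<^bsub>BijGroup V\<^esub> g"
  have ik: "inv\<^bsub>BijGroup V\<^esub> k \<in> Bij V" using B.inv_closed kB by (simp add: BijGroup_simps)
  have hB: "?h \<in> Bij V" using B.m_closed ik gB by (simp add: BijGroup_simps)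
  have "?h x = x" if "x \<in> F" for x
  proof -
    have xV: "x \<in> V" using F that by blast
    have "?h x = inv_into V k (k x)"
      using xV g that kB gB ik Bij_imp_funcset[OF kB] by (auto simp: BijGroup_simps compose_eq inv_BijGroup)
    then show ?thesis using kB xV by (simp add: Bij_def bij_betw_def)
  qed
  then have "?h \<in> fixator (Bij V) F" using hB by (simp add: fixator_def)
  moreover have "k \<in> carrier (BijGroup V)" "g \<in> carrier (BijGroup V)"
    using kB gB by (simp_all add: BijGroup_simps)
  then have "k \<otimes>\<^bsub>BijGroup V\<^esub> ?h = g"
    using B.m_assoc[of k "inv\<^bsub>BijGroup V\<^esub> k" g] by simp
  ultimately have "g \<in> k <#\<^bsub>BijGroup V\<^esub> fixator (Bij V) F" unfolding l_coset_def by force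
  then have "g \<in> U" using F(3) by blast
  then show False using U g G_auts by blast
qed

lemma open_subgroup_fixator:
  assumes "openin (group_topology T G) H" "subgroup H (grp T G)"
  obtains F where "finite F" "F \<subseteq> V" "fixator G F \<subseteq> H"
proof -
  obtain U where U: "openin (perm_topology V) U" "H = U \<inter> G"
    using assms(1) unfolding group_topology_def openin_subtopology by blast
  have "idt \<in> U" using U subgroupD[OF assms(2)] by blast
  then obtain F where F: "finite F" "F \<subseteq> V" "idt <#\<^bsub>BijGroup V\<^esub> fixator (Bij V) F \<subseteq> U"
    using U(1) unfolding openin_perm_topology by blast
  interpret B: group "BijGroup V" by (rule group_BijGroup)
  have "g \<in> U" if g: "g \<in> fixator G F" for g
  proof -
    have gB: "g \<in> Bij V" using g G_Bij by (auto simp: fixator_def)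
    then have "\<one>\<^bsub>BijGroup V\<^esub> \<otimes>\<^bsub>BijGroup V\<^esub> g = g" by (simp add: BijGroup_simps(1))
    moreover have "idt = \<one>\<^bsub>BijGroup V\<^esub>" by (simp add: idt_eq BijGroup_simps)
    moreover have "g \<in> fixator (Bij V) F" using g gB by (simp add: fixator_def)
    ultimately show ?thesis using F(3) unfolding l_coset_def by fastforce
  qed
  then have "fixator G F \<subseteq> H" using U by (auto simp: fixator_def)
  then show ?thesis using that F by blast
qed

text \<open>A subgroup containing a point stabiliser is a union of cosets of it. The set
  \<open>U\<close> is the corresponding union of cosets in the group of all permutations.\<close>

lemma subgroup_open:
  assumes "subgroup H (grp T G)" "v \<in> V" "vstab T G v \<subseteq> H"
  shows "openin (group_topology T G) H"
proof -
  note HG = subgroupD[OF assms(1)]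
  define U where "U = {g \<in> Bij V. \<exists>h\<in>H. g v = h v}"
  interpret B: group "BijGroup V" by (rule group_BijGroup)
  have "openin (perm_topology V) U"
    unfolding openin_perm_topology
  proof (intro conjI ballI)
    show "U \<subseteq> Bij V" by (auto simp: U_def)
    fix g assume g: "g \<in> U"
    have "g <#\<^bsub>BijGroup V\<^esub> fixator (Bij V) {v} \<subseteq> U"
      using g assms(2) by (auto simp: U_def l_coset_def fixator_def BijGroup_simps compose_Bij compose_eq)
    then show "\<exists>F. finite F \<and> F \<subseteq> V \<and> g <#\<^bsub>BijGroup V\<^esub> fixator (Bij V) F \<subseteq> U"
      using assms(2) by (intro exI[of _ "{v}"]) auto
  qed
  moreover have "H = U \<inter> G"
  proof (intro Set.set_eqI iffI)
    show "g \<in> U \<inter> G" if "g \<in> H" for g using that HG G_Bij by (auto simp: U_def)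
    fix g assume "g \<in> U \<inter> G"
    then obtain h where h: "h \<in> H" "g v = h v" "g \<in> G" by (auto simp: U_def)
    then have "iv h \<cdot> g \<in> H" using assms HG by auto
    then show "g \<in> H" using subgroup_absorb[OF assms(1) HG(3)[OF h(1)] h(3)] by blast
  qed
  ultimately show ?thesis unfolding group_topology_def openin_subtopology by blast
qed

text \<open>Property (P) for the path with vertices \<open>x\<close> and \<open>y\<close>, whose
  fibres are the two half-trees.\<close>

lemma edge_independence:
  assumes "property_P T G" "(x, y) \<in> E" "g \<in> G" "g x = x" "g y = y"
  obtains h where "h \<in> G" "\<And>z. z \<in> half T x y \<Longrightarrow> h z = g z" "\<And>z. z \<in> half T y x \<Longrightarrow> h z = z"
proof -
  define fib where "fib = (\<lambda>u. {v \<in> V. closest_point T {x, y} v = u})"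
  have fib: "fib x = half T y x" "fib y = half T x y"
    unfolding fib_def by (rule closest_point_half[OF assms(2)])+
  have P: "(\<lambda>g. \<lambda>u\<in>{x, y}. restrict g (fib u)) ` fixator G {x, y} =
      (\<Pi>\<^sub>E u\<in>{x, y}. (\<lambda>g. restrict g (fib u)) ` fixator G {x, y})"
    using assms(1) edge_is_simple_path[OF assms(2)]
    unfolding property_P_def Let_def fib_def by blast
  have xy: "x \<noteq> y" "x \<in> V" "y \<in> V" using adj_neq adj_verts assms(2) by blast+
  have mem: "g \<in> fixator G {x, y}" "idt \<in> fixator G {x, y}" using assms xy by (auto simp: fixator_def)
  \<comment> \<open>The prescribed tuple: \<open>g\<close> over \<open>y\<close> and the identity
    over \<open>x\<close>.\<close>
  define f where "f = (\<lambda>u\<in>{x, y}. restrict (if u = y then g else idt) (fib u))"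
  have "f \<in> (\<Pi>\<^sub>E u\<in>{x, y}. (\<lambda>g. restrict g (fib u)) ` fixator G {x, y})"
    unfolding f_def using mem by auto
  then obtain h where h: "h \<in> fixator G {x, y}" "f = (\<lambda>u\<in>{x, y}. restrict h (fib u))"
    unfolding P[symmetric] by blast
  have "restrict h (fib x) = restrict idt (fib x)" "restrict h (fib y) = restrict g (fib y)"
    using fun_cong[OF h(2), of x] fun_cong[OF h(2), of y] xy by (simp_all add: f_def)
  then have "h z = idt z" if "z \<in> half T y x" for z
    using that fib by (metis restrict_apply')
  moreover have "h z = g z" if "z \<in> half T x y" for z
    using that fib \<open>restrict h (fib y) = restrict g (fib y)\<close> by (metis restrict_apply')
  moreover have "h \<in> G" using h by (auto simp: fixator_def)
  ultimately show ?thesis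
    using half_verts[OF adj_sym[OF assms(2)]] by (intro that[of h]) (auto dest: subsetD)
qed

lemma edge_stab_le:
  assumes "property_P T G" "(x, y) \<in> E" "subgroup H (grp T G)"
    and "fixator G (half T x y) \<subseteq> H" "fixator G (half T y x) \<subseteq> H"
    and g: "g \<in> G" "g x = x" "g y = y"
  shows "g \<in> H"
proof -
  obtain h where h: "h \<in> G" "\<And>z. z \<in> half T x y \<Longrightarrow> h z = g z" "\<And>z. z \<in> half T y x \<Longrightarrow> h z = z"
    using edge_independence[OF assms(1,2) g] by blast
  have "h \<in> H" using h assms(5) by (auto simp: fixator_def)
  have "(iv h \<cdot> g) z = z" if "z \<in> half T x y" for z
  proof -
    have "z \<in> V" using that half_verts assms(2) by blast
    then show ?thesis using h(2)[OF that] h(1) g by (simp) (metis act_iv(1))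
  qed
  then have "iv h \<cdot> g \<in> H" using h g assms(4) by (auto simp: fixator_def)
  then show ?thesis using subgroup_absorb[OF assms(3) subgroupD(3)[OF assms(3) \<open>h \<in> H\<close>] g(1)] by blast
qed

section \<open>Maximal stabilisers and primitivity on the parts\<close>

lemma two_maximal:
  assumes "maximal_subgroup A (grp T G)" "maximal_subgroup B (grp T G)" "A \<noteq> B"
    and "subgroup H (grp T G)" "A \<subseteq> H" "B \<subseteq> H"
  shows "H = G"
proof -
  have "H = A \<or> H = G" "H = B \<or> H = G"
    using assms unfolding maximal_subgroup_def carrier_grp by blast+
  then show ?thesis using assms(3) by blast
qed

text \<open>The elements that keep \<open>v\<close> in its own \<open>R\<close>-class form a
  subgroup above the stabiliser of \<open>v\<close>, and maximality leaves only the two extreme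
  relations.\<close>

lemma maximal_stab_primitive:
  assumes v: "v \<in> V" and max: "maximal_subgroup (vstab T G v) (grp T G)"
  shows "primitive_on (vorbit T G v) G"
  unfolding primitive_on_def
proof (intro conjI allI impI)
  let ?X = "vorbit T G v"
  show "transitive_on ?X G"
    unfolding transitive_on_def
  proof (intro ballI)
    fix x y assume "x \<in> ?X" "y \<in> ?X"
    then obtain g h where gh: "g \<in> G" "h \<in> G" "g v = x" "h v = y" unfolding vorbit_iff by blast
    then have "(h \<cdot> iv g) x = y" using v by auto
    then show "\<exists>h\<in>G. h x = y" using gh by (intro bexI[of _ "h \<cdot> iv g"]) auto
  qed
  fix R assume R: "equiv ?X R \<and> (\<forall>h\<in>G. \<forall>(x, y)\<in>R. (h x, h y) \<in> R)"
  then have inv: "(h x, h y) \<in> R" if "h \<in> G" "(x, y) \<in> R" for h x y using that by blast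
  have eq: "R \<subseteq> ?X \<times> ?X" "refl_on ?X R" "sym R" "trans R" using R by (auto simp: equiv_def)
  have vX: "v \<in> ?X" using v unfolding vorbit_iff by (intro bexI[of _ idt]) auto
  define H where "H = {g \<in> G. (v, g v) \<in> R}"
  have "subgroup H (grp T G)"
  proof (rule subgroupI)
    show "H \<subseteq> G" by (auto simp: H_def)
    show "idt \<in> H" using v vX eq(2) by (auto simp: H_def refl_on_def)
    show "g \<cdot> h \<in> H" if "g \<in> H" "h \<in> H" for g h
      using that inv[of g v "h v"] transD[OF eq(4), of v "g v" "g (h v)"] v by (auto simp: H_def)
    show "iv h \<in> H" if "h \<in> H" for h
      using that inv[of "iv h" v "h v"] symD[OF eq(3)] v by (auto simp: H_def)
  qed
  moreover have "vstab T G v \<subseteq> H" using vX eq(2) by (auto simp: H_def refl_on_def)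
  ultimately have "H = vstab T G v \<or> H = G"
    using max unfolding maximal_subgroup_def by (metis carrier_grp)
  then show "R = Id_on ?X \<or> R = ?X \<times> ?X"
  proof
    assume H: "H = G"
    have "(v, x) \<in> R" if "x \<in> ?X" for x using that H by (auto simp: vorbit_iff H_def)
    then have "R = ?X \<times> ?X" using eq by (blast dest: symD transD)
    then show ?thesis ..
  next
    assume H: "H = vstab T G v"
    have "x = y" if xy: "(x, y) \<in> R" for x y
    proof -
      have "x \<in> ?X" "y \<in> ?X" using xy eq(1) by auto
      then obtain g h where gh: "g \<in> G" "h \<in> G" "g v = x" "h v = y" unfolding vorbit_iff by blast
      have "(iv g x, iv g y) \<in> R" using inv xy gh by simp
      then have "iv g \<cdot> h \<in> H" using gh v by (auto simp: H_def)
      then have "iv g (h v) = v" using gh v H by simp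
      then have "g v = h v" using act_iv(2)[of g "h v"] gh(1,2) v by (metis act_closed)
      then show ?thesis using gh by simp
    qed
    then have "R = Id_on ?X" using eq(1,2) by (auto simp: refl_on_def Id_on_def)
    then show ?thesis ..
  qed
qed

lemma primitive_maximal_stab:
  assumes P: "P \<subseteq> V" "\<And>g. g \<in> G \<Longrightarrow> g ` P = P" and prim: "primitive_on P G"
    and v: "v \<in> P" and w: "w \<in> P" "w \<noteq> v"
  shows "maximal_subgroup (vstab T G v) (grp T G)"
proof -
  have vV: "v \<in> V" using P v by blast
  have GG: "subgroup G (grp T G)" using K.subgroup_self carrier_grp by metis
  obtain g where g: "g \<in> G" "g v = w" using prim v w unfolding primitive_on_def transitive_on_def by meson
  have "H = vstab T G v \<or> H = G" if H: "subgroup H (grp T G)" "vstab T G v \<subseteq> H" for H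
  proof -
    have "H = {a \<in> G. a v = v} \<or> H = G"
    proof (rule primitive_stab_maximal[OF GG P(1) _ prim v H(1)])
      show "a x \<in> P" if "a \<in> G" "x \<in> P" for a x using that P(2) by blast
      show "H \<subseteq> G" using subgroupD(1)[OF H(1)] by blast
    qed (use H(2) in auto)
    moreover have "vstab T G v = {a \<in> G. a v = v}" by auto
    ultimately show ?thesis by blast
  qed
  moreover have "vstab T G v \<noteq> G" using g w by auto
  ultimately show ?thesis
    using vstab_subgroup[OF vV] unfolding maximal_subgroup_def by (metis carrier_grp)
qed

text \<open>The span of the orbit of an edge is a subtree as soon as the two stabilisers generate.\<close>
lemma maximal_pair_orbits:
  assumes vw: "(v, w) \<in> E" and ne: "vstab T G v \<noteq> vstab T G w"
    and max: "maximal_subgroup (vstab T G v) (grp T G)" "maximal_subgroup (vstab T G w) (grp T G)"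
    and np: "preserves_no_proper_subtree T G"
  shows "V = vorbit T G v \<union> vorbit T G w"
proof -
  have V: "v \<in> V" "w \<in> V" using adj_verts vw by auto
  define S where "S = T\<lparr>verts := vorbit T G v \<union> vorbit T G w,
    arcs := {a \<in> arcs T. \<exists>g\<in>G. {orig T a, term_of T a} = {g v, g w}}\<rparr>"
  have S [simp]: "verts S = vorbit T G v \<union> vorbit T G w"
    "arcs S = {a \<in> arcs T. \<exists>g\<in>G. {orig T a, term_of T a} = {g v, g w}}"
    "orig S = orig T" "opp S = opp T" "term_of S = term_of T"
    by (auto simp: S_def term_of_def fun_eq_iff)
  have adjS: "adj_rel S = {(x, y). \<exists>g\<in>G. (x, y) = (g v, g w) \<or> (x, y) = (g w, g v)}"
  proof (intro Set.set_eqI iffI)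
    fix p assume "p \<in> adj_rel S"
    then show "p \<in> {(x, y). \<exists>g\<in>G. (x, y) = (g v, g w) \<or> (x, y) = (g w, g v)}"
      by (auto simp: adj_rel_def doubleton_eq_iff)
  next
    fix p assume "p \<in> {(x, y). \<exists>g\<in>G. (x, y) = (g v, g w) \<or> (x, y) = (g w, g v)}"
    then obtain g where g: "g \<in> G" "p = (g v, g w) \<or> p = (g w, g v)" by auto
    then have "p \<in> E" using act_adjI[OF g(1) vw] adj_sym by blast
    then obtain a where a: "a \<in> arcs T" "p = (orig T a, term_of T a)" by (auto simp: adj_rel_def)
    then have "a \<in> arcs S" using g by (auto simp: doubleton_eq_iff)
    then show "p \<in> adj_rel S" using a unfolding adj_rel_def by auto
  qed
  have graphT: "is_graph T" using tree by (simp add: is_tree_def)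
  have graphS: "is_graph S"
    unfolding is_graph_def
  proof (intro conjI)
    show "orig S ` arcs S \<subseteq> verts S" by (auto simp: vorbit_iff doubleton_eq_iff)
    show "opp S ` arcs S \<subseteq> arcs S" using graphT by (auto simp: is_graph_def term_of_def insert_commute)
    show "\<forall>a\<in>arcs S. opp S (opp S a) = a" using graphT by (auto simp: is_graph_def)
  qed
  have invS: "(g x, g y) \<in> adj_rel S" if "g \<in> G" "(x, y) \<in> adj_rel S" for g x y
  proof -
    have "\<exists>h\<in>G. (x, y) = (h v, h w) \<or> (x, y) = (h w, h v)" using that(2) unfolding adjS by simp
    then obtain h where "h \<in> G" "(x, y) = (h v, h w) \<or> (x, y) = (h w, h v)" ..
    then show ?thesis unfolding adjS using that V by (auto intro!: bexI[of _ "g \<cdot> h"])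
  qed
  have inv: "(g x, g y) \<in> (adj_rel S)\<^sup>*" if "(x, y) \<in> (adj_rel S)\<^sup>*" "g \<in> G" for g x y
    using that(1) by induction (use invS[OF that(2)] in \<open>auto intro: rtrancl_into_rtrancl\<close>)
  have symS: "sym ((adj_rel S)\<^sup>*)"
    by (rule sym_rtrancl) (auto simp: sym_def adjS)
  \<comment> \<open>The elements carrying \<open>v\<close> within its own component of
    \<open>S\<close>. Both stabilisers turn out to lie in this subgroup, so it is all of
    \<open>G\<close> and \<open>S\<close> is connected.\<close>
  define H where "H = {g \<in> G. (v, g v) \<in> (adj_rel S)\<^sup>*}"
  have H: "subgroup H (grp T G)"
  proof (rule subgroupI)
    show "g \<cdot> h \<in> H" if "g \<in> H" "h \<in> H" for g h
      using that inv[of v "h v" g] V by (auto simp: H_def)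
    show "iv h \<in> H" if "h \<in> H" for h
      using that inv[of v "h v" "iv h"] symD[OF symS] V by (auto simp: H_def)
  qed (use V in \<open>auto simp: H_def\<close>)
  have gw: "(g v, g w) \<in> adj_rel S" if "g \<in> G" for g using that by (auto simp: adjS)
  have "vstab T G w \<subseteq> H"
  proof
    fix g assume g: "g \<in> vstab T G w"
    \<comment> \<open>An element fixing \<open>w\<close> moves the edge at \<open>w\<close> to
      another edge at \<open>w\<close>, which gives a walk from \<open>v\<close> through
      \<open>w\<close> to \<open>g v\<close>.\<close>
    then have "(v, w) \<in> (adj_rel S)\<^sup>*" "(w, g v) \<in> (adj_rel S)\<^sup>*"
      using gw[of idt] gw[of g] V symD[OF symS] by auto
    then show "g \<in> H" using g by (auto simp: H_def)
  qed
  moreover have "vstab T G v \<subseteq> H" by (auto simp: H_def)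
  ultimately have HG: "H = G" using two_maximal[OF max ne H] by blast
  have base: "(v, x) \<in> (adj_rel S)\<^sup>*" if "x \<in> verts S" for x
  proof -
    from that obtain g where g: "g \<in> G" "x = g v \<or> x = g w" by (auto simp: vorbit_iff)
    then have "(v, g v) \<in> (adj_rel S)\<^sup>*" using HG by (auto simp: H_def)
    then show ?thesis using g gw[OF g(1)] by (auto intro: rtrancl_into_rtrancl)
  qed
  have "is_connected S"
    unfolding is_connected_def using base symD[OF symS] by (blast intro: rtrancl_trans)
  moreover have "v \<in> verts S" using V by (auto simp: vorbit_iff intro!: bexI[of _ idt])
  moreover have "verts S \<subseteq> V" using V by (auto simp: vorbit_iff)
  ultimately have sub: "is_subtree S T"
    using graphS unfolding is_subtree_def is_subgraph_def by auto
  note SV = \<open>verts S \<subseteq> V\<close>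
  have le: "g ` verts S \<subseteq> verts S \<and> arc_act T g ` arcs S \<subseteq> arcs S" if g: "g \<in> G" for g
  proof
    show "g ` verts S \<subseteq> verts S"
    proof
      fix x assume "x \<in> g ` verts S"
      then obtain h where "h \<in> G" "x = g (h v) \<or> x = g (h w)" by (auto simp: vorbit_iff)
      then show "x \<in> verts S" using g V by (auto simp: vorbit_iff intro: bexI[of _ "g \<cdot> h"])
    qed
    show "arc_act T g ` arcs S \<subseteq> arcs S"
    proof
      fix b assume "b \<in> arc_act T g ` arcs S"
      then obtain a h where a: "a \<in> arcs T" "b = arc_act T g a" "h \<in> G" "{orig T a, term_of T a} = {h v, h w}"
        by auto
      have "b \<in> arcs T" "orig T b = g (orig T a)" "term_of T b = g (term_of T a)"
        using arc_act[OF tree G_auts[OF g] a(1)] a(2) by auto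
      then show "b \<in> arcs S" using a(3,4) g V by (auto simp: doubleton_eq_iff intro!: bexI[of _ "g \<cdot> h"])
    qed
  qed
  have "preserves T G S"
    unfolding preserves_def
  proof (intro ballI conjI)
    fix g assume g: "g \<in> G"
    show "g ` verts S = verts S"
    proof
      show "verts S \<subseteq> g ` verts S"
      proof
        fix x assume x: "x \<in> verts S"
        then have "iv g x \<in> verts S" using le[OF iv_closed[OF g]] by blast
        moreover have "x = g (iv g x)" using x SV g by auto
        ultimately show "x \<in> g ` verts S" by blast
      qed
    qed (use le g in blast)
    show "arc_act T g ` arcs S = arcs S"
    proof
      show "arcs S \<subseteq> arc_act T g ` arcs S"
      proof
        fix b assume b: "b \<in> arcs S"
        let ?a = "arc_act T (iv g) b"
        have bT: "b \<in> arcs T" using b by simp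
        have a: "?a \<in> arcs S" using le[OF iv_closed[OF g]] b by blast
        then have aT: "?a \<in> arcs T" by simp
        have bV: "orig T b \<in> V" "term_of T b \<in> V"
          using bT adj_verts[of "orig T b" "term_of T b"] by (auto simp: adj_rel_def)
        have "orig T (arc_act T g ?a) = orig T b" "term_of T (arc_act T g ?a) = term_of T b"
          using arc_act[OF tree G_auts[OF g] aT] arc_act[OF tree G_auts[OF iv_closed[OF g]] bT] bV g by auto
        then have "arc_act T g ?a = b"
          using tree arc_act(1)[OF tree G_auts[OF g] aT] bT unfolding is_tree_def by blast
        then show "b \<in> arc_act T g ` arcs S" using a by (metis imageI)
      qed
    qed (use le g in blast)
  qed
  then have "\<not> is_proper_subtree S T" using np unfolding preserves_no_proper_subtree_def by blast
  then show ?thesis using sub unfolding is_proper_subtree_def by simp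
qed

text \<open>Condition (iii) with the elements of \<open>G\<close> acting directly instead of being
  cut down to \<open>P\<close>; \<open>primitive_on_restrict\<close> identifies the two
  forms.\<close>

definition bipartite_primitive :: bool where
  "bipartite_primitive \<longleftrightarrow> (\<forall>P\<in>bipartition T. (\<forall>g\<in>G. g ` P = P) \<and> primitive_on P G)"

text \<open>Every vertex stabiliser lies in this subgroup, so two distinct maximal ones force it to
  be \<open>G\<close>, and then no element exchanges the parts.\<close>

lemma even_displacement_subgroup: "subgroup {g \<in> G. \<forall>x\<in>V. even (d x (g x))} (grp T G)"
proof (rule subgroupI)
  show "g \<cdot> h \<in> {g \<in> G. \<forall>x\<in>V. even (d x (g x))}"
    if "g \<in> {g \<in> G. \<forall>x\<in>V. even (d x (g x))}" "h \<in> {g \<in> G. \<forall>x\<in>V. even (d x (g x))}" for g h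
  proof -
    have "even (d x (g (h x)))" if "x \<in> V" for x
      using dist_parity[of x "h x" "g (h x)"] that \<open>g \<in> _\<close> \<open>h \<in> _\<close> by auto
    then show ?thesis using that by auto
  qed
  show "iv h \<in> {g \<in> G. \<forall>x\<in>V. even (d x (g x))}" if "h \<in> {g \<in> G. \<forall>x\<in>V. even (d x (g x))}" for h
  proof -
    have "even (d x (iv h x))" if "x \<in> V" for x
      using \<open>h \<in> _\<close> that dist_sym[of x "iv h x"] by (auto dest!: bspec[of _ _ "iv h x"])
    then show ?thesis using that by auto
  qed
qed auto

lemma even_displacement_invariant:
  assumes "\<And>g x. g \<in> G \<Longrightarrow> x \<in> V \<Longrightarrow> even (d x (g x))" "g \<in> G" "v \<in> V"
  shows "g ` part v = part v"
proof -
  have le: "h ` part v \<subseteq> part v" if "h \<in> G" for h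
    using assms(1)[OF that] dist_parity[OF assms(3), of _ "h _"] that by auto
  show ?thesis
  proof
    show "part v \<subseteq> g ` part v"
    proof
      fix x assume x: "x \<in> part v"
      then have "iv g x \<in> part v" using le[OF iv_closed[OF assms(2)]] by blast
      moreover have "x = g (iv g x)" using x assms by auto
      ultimately show "x \<in> g ` part v" by blast
    qed
  qed (rule le[OF assms(2)])
qed

lemma vstab_even_displacement:
  assumes "v \<in> V" "g \<in> vstab T G v" "x \<in> V"
  shows "even (d x (g x))"
proof -
  have "d x v = d (g x) v" using act_dist[of g x v] assms unfolding vstab_iff by metis
  then show ?thesis using dist_parity[OF assms(3,1), of "g x"] dist_sym[of v "g x"] assms by auto
qed

text \<open>Even displacement confines each of the two orbits to a part, and together they exhaust
  the vertices, so the orbits are the parts. Maximality of a stabiliser gives primitivity on its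
  orbit.\<close>

lemma maximal_pair_imp_bipartite_primitive:
  assumes vw: "(v, w) \<in> E" and ne: "vstab T G v \<noteq> vstab T G w"
    and max: "maximal_subgroup (vstab T G v) (grp T G)" "maximal_subgroup (vstab T G w) (grp T G)"
    and np: "preserves_no_proper_subtree T G"
  shows bipartite_primitive
proof -
  have V: "v \<in> V" "w \<in> V" using adj_verts vw by auto
  have "{g \<in> G. \<forall>x\<in>V. even (d x (g x))} = G"
    by (rule two_maximal[OF max ne even_displacement_subgroup])
      (use vstab_even_displacement V in auto)
  then have ev: "even (d x (g x))" if "g \<in> G" "x \<in> V" for g x using that by blast
  have orb: "vorbit T G u = part u" if u: "(u, u') \<in> E" "V = vorbit T G u \<union> vorbit T G u'" for u u'
  proof
    have uV: "u \<in> V" "u' \<in> V" using adj_verts u by auto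
    show "vorbit T G u \<subseteq> part u" using ev uV by (auto simp: vorbit_iff)
    show "part u \<subseteq> vorbit T G u"
    proof
      fix x assume x: "x \<in> part u"
      have "x \<notin> vorbit T G u'"
      proof
        assume "x \<in> vorbit T G u'"
        then obtain g where g: "g \<in> G" "g u' = x" by (auto simp: vorbit_iff)
        then have "even (d u' x)" using ev uV by auto
        moreover have "odd (d u u')" using dist_adj[OF u(1)] by simp
        ultimately show False using dist_parity[OF uV, of x] x by auto
      qed
      then show "x \<in> vorbit T G u" using x u(2) by blast
    qed
  qed
  have VV: "V = vorbit T G v \<union> vorbit T G w" by (rule maximal_pair_orbits[OF vw ne max np])
  have "part v = vorbit T G v" "part w = vorbit T G w"
    using orb[OF vw VV] orb[OF adj_sym[OF vw]] VV by blast+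
  then show ?thesis
    unfolding bipartite_primitive_def bipartition_eq[OF vw]
    using maximal_stab_primitive[OF V(1) max(1)] maximal_stab_primitive[OF V(2) max(2)]
      even_displacement_invariant[of _ v] even_displacement_invariant[of _ w] ev V by auto
qed

end

section \<open>Primitivity on the parts and local actions\<close>

locale thick_tree_action = tree_action T G for T :: "('v, 'a) arc_graph" and G +
  assumes thick: "\<forall>v\<in>V. infinite (nbrs T v) \<or> 3 \<le> card (nbrs T v)"
begin

lemma third_nbr:
  assumes "v \<in> V"
  obtains z where "(v, z) \<in> E" "z \<noteq> x" "z \<noteq> y"
proof -
  have "\<not> nbrs T v \<subseteq> {x, y}"
  proof
    assume sub: "nbrs T v \<subseteq> {x, y}"
    then have "finite (nbrs T v)" using finite_subset by blast
    moreover have "card (nbrs T v) \<le> card {x, y}" using sub by (intro card_mono) auto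
    moreover have "card {x, y} \<le> 2" by (simp add: card_insert_if)
    ultimately show False using thick assms by auto
  qed
  then obtain z where "z \<in> nbrs T v" "z \<noteq> x" "z \<noteq> y" by blast
  then show ?thesis by (intro that) simp_all
qed

text \<open>The second clause says that a transitive local action is not regular. It is stated for
  \<open>G\<close> itself, on neighbours instead of arcs and before taking closures;
  \<open>locally_primitive_iff_diagram\<close> translates.\<close>

definition locally_primitive :: "'v \<Rightarrow> bool" where
  "locally_primitive v \<longleftrightarrow> primitive_on (nbrs T v) (vstab T G v) \<and>
     (\<exists>g\<in>vstab T G v. \<exists>x\<in>nbrs T v. \<exists>y\<in>nbrs T v. g x = x \<and> g y \<noteq> y)"

lemma nbrs_verts: "nbrs T v \<subseteq> V"
  using adj_verts by auto

lemma vstab_nbrs: "g \<in> vstab T G v \<Longrightarrow> x \<in> nbrs T v \<Longrightarrow> g x \<in> nbrs T v"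
  using act_adjI[of g v x] by auto

lemma locally_primitive_trans:
  assumes "locally_primitive v" "(v, x) \<in> E" "(v, y) \<in> E"
  obtains g where "g \<in> G" "g v = v" "g x = y"
proof -
  have "transitive_on (nbrs T v) (vstab T G v)"
    using assms(1) unfolding locally_primitive_def primitive_on_def by blast
  then have "\<exists>g\<in>vstab T G v. g x = y" using assms(2,3) unfolding transitive_on_def by simp
  then show ?thesis using that by auto
qed

lemma locally_primitive_moves:
  assumes "locally_primitive v" "(v, x) \<in> E" "(v, y) \<in> E" "x \<noteq> y"
  obtains g where "g \<in> G" "g v = v" "g x = x" "g y \<noteq> y"
proof -
  have V: "v \<in> V" using adj_verts assms by blast
  obtain k x0 y0 where k: "k \<in> vstab T G v" "x0 \<in> nbrs T v" "y0 \<in> nbrs T v" "k x0 = x0" "k y0 \<noteq> y0"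
    using assms(1) unfolding locally_primitive_def by blast
  have "\<exists>a\<in>vstab T G v. a x = x \<and> a y \<noteq> y"
  proof (rule primitive_stab_moves[OF vstab_subgroup[OF V] nbrs_verts _ _ k])
    show "a x \<in> nbrs T v" if "a \<in> vstab T G v" "x \<in> nbrs T v" for a x using vstab_nbrs that .
  qed (use assms in \<open>auto simp: locally_primitive_def\<close>)
  then show ?thesis using that by auto
qed

lemma bipartite_primitiveD:
  assumes bipartite_primitive "v \<in> V"
  shows "primitive_on (part v) G" "g \<in> G \<Longrightarrow> g ` part v = part v"
    "g \<in> G \<Longrightarrow> x \<in> part v \<Longrightarrow> g x \<in> part v"
proof -
  have *: "(\<forall>g\<in>G. g ` part v = part v) \<and> primitive_on (part v) G"
    using assms(1) part_in_bipartition[OF assms(2)] unfolding bipartite_primitive_def by (rule bspec)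
  then show "primitive_on (part v) G" by (rule conjunct2)
  show **: "g \<in> G \<Longrightarrow> g ` part v = part v" using * by (rule conjunct1[THEN bspec])
  then show "g \<in> G \<Longrightarrow> x \<in> part v \<Longrightarrow> g x \<in> part v" by blast
qed

lemma parts_transitive:
  assumes bipartite_primitive "v \<in> V" "x \<in> part v"
  obtains g where "g \<in> G" "g v = x"
proof -
  have "transitive_on (part v) G"
    using bipartite_primitiveD(1)[OF assms(1,2)] unfolding primitive_on_def by blast
  then have "\<exists>g\<in>G. g v = x" using assms mem_part_self[OF assms(2)] unfolding transitive_on_def by blast
  then show ?thesis using that by blast
qed

text \<open>The connected components of a proper invariant set of edges are blocks on each part. They
  cannot be everything, so they are trivial.\<close>
lemma invariant_edges_matching:
  assumes bp: bipartite_primitive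
    and Q: "Q \<subset> E" "sym Q" "\<And>g p q. g \<in> G \<Longrightarrow> (p, q) \<in> Q \<Longrightarrow> (g p, g q) \<in> Q"
    and xy: "(x, y1) \<in> Q" "(x, y2) \<in> Q"
  shows "y1 = y2"
proof (rule ccontr)
  assume ne: "y1 \<noteq> y2"
  have V: "x \<in> V" "y1 \<in> V" "y2 \<in> V" using xy Q adj_verts by blast+
  define P where "P = part y1"
  define R where "R = {(a, b). a \<in> P \<and> b \<in> P \<and> (a, b) \<in> Q\<^sup>*}"
  have adjP: "a \<in> P \<longleftrightarrow> b \<notin> P" if "(a, b) \<in> E" for a b unfolding P_def by (rule part_adj[OF that V(2)])
  have inv: "(g a, g b) \<in> Q\<^sup>*" if "(a, b) \<in> Q\<^sup>*" "g \<in> G" for g a b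
    using that(1) by induction (use Q(3)[OF that(2)] in \<open>auto intro: rtrancl_into_rtrancl\<close>)
  have "equiv P R"
  proof (rule equivI)
    show "sym R" using sym_rtrancl[OF Q(2)] by (auto simp: R_def sym_def)
    show "trans R" by (auto simp: R_def trans_def intro: rtrancl_trans)
  qed (auto simp: R_def refl_on_def)
  moreover have "\<forall>g\<in>G. \<forall>(a, b)\<in>R. (g a, g b) \<in> R"
    using inv bipartite_primitiveD(3)[OF bp V(2)] by (auto simp: R_def P_def)
  ultimately have "R = Id_on P \<or> R = P \<times> P"
    using bipartite_primitiveD(1)[OF bp V(2)] unfolding primitive_on_def P_def by blast
  moreover have "(y1, y2) \<in> R"
  proof -
    have "(y1, x) \<in> Q" using xy(1) Q(2) by (auto dest: symD)
    then have "(y1, y2) \<in> Q\<^sup>*" using xy(2) by auto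
    moreover have "y1 \<in> P" using V by (simp add: P_def)
    moreover have "y2 \<in> P" using adjP[of x y1] adjP[of x y2] xy Q(1) \<open>y1 \<in> P\<close> by blast
    ultimately show ?thesis by (simp add: R_def)
  qed
  ultimately have R: "R = P \<times> P" using ne by auto
  \<comment> \<open>An edge missing from \<open>Q\<close>, oriented so that it starts in
    \<open>P\<close>. A further neighbour of \<open>q\<close> also lies in \<open>P\<close>, so a
    \<open>Q\<close>-walk should join it to \<open>p\<close>.\<close>
  obtain p q where pq: "(p, q) \<in> E" "(p, q) \<notin> Q" "p \<in> P"
    using Q(1,2) adjP adj_sym by (metis psubset_imp_ex_mem surj_pair Diff_iff symD)
  obtain p' where p': "(q, p') \<in> E" "p' \<noteq> p" using third_nbr[of q] adj_verts pq by metis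
  have "p' \<in> P" using adjP[of q p'] adjP[of p q] p' pq by blast
  then have path: "(p', p) \<in> Q\<^sup>*" using R pq(3) by (auto simp: R_def)
  \<comment> \<open>Such a walk cannot leave the side of \<open>q\<close>, since the only exit is
    the missing edge.\<close>
  have "z \<in> half T p q" if "(p', z) \<in> Q\<^sup>*" for z
    using that
  proof induction
    case base
    show ?case using half_step[of q T p q p'] p' adj_neq[OF pq(1)] by (auto simp: doubleton_eq_iff)
  next
    case (step z z')
    then have "{z, z'} \<noteq> {p, q}" using pq(2) Q(2) by (auto simp: doubleton_eq_iff dest: symD)
    then show ?case using step half_step[of z T p q z'] Q(1) by blast
  qed
  with path bridge[OF pq(1)] show False by blast
qed

text \<open>If \<open>y1\<close> and \<open>y2\<close> lay in different orbits of the stabiliser of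
  \<open>v\<close>, each of the two edge orbits would be proper, hence meet every vertex at most
  once. Their union meets \<open>v\<close> twice, so it must be the set of all edges; but then a
  third edge at \<open>v\<close> repeats one of the orbits.\<close>

lemma bipartite_primitive_local_trans:
  assumes bp: bipartite_primitive and y: "(v, y1) \<in> E" "(v, y2) \<in> E"
  shows "\<exists>g\<in>G. g v = v \<and> g y1 = y2"
proof (rule ccontr)
  assume neg: "\<not> ?thesis"
  have V: "v \<in> V" "y1 \<in> V" "y2 \<in> V" using y adj_verts by blast+
  define Q where "Q = (\<lambda>y. {(a, b). \<exists>g\<in>G. (a, b) = (g v, g y) \<or> (a, b) = (g y, g v)})"
  have QE: "Q y \<subseteq> E" if "(v, y) \<in> E" for y
    using act_adjI[OF _ that] act_adjI[OF _ adj_sym[OF that]] by (auto simp: Q_def)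
  have Qsym: "sym (Q y)" for y by (auto simp: Q_def sym_def)
  have Qinv: "(g p, g q) \<in> Q y" if "g \<in> G" "(p, q) \<in> Q y" "(v, y) \<in> E" for g p q y
  proof -
    have "\<exists>h\<in>G. (p, q) = (h v, h y) \<or> (p, q) = (h y, h v)" using that(2) unfolding Q_def by simp
    then obtain h where "h \<in> G" "(p, q) = (h v, h y) \<or> (p, q) = (h y, h v)" ..
    then show ?thesis using that(1) V adj_verts[OF that(3)] unfolding Q_def by (auto intro!: bexI[of _ "g \<cdot> h"])
  qed
  have Qv: "\<exists>g\<in>G. g v = v \<and> g y = y'" if "(v, y') \<in> Q y" "(v, y) \<in> E" for y y'
  proof -
    have "\<exists>g\<in>G. (v, y') = (g v, g y) \<or> (v, y') = (g y, g v)" using that(1) unfolding Q_def by simp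
    then obtain g where g: "g \<in> G" "(v, y') = (g v, g y) \<or> (v, y') = (g y, g v)" ..
    have "(v, y') \<in> E" using QE[OF that(2)] that(1) by blast
    then have "y' \<notin> part v" using part_adj[OF _ V(1)] V mem_part_self by blast
    \<comment> \<open>The vertex \<open>g v\<close> stays in the part of \<open>v\<close>, so the
      edge cannot have been reversed.\<close>
    then have "y' \<noteq> g v" using bipartite_primitiveD(3)[OF bp V(1) g(1), of v] V mem_part_self by blast
    then show ?thesis using g by (intro bexI[of _ g]) auto
  qed
  have idt: "(v, y) \<in> Q y" if "(v, y) \<in> E" for y
    using adj_verts[OF that] by (auto simp: Q_def intro!: bexI[of _ idt])
  have "(v, y2) \<notin> Q y1" using Qv[of y2 y1] y neg by blast
  then have proper1: "Q y1 \<subset> E" using QE y by blast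
  have "(v, y1) \<notin> Q y2"
  proof
    assume "(v, y1) \<in> Q y2"
    then obtain g where g: "g \<in> G" "g v = v" "g y2 = y1" using Qv y by blast
    then have "iv g v = v" "iv g y1 = y2" using V act_iv(1)[of g v] act_iv(1)[of g y2] by auto
    then show False using neg g by (blast intro: iv_closed)
  qed
  then have proper2: "Q y2 \<subset> E" using QE y by blast
  have ne: "y1 \<noteq> y2" using \<open>(v, y2) \<notin> Q y1\<close> idt y by blast
  \<comment> \<open>The matching property applies to the union as well, and the union contains two
    edges at \<open>v\<close>.\<close>
  have all: "Q y1 \<union> Q y2 = E"
  proof (rule ccontr)
    assume "Q y1 \<union> Q y2 \<noteq> E"
    then have "Q y1 \<union> Q y2 \<subset> E" using QE y by blast
    moreover have "sym (Q y1 \<union> Q y2)" using Qsym by (simp add: sym_Un)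
    ultimately have "y1 = y2"
      using invariant_edges_matching[OF bp, of "Q y1 \<union> Q y2" v y1 y2] Qinv y idt by blast
    then show False using ne by simp
  qed
  obtain z where z: "(v, z) \<in> E" "z \<noteq> y1" "z \<noteq> y2" using third_nbr V by metis
  have "z = y" if "(v, z) \<in> Q y" "(v, y) \<in> E" "Q y \<subset> E" for y
    using invariant_edges_matching[OF bp that(3) Qsym _ that(1) idt[OF that(2)]] Qinv that(2) by blast
  then show False using all z proper1 proper2 y by blast
qed

text \<open>Translating \<open>R0\<close> to all stars in the orbit of \<open>v\<close> generates an
  invariant relation on the other part. If this is equality, so is \<open>R0\<close>. If it is
  universal, look from \<open>v\<close> at a chain of translated pairs: a pair at another star does
  not change the branch, and a pair at \<open>v\<close> changes it only within an
  \<open>R0\<close>-class, so \<open>R0\<close> is universal too.\<close>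

lemma bipartite_primitive_local_primitive:
  assumes bp: bipartite_primitive and v: "v \<in> V"
  shows "primitive_on (nbrs T v) (vstab T G v)"
  unfolding primitive_on_def
proof (intro conjI allI impI)
  show "transitive_on (nbrs T v) (vstab T G v)"
    unfolding transitive_on_def
  proof (intro ballI)
    fix x y assume "x \<in> nbrs T v" "y \<in> nbrs T v"
    then have "\<exists>g\<in>G. g v = v \<and> g x = y"
      using bipartite_primitive_local_trans[OF bp] by simp
    then show "\<exists>h\<in>vstab T G v. h x = y" by auto
  qed
  fix R0 assume R0: "equiv (nbrs T v) R0 \<and> (\<forall>h\<in>vstab T G v. \<forall>(x, y)\<in>R0. (h x, h y) \<in> R0)"
  have inv0: "(h x, h y) \<in> R0" if "h \<in> G" "h v = v" "(x, y) \<in> R0" for h x y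
    using R0 that by auto
  have eq0: "R0 \<subseteq> nbrs T v \<times> nbrs T v" "refl_on (nbrs T v) R0" "sym R0" "trans R0"
    using R0 by (auto simp: equiv_def)
  obtain y0 where y0: "(v, y0) \<in> E" using third_nbr[OF v] by metis
  have y0V: "y0 \<in> V" using y0 adj_verts by blast
  define P where "P = part y0"
  have adjP: "a \<in> P \<longleftrightarrow> b \<notin> P" if "(a, b) \<in> E" for a b unfolding P_def by (rule part_adj[OF that y0V])
  have vP: "v \<notin> P" using adjP[OF y0] y0V by (simp add: P_def)
  have nP: "y \<in> P" if "(v, y) \<in> E" for y using adjP[OF that] vP by blast
  have gP: "g p \<in> P" if "g \<in> G" "p \<in> P" for g p using bipartite_primitiveD(3)[OF bp y0V that(1)] that by (auto simp: P_def)
  \<comment> \<open>All translates of pairs of \<open>R0\<close>; the relation generated by them is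
    \<open>R\<close>.\<close>
  define W where "W = {(a, b). \<exists>g\<in>G. \<exists>(p, q)\<in>R0. (a, b) = (g p, g q)}"
  define R where "R = {(a, b). a \<in> P \<and> b \<in> P \<and> (a, b) \<in> W\<^sup>*}"
  have WI: "(g p, g q) \<in> W" if "g \<in> G" "(p, q) \<in> R0" for g p q using that by (auto simp: W_def)
  have symW: "sym W" using eq0(3) by (auto simp: W_def sym_def)
  have invW: "(g a, g b) \<in> W" if "(a, b) \<in> W" "g \<in> G" for g a b
  proof -
    from that(1) obtain h p q where h: "h \<in> G" "(p, q) \<in> R0" "a = h p" "b = h q"
      unfolding W_def by blast
    then have "p \<in> V" "q \<in> V" using eq0(1) nbrs_verts by blast+
    then show ?thesis using WI[of "g \<cdot> h" p q] h that(2) by simp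
  qed
  have inv: "(g a, g b) \<in> W\<^sup>*" if "(a, b) \<in> W\<^sup>*" "g \<in> G" for g a b
    using that(1) by induction (use invW[OF _ that(2)] in \<open>auto intro: rtrancl_into_rtrancl\<close>)
  have "equiv P R"
  proof (rule equivI)
    show "sym R" using sym_rtrancl[OF symW] by (auto simp: R_def sym_def)
    show "trans R" by (auto simp: R_def trans_def intro: rtrancl_trans)
  qed (auto simp: R_def refl_on_def)
  moreover have "\<forall>g\<in>G. \<forall>(a, b)\<in>R. (g a, g b) \<in> R" using inv gP by (auto simp: R_def)
  ultimately have R: "R = Id_on P \<or> R = P \<times> P"
    using bipartite_primitiveD(1)[OF bp y0V] unfolding primitive_on_def P_def by blast
  have R0R: "R0 \<subseteq> R"
  proof clarify
    fix p q assume pq: "(p, q) \<in> R0"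
    then have n: "(v, p) \<in> E" "(v, q) \<in> E" using eq0(1) by auto
    then have "p \<in> V" "q \<in> V" using adj_verts by auto
    then have "(p, q) \<in> W" using WI[of idt p q] pq by simp
    then show "(p, q) \<in> R" using nP n by (auto simp: R_def)
  qed
  show "R0 = Id_on (nbrs T v) \<or> R0 = nbrs T v \<times> nbrs T v"
  proof (cases "R = Id_on P")
    case True
    then have "R0 = Id_on (nbrs T v)" using R0R eq0(1,2) by (auto simp: refl_on_def Id_on_def)
    then show ?thesis ..
  next
    case False
    then have R: "R = P \<times> P" using R by blast
    have "(w, w') \<in> R0" if w: "(v, w) \<in> E" "(v, w') \<in> E" for w w'
    proof -
      \<comment> \<open>Invariant of the chain: the branch at \<open>v\<close> that is currently
        occupied starts with a vertex in the \<open>R0\<close>-class of \<open>w\<close>.\<close>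
      have "\<exists>u. (w, u) \<in> R0 \<and> z \<in> half T v u" if "(w, z) \<in> W\<^sup>*" for z
        using that
      proof induction
        case base
        show ?case using eq0(2) w by (intro exI[of _ w]) (auto simp: refl_on_def)
      next
        case (step a b)
        then obtain u where u: "(w, u) \<in> R0" "a \<in> half T v u" by blast
        have vu: "(v, u) \<in> E" using u eq0(1) by auto
        obtain g p q where g: "g \<in> G" "(p, q) \<in> R0" "a = g p" "b = g q" using step(2) by (auto simp: W_def)
        have pq: "(v, p) \<in> E" "(v, q) \<in> E" using g eq0(1) by auto
        then have gn: "(g v, a) \<in> E" "(g v, b) \<in> E" using act_adjI g by auto
        show ?case
        proof (cases "g v = v")
          case True
          then have "(a, b) \<in> R0" using inv0 g by auto
          moreover have "a = u" using branch_unique[of v a u a] gn(1) vu u(2) True by auto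
          ultimately have "(w, b) \<in> R0" using u eq0(4) by (blast dest: transD)
          then show ?thesis by (intro exI[of _ b]) auto
        next
          case False
          have "g v \<in> half T v u" using half_boundary[OF vu u(2) adj_sym[OF gn(1)]] False by blast
          \<comment> \<open>Both \<open>a\<close> and \<open>b\<close> are adjacent to
            \<open>g v\<close> and lie in the part opposite to \<open>v\<close>, so passing from one
            to the other through \<open>g v\<close> avoids \<open>v\<close>.\<close>
          moreover have "b \<noteq> v" using gP[OF g(1) nP[OF pq(2)]] g(4) vP by blast
          ultimately have "b \<in> half T v u" using half_boundary[OF vu _ gn(2)] by blast
          then show ?thesis using u by blast
        qed
      qed
      moreover have "(w, w') \<in> W\<^sup>*" using R nP w by (auto simp: R_def)
      ultimately obtain u where u: "(w, u) \<in> R0" "w' \<in> half T v u" by blast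
      then have "(v, u) \<in> E" using eq0(1) by auto
      then have "w' = u" using branch_unique[of v w' u w'] w u by auto
      then show ?thesis using u by simp
    qed
    then show ?thesis using eq0(1) by auto
  qed
qed

text \<open>If all local point stabilisers at \<open>v\<close> were trivial, folding the tree onto the star of \<open>v\<close>
  would colour the part of the neighbours of \<open>v\<close>, and having the same colour would be a nontrivial
  invariant equivalence relation.\<close>
lemma bipartite_primitive_local_moves:
  assumes bp: bipartite_primitive and v: "v \<in> V"
  shows "\<exists>g\<in>vstab T G v. \<exists>x\<in>nbrs T v. \<exists>y\<in>nbrs T v. g x = x \<and> g y \<noteq> y"
proof (rule ccontr)
  assume neg: "\<not> ?thesis"
  \<comment> \<open>Freeness on the star: an element of the stabiliser of \<open>v\<close> is
    determined there by its value at one neighbour.\<close>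
  have rigid: "g y = h y" if "g \<in> G" "h \<in> G" "g v = v" "h v = v" "(v, x) \<in> E" "g x = h x" "(v, y) \<in> E" for g h x y
  proof -
    have V: "x \<in> V" "y \<in> V" using that adj_verts by auto
    have "(iv h \<cdot> g) \<in> vstab T G v" "(iv h \<cdot> g) x = x" using that v V iv_fix[of h v] by auto
    moreover have "x \<in> nbrs T v" "y \<in> nbrs T v" using that by auto
    ultimately have "(iv h \<cdot> g) y = y" using neg by blast
    then have "h (iv h (g y)) = h y" using that V by simp
    then show ?thesis using that V by simp
  qed
  define A where "A = part v"
  have vA: "v \<in> A" using v by (simp add: A_def)
  have adjA: "a \<in> A \<longleftrightarrow> b \<notin> A" if "(a, b) \<in> E" for a b unfolding A_def by (rule part_adj[OF that v])
  have gA: "g p \<in> A" if "g \<in> G" "p \<in> A" for g p using bipartite_primitiveD(3)[OF bp v that(1)] that by (auto simp: A_def)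
  have AV: "A \<subseteq> V" by (auto simp: A_def)
  \<comment> \<open>An admissible element at \<open>x\<close> is a chart: it carries
    \<open>x\<close> to \<open>v\<close> when \<open>x\<close> is in \<open>A\<close>, and to a
    neighbour of \<open>v\<close> otherwise. The relation \<open>Q\<close> makes the charts at the
    ends of an edge agree at the end outside \<open>A\<close>.\<close>
  define P where "P = (\<lambda>x h. h \<in> G \<and> (x \<in> A \<longrightarrow> h x = v) \<and> (x \<notin> A \<longrightarrow> (v, h x) \<in> E))"
  define Q where "Q = (\<lambda>x y h k. if x \<in> A then h y = (k y :: 'v) else h x = k x)"
  have ext: "\<exists>k. P y k \<and> Q x y h k" if "(x, y) \<in> E" "P x h" for x y h
  proof (cases "x \<in> A")
    case True
    then have h: "h \<in> G" "h x = v" using that(2) by (auto simp: P_def)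
    then have "(v, h y) \<in> E" using act_adjI[OF h(1) that(1)] by simp
    then have "P y h" using h adjA[OF that(1)] True by (simp add: P_def)
    then show ?thesis using True by (intro exI[of _ h]) (simp add: Q_def)
  next
    case False
    then have h: "h \<in> G" "(v, h x) \<in> E" using that(2) by (auto simp: P_def)
    have "(h x, h y) \<in> E" using act_adjI[OF h(1) that(1)] .
    \<comment> \<open>Both \<open>h y\<close> and \<open>v\<close> are neighbours of
      \<open>h x\<close>, so local transitivity at \<open>h x\<close> corrects the chart without
      changing its value at \<open>x\<close>.\<close>
    then obtain g where g: "g \<in> G" "g (h x) = h x" "g (h y) = v"
      using bipartite_primitive_local_trans[OF bp, of "h x" "h y" v] adj_sym h(2) by metis
    have "P y (g \<cdot> h)" "Q x y h (g \<cdot> h)"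
      using g h False adjA[OF that(1)] adj_verts[OF that(1)] by (simp_all add: P_def Q_def)
    then show ?thesis by blast
  qed
  have "P v idt" using v vA by (simp add: P_def)
  obtain f where fP: "\<And>x. x \<in> V \<Longrightarrow> P x (f x)"
    and fQ: "\<And>x y. (x, y) \<in> E \<Longrightarrow> d v y = d v x + 1 \<Longrightarrow> Q x y (f x) (f y)"
    using rooted_choice[of v P idt Q] v \<open>P v idt\<close> ext by metis
  define c where "c = (\<lambda>b. f b b)"
  have fG: "f x \<in> G" if "x \<in> V" for x using fP[OF that] by (simp add: P_def)
  have fa: "f a a = v" if "a \<in> A" for a using fP[of a] that AV by (auto simp: P_def)
  \<comment> \<open>The colour of \<open>b\<close> is read off equally by the charts of all its
    neighbours.\<close>
  have fc: "f a b = c b" if "a \<in> A" "(a, b) \<in> E" for a b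
  proof -
    have b: "b \<notin> A" using adjA that by blast
    have V: "a \<in> V" "b \<in> V" using adj_verts that by auto
    have "d v b = d v a + 1 \<or> d v a = d v b + 1"
      using dist_half[OF that(2), of v] dist_half[OF adj_sym[OF that(2)], of v] not_half_iff[OF that(2) v] by auto
    then show ?thesis
      using fQ[OF that(2)] fQ[OF adj_sym[OF that(2)]] that(1) b by (auto simp: Q_def c_def)
  qed
  define B where "B = V - A"
  \<comment> \<open>The action of \<open>g\<close> from the star of \<open>a\<close> to that of
    \<open>g a\<close>, read in the charts: a permutation of the star of \<open>v\<close>.\<close>
  define \<sigma> where "\<sigma> = (\<lambda>g a. f (g a) \<cdot> (g \<cdot> iv (f a)))"
  have \<sigma>: "\<sigma> g a \<in> G \<and> \<sigma> g a v = v \<and> ((a, b) \<in> E \<longrightarrow> \<sigma> g a (c b) = c (g b))" if "g \<in> G" "a \<in> A" for g a b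
  proof -
    have aV: "a \<in> V" "g a \<in> V" using that AV by auto
    have F: "f a \<in> G" "f (g a) \<in> G" using fG aV by auto
    have ifa: "iv (f a) v = a" using fa[OF that(2)] F aV act_iv(1)[of "f a" a] by simp
    have 1: "\<sigma> g a \<in> G" using F that by (simp add: \<sigma>_def)
    have 2: "\<sigma> g a v = v" using F that v ifa fa[OF gA[OF that]] by (simp add: \<sigma>_def)
    have "\<sigma> g a (c b) = c (g b)" if ab: "(a, b) \<in> E"
    proof -
      from ab have bV: "b \<in> V" using adj_verts by auto
      have "iv (f a) (c b) = b" using fc[OF \<open>a \<in> A\<close> ab] F bV act_iv(1)[of "f a" b] by simp
      moreover have "c b \<in> V" using fc[OF \<open>a \<in> A\<close> ab] F bV by (metis act_closed)
      moreover have "f (g a) (g b) = c (g b)" using fc[OF gA[OF \<open>g \<in> G\<close> \<open>a \<in> A\<close>] act_adjI[OF \<open>g \<in> G\<close> ab]] .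
      ultimately show ?thesis using F \<open>g \<in> G\<close> bV by (simp add: \<sigma>_def)
    qed
    with 1 2 show ?thesis by blast
  qed
  have cn: "(v, c b) \<in> E" if "b \<in> B" for b using fP[of b] that by (simp add: P_def c_def B_def)
  \<comment> \<open>Two vertices of \<open>A\<close> with a common neighbour \<open>b\<close> give
    permutations that agree at the colour of \<open>b\<close>, so they agree on the star by
    rigidity. Connectedness then makes \<open>\<sigma> g a\<close> independent of
    \<open>a\<close>.\<close>
  have \<sigma>2: "\<sigma> g a y = \<sigma> g a' y" if "g \<in> G" "a \<in> A" "a' \<in> A" "(a, b) \<in> E" "(a', b) \<in> E" "(v, y) \<in> E" for g a a' b y
  proof (rule rigid[of "\<sigma> g a" "\<sigma> g a'" "c b"])
    have "b \<in> B" using that adjA adj_verts by (auto simp: B_def)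
    then show "(v, c b) \<in> E" by (rule cn)
    show "\<sigma> g a (c b) = \<sigma> g a' (c b)" using \<sigma>[of g a b] \<sigma>[of g a' b] that by simp
  qed (use \<sigma> that in auto)
  have \<sigma>v: "(x \<in> A \<longrightarrow> \<sigma> g x y = \<sigma> g v y) \<and> (x \<notin> A \<longrightarrow> (\<forall>a. (x, a) \<in> E \<longrightarrow> \<sigma> g a y = \<sigma> g v y))"
    if g: "g \<in> G" and y: "(v, y) \<in> E" and x: "(v, x) \<in> E\<^sup>*" for g x y
    using x
  proof induction
    case base
    show ?case using vA by simp
  next
    case (step x x')
    show ?case
    proof (cases "x \<in> A")
      case True
      then have "x' \<notin> A" using adjA step(2) by blast
      moreover have "\<sigma> g a y = \<sigma> g v y" if a: "(x', a) \<in> E" for a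
      proof -
        have "a \<in> A" using adjA[OF a] \<open>x' \<notin> A\<close> by blast
        then have "\<sigma> g a y = \<sigma> g x y" using \<sigma>2[OF g _ True adj_sym[OF a] step(2) y] by blast
        then show ?thesis using step True by simp
      qed
      ultimately show ?thesis by simp
    next
      case False
      then show ?thesis using step adjA by blast
    qed
  qed
  \<comment> \<open>Consequently \<open>g\<close> permutes the colours by the single map
    \<open>\<sigma> g v\<close>, and having equal colours is an invariant relation.\<close>
  have cg: "c (g b) = \<sigma> g v (c b)" if g: "g \<in> G" and b: "b \<in> B" for g b
  proof -
    have "b \<in> V" using b by (simp add: B_def)
    then obtain a where a: "(b, a) \<in> E" using third_nbr by metis
    have aA: "a \<in> A" using adjA[OF a] b by (auto simp: B_def)
    then have "a \<in> V" using AV by blast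
    then have "\<sigma> g a (c b) = \<sigma> g v (c b)" using \<sigma>v[OF g cn[OF b] connected[OF v]] aA by blast
    then show ?thesis using \<sigma>[OF g aA, of b] adj_sym[OF a] by simp
  qed
  obtain y0 where y0: "(v, y0) \<in> E" using third_nbr[OF v] by metis
  have y0V: "y0 \<in> V" using y0 adj_verts by auto
  have y0B: "y0 \<in> B" using y0V adjA[OF y0] vA by (simp add: B_def)
  have B: "B = part y0"
  proof -
    have "even (d v x) \<longleftrightarrow> odd (d y0 x)" if "x \<in> V" for x
      using dist_adj_neq[OF y0 that] dist_sym by metis
    then show ?thesis by (auto simp: B_def A_def)
  qed
  have gB: "g b \<in> B" if "g \<in> G" "b \<in> B" for g b
    using bipartite_primitiveD(3)[OF bp y0V] that unfolding B by blast
  define R where "R = {(b, b'). b \<in> B \<and> b' \<in> B \<and> c b = c b'}"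
  have "equiv B R" by (rule equivI) (auto simp: R_def refl_on_def sym_def trans_def)
  moreover have "\<forall>g\<in>G. \<forall>(a, b)\<in>R. (g a, g b) \<in> R" using gB cg by (auto simp: R_def)
  ultimately have R: "R = Id_on B \<or> R = B \<times> B"
    using bipartite_primitiveD(1)[OF bp y0V] unfolding primitive_on_def B by blast
  have fv: "f v \<in> G" "f v v = v" using fG v fa vA by auto
  obtain y1 where y1: "(v, y1) \<in> E" "y1 \<noteq> y0" using third_nbr[OF v] by metis
  have y1B: "y1 \<in> B" using y1 adjA[OF y1(1)] vA adj_verts by (auto simp: B_def)
  \<comment> \<open>Different neighbours of \<open>v\<close> have different colours, so the relation
    is not universal.\<close>
  have "c y0 \<noteq> c y1" using fc[OF vA y0] fc[OF vA y1(1)] fv y0V y1 adj_verts[OF y1(1)] by (metis act_inj)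
  then have "R = Id_on B" using R y0B y1B by (auto simp: R_def)
  obtain a' where a': "(y0, a') \<in> E" "a' \<noteq> v" using third_nbr[OF y0V] by metis
  have a'A: "a' \<in> A" using adjA[OF a'(1)] y0B by (auto simp: B_def)
  obtain b where b: "(a', b) \<in> E" "b \<noteq> y0" using third_nbr[of a'] a' adj_verts by metis
  have bB: "b \<in> B" using adjA[OF b(1)] a'A adj_verts[OF b(1)] by (auto simp: B_def)
  have "a' \<in> half T v y0" using half_boundary[OF y0 half_refl a'(1)] a'(2) by blast
  moreover have "b \<noteq> v" using bB vA by (auto simp: B_def)
  ultimately have bh: "b \<in> half T v y0" using half_boundary[OF y0 _ b(1)] by blast
  have "c b \<in> V" using cn[OF bB] adj_verts by auto
  \<comment> \<open>All colours already occur around \<open>v\<close>: this neighbour of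
    \<open>v\<close> shares its colour with \<open>b\<close>, which is not adjacent to
    \<open>v\<close>, so the relation is not equality either.\<close>
  define y' where "y' = iv (f v) (c b)"
  have y': "(v, y') \<in> E"
    using act_adjI[OF iv_closed[OF fv(1)] cn[OF bB]] iv_fix[OF fv(1) v fv(2)] by (simp add: y'_def)
  have "f v y' = c b" using fv \<open>c b \<in> V\<close> by (simp add: y'_def)
  then have "c y' = c b" using fc[OF vA y'] by simp
  moreover have "y' \<in> B" using adjA[OF y'] vA adj_verts[OF y'] by (auto simp: B_def)
  ultimately have "y' = b" using \<open>R = Id_on B\<close> bB by (auto simp: R_def)
  then have "b = y0" using branch_unique[OF y' y0, of b] bh by simp
  then show False using b by simp
qed

lemma bipartite_primitive_locally_primitive:
  "bipartite_primitive \<Longrightarrow> v \<in> V \<Longrightarrow> locally_primitive v"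
  unfolding locally_primitive_def
  using bipartite_primitive_local_primitive bipartite_primitive_local_moves by blast

text \<open>If one edge had both ends in the same orbit, local transitivity would put every
  neighbour of every vertex of that orbit into it, and by connectedness there would be one orbit
  only.\<close>

lemma orbits_separate_adjacent:
  assumes loc: "\<forall>v\<in>V. locally_primitive v"
    and two: "x0 \<in> V" "y0 \<in> V" "vorbit T G x0 \<noteq> vorbit T G y0"
    and xy: "(x, y) \<in> E" and g: "g \<in> G"
  shows "g x \<noteq> y"
proof
  assume gx: "g x = y"
  have xV: "x \<in> V" using adj_verts xy by auto
  have "z \<in> vorbit T G x" if "(x, z) \<in> E\<^sup>*" for z
    using that
  proof induction
    case base
    show ?case using xV by (auto simp: vorbit_iff intro!: bexI[of _ idt])
  next
    case (step z z')
    then obtain h where h: "h \<in> G" "h x = z" by (auto simp: vorbit_iff)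
    have "(z, h y) \<in> E" using act_adjI[OF h(1) xy] h(2) by simp
    then obtain k where k: "k \<in> G" "k (h y) = z'"
      using locally_primitive_trans[of z "h y" z'] loc step(2) adj_verts by metis
    have "(k \<cdot> (h \<cdot> g)) x = z'" using h k g gx xV by simp
    then show ?case using h k g unfolding vorbit_iff by (intro bexI[of _ "k \<cdot> (h \<cdot> g)"]) auto
  qed
  then have all: "z \<in> vorbit T G x" if "z \<in> V" for z using connected[OF xV that] by blast
  have "vorbit T G x = vorbit T G z" if "z \<in> V" for z
    using all[OF that] vorbit_eq_iff[OF xV that] unfolding vorbit_iff by blast
  then show False using two by blast
qed

text \<open>Adjacent vertices lie in different orbits and there are just two, so the orbits
  alternate along walks.\<close>

lemma parts_eq_orbits:
  assumes loc: "\<forall>v\<in>V. locally_primitive v"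
    and two: "x0 \<in> V" "y0 \<in> V" "vorbit T G x0 \<noteq> vorbit T G y0" "V = vorbit T G x0 \<union> vorbit T G y0"
    and v: "v \<in> V"
  shows "part v = vorbit T G v"
proof -
  note sep = orbits_separate_adjacent[OF loc two(1-3)]
  have orbit_mem: "x \<in> vorbit T G x" if "x \<in> V" for x
    using that by (auto simp: vorbit_iff intro!: bexI[of _ idt])
  have eqI: "vorbit T G x = vorbit T G y" if "y \<in> vorbit T G x" "x \<in> V" "y \<in> V" for x y
    using that vorbit_eq_iff unfolding vorbit_iff by blast
  have ne: "vorbit T G x \<noteq> vorbit T G y" if "(x, y) \<in> E" for x y
    using sep[OF that] vorbit_eq_iff adj_verts[OF that] by blast
  have only: "vorbit T G x = vorbit T G x0 \<or> vorbit T G x = vorbit T G y0" if "x \<in> V" for x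
    using that two eqI by blast
  have walk: "vorbit T G x = vorbit T G v \<longleftrightarrow> even n" if "(v, x) \<in> E ^^ n" for n x
    using that
  proof (induction n arbitrary: x)
    case (Suc n)
    then obtain u where u: "(v, u) \<in> E ^^ n" "(u, x) \<in> E" by auto
    have "vorbit T G u = vorbit T G v \<longleftrightarrow> even n" using Suc.IH u by blast
    moreover have "vorbit T G u \<noteq> vorbit T G x" using ne u by blast
    moreover have "x \<in> V" "u \<in> V" using adj_verts u by auto
    ultimately show ?case using only[of x] only[of u] only[OF v] by (simp) metis
  qed simp
  have "x \<in> vorbit T G v \<longleftrightarrow> even (d v x)" if "x \<in> V" for x
    using walk[OF dist_walk[OF v that]] eqI[OF _ v that] orbit_mem[OF that] by metis
  moreover have "vorbit T G v \<subseteq> V" using v by (auto simp: vorbit_iff)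
  ultimately show ?thesis by blast
qed

lemma locally_primitive_imp_bipartite_primitive:
  assumes P: "property_P T G" and loc: "\<forall>v\<in>V. locally_primitive v"
    and two: "x0 \<in> V" "y0 \<in> V" "vorbit T G x0 \<noteq> vorbit T G y0" "V = vorbit T G x0 \<union> vorbit T G y0"
  shows bipartite_primitive
proof -
  have parts: "part v = vorbit T G v" if "v \<in> V" for v using parts_eq_orbits[OF loc two that] .
  have inv1: "g x \<in> part v" if "g \<in> G" "v \<in> V" "x \<in> part v" for g v x
  proof -
    have "x \<in> vorbit T G v" using that(3) parts[OF that(2)] by simp
    then obtain h where "h \<in> G" "h v = x" by (auto simp: vorbit_iff)
    then show ?thesis unfolding parts[OF that(2)] using that by (auto simp: vorbit_iff intro!: bexI[of _ "g \<cdot> h"])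
  qed
  have inv: "g ` part v = part v" if "g \<in> G" "v \<in> V" for g v
  proof
    show "part v \<subseteq> g ` part v"
    proof
      fix x assume x: "x \<in> part v"
      then have "iv g x \<in> part v" using inv1[OF iv_closed[OF that(1)] that(2)] by blast
      moreover have "x = g (iv g x)" using x that by auto
      ultimately show "x \<in> g ` part v" by blast
    qed
  qed (use inv1 that in blast)
  have "primitive_on (part v) G" if v: "v \<in> V" for v
    unfolding primitive_on_def
  proof (intro conjI allI impI)
    show "transitive_on (part v) G"
      unfolding transitive_on_def
    proof (intro ballI)
      fix x y assume "x \<in> part v" "y \<in> part v"
      then obtain g h where gh: "g \<in> G" "h \<in> G" "g v = x" "h v = y"
        unfolding parts[OF v] vorbit_iff by blast
      then have "(h \<cdot> iv g) x = y" using v by auto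
      then show "\<exists>h\<in>G. h x = y" using gh by (intro bexI[of _ "h \<cdot> iv g"]) auto
    qed
    fix R assume R: "equiv (part v) R \<and> (\<forall>h\<in>G. \<forall>(x, y)\<in>R. (h x, h y) \<in> R)"
    then have Rinv: "(h x, h y) \<in> R" if "h \<in> G" "(x, y) \<in> R" for h x y using that by blast
    have eq: "R \<subseteq> part v \<times> part v" "refl_on (part v) R" "sym R" "trans R" using R by (simp_all add: equiv_def)
    have adjP: "a \<in> part v \<longleftrightarrow> b \<notin> part v" if "(a, b) \<in> E" for a b by (rule part_adj[OF that v])
    show "R = Id_on (part v) \<or> R = part v \<times> part v"
    proof (cases "\<exists>x y. (x, y) \<in> R \<and> x \<noteq> y")
      case False
      then have "R = Id_on (part v)" using eq(1,2) by (auto simp: refl_on_def Id_on_def)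
      then show ?thesis ..
    next
      case True
      then obtain x y where xy: "(x, y) \<in> R" "x \<noteq> y" by blast
      then have xyP: "x \<in> part v" "y \<in> part v" using eq(1) by blast+
      then have V: "x \<in> V" "y \<in> V" by auto
      obtain u where u: "(x, u) \<in> E" "y \<in> half T x u" using branch_ex[OF V] xy by auto
      have uP: "u \<notin> part v" using adjP[OF u(1)] xyP by blast
      have uV: "u \<in> V" using adj_verts u by auto
      \<comment> \<open>The path from \<open>x\<close> to \<open>y\<close> starts with
        \<open>x\<close>, \<open>u\<close>, \<open>x'\<close>.\<close>
      obtain x' where x': "(u, x') \<in> E" "y \<in> half T u x'" using branch_ex[OF uV V(2)] uP xyP by metis
      have "x' \<noteq> x" using half_disjoint[OF u(1)] u(2) x'(2) by blast
      obtain h0 where h0: "h0 \<in> G" "h0 u = u" "h0 x' = x'" "h0 x \<noteq> x"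
        using locally_primitive_moves[OF bspec[OF loc uV] x'(1) adj_sym[OF u(1)] \<open>x' \<noteq> x\<close>] by metis
      \<comment> \<open>Independence at the edge between \<open>u\<close> and \<open>x'\<close>:
        keep the action of \<open>h0\<close> on the side of \<open>x\<close> and make it trivial on
        the side of \<open>y\<close>. Then \<open>x\<close> and \<open>h x\<close> are both related
        to \<open>y\<close>, and both are neighbours of \<open>u\<close>.\<close>
      obtain h where h: "h \<in> G" "\<And>z. z \<in> half T x' u \<Longrightarrow> h z = h0 z" "\<And>z. z \<in> half T u x' \<Longrightarrow> h z = z"
        using edge_independence[OF P adj_sym[OF x'(1)] h0(1,3,2)] by metis
      have "x \<in> half T x' u" using half_boundary[OF adj_sym[OF x'(1)] half_refl adj_sym[OF u(1)]] \<open>x' \<noteq> x\<close> by blast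
      then have hx: "h x \<noteq> x" "h y = y" "h u = u" using h h0 x' by auto
      have "(h x, y) \<in> R" using Rinv[OF h(1) xy(1)] hx by simp
      then have xhx: "(x, h x) \<in> R" using xy(1) eq(3,4) by (blast dest: symD transD)
      have uhx: "(u, h x) \<in> E" using act_adjI[OF h(1) adj_sym[OF u(1)]] hx by simp
      define R' where "R' = R \<inter> nbrs T u \<times> nbrs T u"
      have nP: "z \<in> part v" if "(u, z) \<in> E" for z using adjP[OF that] uP by blast
      have "equiv (nbrs T u) R'"
      proof (rule equivI)
        show "refl_on (nbrs T u) R'" using eq(2) nP by (auto simp: R'_def refl_on_def)
        show "sym R'" using eq(3) by (auto simp: R'_def sym_def)
        show "trans R'" using eq(4) unfolding R'_def trans_def by blast
      qed (auto simp: R'_def)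
      moreover have "\<forall>k\<in>vstab T G u. \<forall>(a, b)\<in>R'. (k a, k b) \<in> R'"
        using Rinv vstab_nbrs by (auto simp: R'_def)
      ultimately have "R' = Id_on (nbrs T u) \<or> R' = nbrs T u \<times> nbrs T u"
        using bspec[OF loc uV] unfolding locally_primitive_def primitive_on_def by blast
      moreover have "(x, h x) \<in> R'" using xhx uhx u adj_sym by (simp add: R'_def)
      ultimately have R': "R' = nbrs T u \<times> nbrs T u" using hx by auto
      \<comment> \<open>The relation is universal on the star of \<open>u\<close>, and every vertex
        outside \<open>part v\<close> is a translate of \<open>u\<close>.\<close>
      have star: "(a, b) \<in> R" if z: "z \<in> V" "z \<notin> part v" "(z, a) \<in> E" "(z, b) \<in> E" for z a b
      proof -
        have "odd (d v z)" "odd (d v u)" using z uP uV by auto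
        then have "z \<in> part u" using dist_parity[OF uV v, of z] z(1) dist_sym[of u v] by simp
        then obtain g where g: "g \<in> G" "g u = z" using parts[OF uV] by (auto simp: vorbit_iff)
        have abV: "a \<in> V" "b \<in> V" using z adj_verts by auto
        have "(iv g z, iv g a) \<in> E" "(iv g z, iv g b) \<in> E" using z act_adjI[OF iv_closed[OF g(1)]] by auto
        moreover have "iv g z = u" using g uV by auto
        ultimately have "(iv g a, iv g b) \<in> R" using R' by (auto simp: R'_def)
        then have "(g (iv g a), g (iv g b)) \<in> R" using Rinv[OF g(1)] by blast
        then show ?thesis using g abV by simp
      qed
      \<comment> \<open>Walking outwards from \<open>x\<close>, each star centred outside
        \<open>part v\<close> is absorbed as soon as one of its vertices is related to
        \<open>x\<close>.\<close>
      have "(z \<in> part v \<longrightarrow> (x, z) \<in> R) \<and> (z \<notin> part v \<longrightarrow> (\<forall>t. (z, t) \<in> E \<longrightarrow> (x, t) \<in> R))"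
        if "(x, z) \<in> E\<^sup>*" for z
        using that
      proof induction
        case base
        show ?case using eq(2) xyP by (simp add: refl_on_def)
      next
        case (step z z')
        show ?case
        proof (cases "z \<in> part v")
          case True
          then have z': "z' \<notin> part v" "z' \<in> V" using adjP[OF step(2)] adj_verts[OF step(2)] by auto
          have "(x, t) \<in> R" if "(z', t) \<in> E" for t
            using star[OF z'(2,1) adj_sym[OF step(2)] that] step True eq(4) by (blast dest: transD)
          then show ?thesis using z' by blast
        next
          case False
          then show ?thesis using step adjP by blast
        qed
      qed
      then have "(x, z) \<in> R" if "z \<in> part v" for z using connected[OF V(1)] that by blast
      then have "R = part v \<times> part v" using eq by (blast dest: symD transD)
      then show ?thesis ..
    qed
  qed
  then show ?thesis using inv unfolding bipartite_primitive_def bipartition_eq_image by blast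
qed

section \<open>Maximality and incomparability of vertex stabilisers\<close>

lemma bipartite_primitive_maximal:
  assumes bp: bipartite_primitive and v: "v \<in> V"
  shows "maximal_subgroup (vstab T G v) (grp T G)"
proof -
  obtain u where u: "(v, u) \<in> E" using third_nbr[OF v] by metis
  then obtain w where w: "(u, w) \<in> E" "w \<noteq> v" using third_nbr[of u] adj_verts by metis
  have "w \<in> part v" using part_adj[OF u v] part_adj[OF w(1) v] v mem_part_self by blast
  show ?thesis
  proof (rule primitive_maximal_stab[OF _ _ bipartite_primitiveD(1)[OF bp v] mem_part_self[OF v] \<open>w \<in> part v\<close> w(2)])
    show "g ` part v = part v" if "g \<in> G" for g using bipartite_primitiveD(2)[OF bp v that] .
  qed auto
qed

text \<open>An element fixing \<open>v\<close> and moving the branch that contains \<open>w\<close>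
  to another branch must move \<open>w\<close>.\<close>

lemma locally_primitive_stab_not_le:
  assumes loc: "locally_primitive v" and v: "v \<in> V" "w \<in> V" "v \<noteq> w"
  shows "\<not> vstab T G v \<subseteq> vstab T G w"
proof -
  obtain u where u: "(v, u) \<in> E" "w \<in> half T v u" using branch_ex[OF v(1,2)] v(3) by metis
  obtain u' where u': "(v, u') \<in> E" "u' \<noteq> u" using third_nbr[OF v(1)] by metis
  obtain g where g: "g \<in> G" "g v = v" "g u = u'" using locally_primitive_trans[OF loc u(1) u'(1)] by metis
  have "g w \<in> half T v u'" using act_half[OF g(1) u(1) v(2)] u g by simp
  then have "g w \<noteq> w" using branch_unique[OF u(1) u'(1) u(2)] u'(2) by metis
  then show ?thesis using g by auto
qed

text \<open>Primitivity makes the stabiliser of the edge to \<open>x\<close> maximal in that of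
  \<open>y\<close>, and by nonregularity the stabiliser of the edge to \<open>z\<close> is not
  contained in it.\<close>

lemma adjacent_edge_stabs_generate:
  assumes loc: "locally_primitive y" and xz: "(y, x) \<in> E" "(y, z) \<in> E" "x \<noteq> z"
    and H: "subgroup H (grp T G)" "vstab T G y \<inter> vstab T G x \<subseteq> H" "vstab T G y \<inter> vstab T G z \<subseteq> H"
  shows "vstab T G y \<subseteq> H"
proof -
  have y: "y \<in> V" using adj_verts xz by auto
  have sub: "subgroup (H \<inter> vstab T G y) (grp T G)"
    using K.subgroups_Inter_pair[OF H(1) vstab_subgroup[OF y]] .
  have "H \<inter> vstab T G y = {a \<in> vstab T G y. a x = x} \<or> H \<inter> vstab T G y = vstab T G y"
  proof (rule primitive_stab_maximal[OF vstab_subgroup[OF y] nbrs_verts _ _ _ sub])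
    show "a t \<in> nbrs T y" if "a \<in> vstab T G y" "t \<in> nbrs T y" for a t using vstab_nbrs that .
    show "primitive_on (nbrs T y) (vstab T G y)" using loc by (simp add: locally_primitive_def)
  qed (use xz H in auto)
  moreover obtain g where "g \<in> G" "g y = y" "g z = z" "g x \<noteq> x"
    using locally_primitive_moves[OF loc xz(2,1)] xz(3) by metis
  then have "g \<in> H \<inter> vstab T G y" "g \<notin> {a \<in> vstab T G y. a x = x}" using H by auto
  ultimately show ?thesis by blast
qed

section \<open>Open subgroups\<close>

text \<open>If \<open>H\<close> contains the fixator of a finite set \<open>F\<close> and an element \<open>h\<close> moving \<open>F\<close> far
  away, then both half-trees at an edge between \<open>F\<close> and \<open>h F\<close> have their fixators in \<open>H\<close>.\<close>
lemma open_unbounded_whole: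
  assumes P: "property_P T G" and bp: bipartite_primitive
    and H: "subgroup H (grp T G)" "openin (group_topology T G) H"
    and unb: "\<not> bounded_action T H"
  shows "H = G"
proof -
  note HG = subgroupD[OF H(1)]
  have loc: "\<And>v. v \<in> V \<Longrightarrow> locally_primitive v" by (rule bipartite_primitive_locally_primitive[OF bp])
  obtain F where F: "finite F" "F \<subseteq> V" "fixator G F \<subseteq> H" using open_subgroup_fixator[OF H(2,1)] by blast
  obtain v where v: "v \<in> V" "\<And>n. \<exists>x\<in>vorbit T H v. \<exists>y\<in>vorbit T H v. n < d x y"
    using unb unfolding bounded_action_def by (meson not_le)
  define r where "r = Max (insert 0 (d v ` F))"
  have r: "d v f \<le> r" if "f \<in> F" for f unfolding r_def using F that by (intro Max_ge) auto
  \<comment> \<open>The set \<open>F\<close> lies within distance \<open>r\<close> of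
    \<open>v\<close>. Distance at least \<open>2 * r + 3\<close> leaves three consecutive edges that
    separate \<open>F\<close> from its image under \<open>h\<close>, hence two adjacent vertices
    each lying on two of these edges.\<close>
  obtain h where h: "h \<in> H" "2 * r + 3 < d v (h v)"
  proof -
    obtain x y where xy: "x \<in> vorbit T H v" "y \<in> vorbit T H v" "2 * r + 3 < d x y" using v(2) by meson
    then obtain h1 h2 where hh: "h1 \<in> H" "h2 \<in> H" "h1 v = x" "h2 v = y" by (auto simp: orbit_def)
    then have hG: "h1 \<in> G" "h2 \<in> G" using HG by auto
    then have "d (iv h1 (h1 v)) (iv h1 (h2 v)) = d (h1 v) (h2 v)" by (intro act_dist) (use v in auto)
    moreover have "(iv h1 \<cdot> h2) v = iv h1 (h2 v)" "iv h1 (h1 v) = v" using hG v(1) by auto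
    ultimately have "d v ((iv h1 \<cdot> h2) v) = d x y" unfolding hh(3,4)[symmetric] by (simp only:)
    then show ?thesis using that[of "iv h1 \<cdot> h2"] hh HG xy by auto
  qed
  define n where "n = d v (h v)"
  have hG: "h \<in> G" using h HG by blast
  have hv: "h v \<in> V" using hG v by simp
  obtain p where p: "p 0 = v" "p n = h v" "\<And>i. i < n \<Longrightarrow> (p i, p (Suc i)) \<in> E"
    using dist_walk[OF v(1) hv] unfolding n_def relpow_fun_conv by blast
  have pV: "p i \<in> V" if "i \<le> n" for i
  proof (cases i)
    case (Suc j)
    then show ?thesis using adj_verts(2)[OF p(3)[of j]] that by simp
  qed (use v p in simp)
  have seg: "(p i, p j) \<in> E ^^ (j - i)" if "i \<le> j" "j \<le> n" for i j
    unfolding relpow_fun_conv using that p(3) by (intro exI[of _ "\<lambda>t. p (i + t)"]) auto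
  have dv: "d v (p i) = i" "d (p i) (h v) = n - i" if "i \<le> n" for i
  proof -
    have "d v (p i) \<le> i" "d (p i) (h v) \<le> n - i"
      using dist_le[OF seg[of 0 i]] dist_le[OF seg[of i n]] that p by auto
    moreover have "n \<le> d v (p i) + d (p i) (h v)"
      unfolding n_def by (rule dist_triangle) (use v hv pV that in auto)
    ultimately show "d v (p i) = i" "d (p i) (h v) = n - i" using that by auto
  qed
  \<comment> \<open>The first bound keeps \<open>F\<close> on the near side of the edge, the second
    keeps the image of \<open>F\<close> under \<open>h\<close> on the far side.\<close>
  have edge: "vstab T G (p i) \<inter> vstab T G (p (Suc i)) \<subseteq> H" if i: "r \<le> i" "Suc i + r \<le> n" for i
  proof -
    have e: "(p i, p (Suc i)) \<in> E" using p(3) i by simp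
    have vh: "v \<in> half T (p (Suc i)) (p i)"
      using half_iff_dist[OF adj_sym[OF e] v(1)] dv i by simp
    have hvh: "h v \<in> half T (p i) (p (Suc i))"
      using half_iff_dist[OF e hv] dv[of i] dv[of "Suc i"] dist_sym[of "h v"] i by simp
    have Fh: "F \<subseteq> half T (p (Suc i)) (p i)"
    proof
      fix f assume f: "f \<in> F"
      show "f \<in> half T (p (Suc i)) (p i)"
      proof (rule ccontr)
        assume "f \<notin> half T (p (Suc i)) (p i)"
        then have "f \<in> half T (p i) (p (Suc i))" using not_half_iff[OF adj_sym[OF e]] f F by blast
        then have "d v f = d v (p i) + 1 + d (p (Suc i)) f" using dist_cross[OF adj_sym[OF e] vh] by blast
        then show False using r[OF f] dv[of i] i by simp
      qed
    qed
    have hFh: "h f \<in> half T (p i) (p (Suc i))" if f: "f \<in> F" for f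
    proof (rule ccontr)
      have fV: "f \<in> V" using f F by blast
      assume "h f \<notin> half T (p i) (p (Suc i))"
      then have "h f \<in> half T (p (Suc i)) (p i)" using not_half_iff[OF e] hG fV by simp
      then have "d (h v) (h f) = d (h v) (p (Suc i)) + 1 + d (p i) (h f)" using dist_cross[OF e hvh] by blast
      moreover have "d (h v) (h f) = d v f" by (rule act_dist) (use hG v fV in auto)
      moreover have "d (h v) (p (Suc i)) = n - Suc i" using dv(2)[of "Suc i"] i dist_sym[of "h v"] by simp
      ultimately show False using r[OF f] i by linarith
    qed
    have "fixator G (half T (p (Suc i)) (p i)) \<subseteq> H" using Fh F(3) by (auto simp: fixator_def)
    moreover have "fixator G (half T (p i) (p (Suc i))) \<subseteq> H"
    proof
      fix g assume g: "g \<in> fixator G (half T (p i) (p (Suc i)))"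
      then have gG: "g \<in> G" by (simp add: fixator_def)
      \<comment> \<open>On the far side the fixator is conjugated back by \<open>h\<close> into the
        fixator of \<open>F\<close>.\<close>
      have "(iv h \<cdot> (g \<cdot> h)) f = f" if "f \<in> F" for f
        using g hFh[OF that] that F hG gG by (auto simp: fixator_def)
      then have "iv h \<cdot> (g \<cdot> h) \<in> H" using F(3) gG hG by (auto simp: fixator_def)
      then have "h \<cdot> (iv h \<cdot> (g \<cdot> h)) \<cdot> iv h \<in> H" by (rule HG(2)[OF HG(2)[OF h(1)] HG(3)[OF h(1)]])
      moreover have "h \<cdot> (iv h \<cdot> (g \<cdot> h)) \<cdot> iv h = g" by (rule act_eqI) (use hG gG in auto)
      ultimately show "g \<in> H" by simp
    qed
    ultimately show ?thesis using edge_stab_le[OF P e H(1)] by auto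
  qed
  have stab: "vstab T G (p (Suc i)) \<subseteq> H" if i: "r \<le> i" "Suc (Suc i) + r \<le> n" for i
  proof (rule adjacent_edge_stabs_generate[OF loc])
    show "p (Suc i) \<in> V" using pV i by simp
    show "(p (Suc i), p i) \<in> E" "(p (Suc i), p (Suc (Suc i))) \<in> E" using p(3) i adj_sym by auto
    show "p i \<noteq> p (Suc (Suc i))" using dv(1)[of i] dv(1)[of "Suc (Suc i)"] i by auto
    show "vstab T G (p (Suc i)) \<inter> vstab T G (p i) \<subseteq> H" using edge[of i] i by auto
    show "vstab T G (p (Suc i)) \<inter> vstab T G (p (Suc (Suc i))) \<subseteq> H" using edge[of "Suc i"] i by auto
  qed (rule H)
  have "n > 2 * r + 3" using h n_def by simp
  then have s: "vstab T G (p (Suc r)) \<subseteq> H" "vstab T G (p (Suc (Suc r))) \<subseteq> H" and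
    e: "(p (Suc r), p (Suc (Suc r))) \<in> E"
    using stab[of r] stab[of "Suc r"] p(3)[of "Suc r"] by auto
  have eV: "p (Suc r) \<in> V" "p (Suc (Suc r)) \<in> V" using adj_verts e by auto
  show "H = G"
    by (rule two_maximal[OF bipartite_primitive_maximal[OF bp eV(1)] bipartite_primitive_maximal[OF bp eV(2)] _ H(1) s])
      (use locally_primitive_stab_not_le[OF loc[OF eV(1)] eV adj_neq[OF e]] in blast)
qed

text \<open>The vertices minimising the greatest distance to a bounded orbit form a vertex or an edge.\<close>
lemma bounded_centre:
  assumes H: "subgroup H (grp T G)" and bd: "bounded_action T H" and v: "v \<in> V"
  obtains M where "M \<subseteq> V" "M \<noteq> {}" "\<And>h x. h \<in> H \<Longrightarrow> x \<in> M \<Longrightarrow> h x \<in> M"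
    "\<And>x y. x \<in> M \<Longrightarrow> y \<in> M \<Longrightarrow> x \<noteq> y \<Longrightarrow> (x, y) \<in> E"
proof -
  note HG = subgroupD[OF H]
  define X where "X = vorbit T H v"
  have X: "x \<in> X \<longleftrightarrow> (\<exists>h\<in>H. h v = x)" for x by (auto simp: X_def orbit_def)
  have XV: "X \<subseteq> V" using X HG v by auto
  have vX: "v \<in> X" using X HG v by (auto intro!: bexI[of _ idt])
  have hX: "h x \<in> X" if "h \<in> H" "x \<in> X" for h x
  proof -
    from that(2) obtain k where "k \<in> H" "k v = x" unfolding X ..
    then have "(h \<cdot> k) v = h x" "h \<cdot> k \<in> H" using that HG v by auto
    then show ?thesis using X by blast
  qed
  obtain N where N: "\<And>x y. x \<in> X \<Longrightarrow> y \<in> X \<Longrightarrow> d x y \<le> N"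
    using bd v unfolding bounded_action_def X_def by meson
  define B where "B = (\<lambda>n x. x \<in> V \<and> (\<forall>z\<in>X. d x z \<le> n))"
  have "B N v" using N vX v by (auto simp: B_def)
  \<comment> \<open>The least radius of a ball containing the orbit; the set \<open>M\<close> will
    consist of all centres of such balls.\<close>
  define m where "m = (LEAST n. \<exists>x. B n x)"
  have m: "\<exists>x. B m x" unfolding m_def by (rule LeastI_ex) (use \<open>B N v\<close> in blast)
  have min: "\<not> B n x" if "n < m" for n x using that not_less_Least unfolding m_def by blast
  show ?thesis
  proof (rule that[of "{x. B m x}"])
    show "{x. B m x} \<subseteq> V" by (auto simp: B_def)
    show "{x. B m x} \<noteq> {}" using m by blast
    show "h x \<in> {x. B m x}" if h: "h \<in> H" and x: "x \<in> {x. B m x}" for h x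
    proof -
      have "d (h x) z \<le> m" if z: "z \<in> X" for z
      proof -
        have "iv h z \<in> X" using hX HG h z by blast
        then have "d x (iv h z) \<le> m" using x by (auto simp: B_def)
        moreover have "d (h x) (h (iv h z)) = d x (iv h z)"
          using HG h x z XV by (intro act_dist) (auto simp: B_def)
        moreover have "h (iv h z) = z" using HG h z XV by auto
        ultimately show ?thesis by simp
      qed
      then show ?thesis using HG h x by (auto simp: B_def)
    qed
    show "(x, y) \<in> E" if xy: "x \<in> {x. B m x}" "y \<in> {x. B m x}" "x \<noteq> y" for x y
    proof (rule ccontr)
      assume nE: "(x, y) \<notin> E"
      have V: "x \<in> V" "y \<in> V" using xy by (auto simp: B_def)
      obtain u where u: "(x, u) \<in> E" "y \<in> half T x u" using branch_ex[OF V] xy(3) by metis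
      have uV: "u \<in> V" using adj_verts u by auto
      have "y \<noteq> u" using nE u by blast
      then obtain w where w: "(u, w) \<in> E" "y \<in> half T u w" using branch_ex[OF uV V(2)] by metis
      have "w \<noteq> x" using half_disjoint[OF u(1)] u(2) w(2) by blast
      \<comment> \<open>If \<open>x\<close> and \<open>y\<close> were centres at distance at least
        2, the vertex \<open>u\<close> next to \<open>x\<close> on the way to \<open>y\<close> would
        be a better one: a point beyond \<open>u\<close> is farther from \<open>x\<close> than from
        \<open>u\<close>, and any other point is farther from \<open>y\<close>.\<close>
      have less: "d u z < m" if z: "z \<in> X" for z
      proof (cases "z \<in> half T u w")
        case False
        have zV: "z \<in> V" using z XV by blast
        have "z \<in> half T w u" using not_half_iff[OF w(1) zV] False by simp
        then have "d y z = d y w + 1 + d u z" using dist_cross[OF w(1,2)] by blast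
        moreover have "d y z \<le> m" using xy(2) z by (auto simp: B_def)
        ultimately show ?thesis by simp
      next
        case True
        have "z \<in> half T x u" using half_mono[OF w(1) u(1)] \<open>w \<noteq> x\<close> True by blast
        then have "d z x = d z u + 1" using dist_half[OF u(1)] by blast
        moreover have "d x z \<le> m" using xy(1) z by (auto simp: B_def)
        ultimately show ?thesis using dist_sym[of z] by simp
      qed
      have "0 < m" using less[OF vX] by simp
      moreover have "d u z \<le> m - 1" if "z \<in> X" for z using less[OF that] by simp
      then have "B (m - 1) u" using uV by (simp add: B_def)
      ultimately show False using min[of "m - 1"] by simp
    qed
  qed
qed

text \<open>An overgroup \<open>H\<close> of the stabiliser of \<open>v\<close> is open, hence
  bounded if proper, and preserves a centre. The stabiliser of \<open>v\<close> fixes this centre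
  pointwise, so by incomparability the centre is \<open>v\<close> and \<open>H\<close> fixes
  \<open>v\<close>.\<close>

lemma open_bounded_imp_maximal:
  assumes bd: "\<And>H. subgroup H (grp T G) \<Longrightarrow> H \<noteq> G \<Longrightarrow> openin (group_topology T G) H \<Longrightarrow> bounded_action T H"
    and inc: "\<And>v w. v \<in> V \<Longrightarrow> w \<in> V \<Longrightarrow> v \<noteq> w \<Longrightarrow> \<not> vstab T G v \<subseteq> vstab T G w"
    and v: "v \<in> V"
  shows "maximal_subgroup (vstab T G v) (grp T G)"
proof -
  obtain u where u: "(v, u) \<in> E" using third_nbr[OF v] by blast
  have "\<not> vstab T G u \<subseteq> vstab T G v" by (rule inc) (use adj_verts[OF u] adj_neq[OF u] in auto)
  moreover have "vstab T G u \<subseteq> G" by auto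
  ultimately have "vstab T G v \<noteq> G" by blast
  moreover have "H = vstab T G v" if H: "subgroup H (grp T G)" "vstab T G v \<subseteq> H" "H \<noteq> G" for H
  proof -
    note HG = subgroupD[OF H(1)]
    have "bounded_action T H" using bd H subgroup_open[OF H(1) v H(2)] by blast
    then obtain M where M: "M \<subseteq> V" "M \<noteq> {}" "\<And>h x. h \<in> H \<Longrightarrow> x \<in> M \<Longrightarrow> h x \<in> M"
      "\<And>x y. x \<in> M \<Longrightarrow> y \<in> M \<Longrightarrow> x \<noteq> y \<Longrightarrow> (x, y) \<in> E"
      using bounded_centre[OF H(1) _ v] by metis
    have fixM: "g x = x" if "g \<in> vstab T G v" "x \<in> M" for g x
    proof (rule ccontr)
      assume ne: "g x \<noteq> x"
      have "g x \<in> M" using M(3) H(2) that by blast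
      then have e: "(x, g x) \<in> E" using M(4) that ne by metis
      \<comment> \<open>An element fixing \<open>v\<close> preserves the distance to
        \<open>v\<close>, whereas adjacent vertices have distances of different parity.\<close>
      have "d v (g x) = d (g v) (g x)" using that by simp
      also have "\<dots> = d v x" using that M(1) v by (intro act_dist) auto
      finally show False using dist_adj_neq[OF e v] by simp
    qed
    have "x = v" if "x \<in> M" for x
    proof (rule ccontr)
      assume "x \<noteq> v"
      moreover have "vstab T G v \<subseteq> vstab T G x" using fixM[OF _ that] by auto
      ultimately show False using inc[of v x] v M(1) that by blast
    qed
    then have "M = {v}" using M(2) by blast
    then have "H \<subseteq> vstab T G v" using M(3) HG by auto
    then show ?thesis using H(2) by blast
  qed
  ultimately show ?thesis
    using vstab_subgroup[OF v] unfolding maximal_subgroup_def carrier_grp by blast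
qed

section \<open>Simplicity\<close>

lemma edge_transitive:
  assumes bp: bipartite_primitive and e: "(u, z) \<in> E" "(b, a) \<in> E" "a \<in> part z"
  obtains h where "h \<in> G" "h u = b" "h z = a"
proof -
  have V: "z \<in> V" "u \<in> V" using adj_verts e by auto
  obtain h1 where h1: "h1 \<in> G" "h1 z = a" using parts_transitive[OF bp V(1) e(3)] by blast
  have "(a, h1 u) \<in> E" using act_adjI[OF h1(1) adj_sym[OF e(1)]] h1(2) by simp
  then obtain g where "g \<in> G" "g a = a" "g (h1 u) = b"
    using bipartite_primitive_local_trans[OF bp _ adj_sym[OF e(2)]] by blast
  then show ?thesis using that[of "g \<cdot> h1"] h1 V by simp
qed

lemma normalD:
  assumes "N \<lhd> grp T G"
  shows "subgroup N (grp T G)" "g \<in> G \<Longrightarrow> n \<in> N \<Longrightarrow> g \<cdot> n \<cdot> iv g \<in> N"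
proof -
  have *: "subgroup N (grp T G) \<and> (\<forall>x\<in>G. \<forall>h\<in>N. x \<cdot> h \<cdot> iv x \<in> N)"
    using assms unfolding K.normal_inv_iff carrier_grp mul_def iv_def .
  then show "subgroup N (grp T G)" "g \<in> G \<Longrightarrow> n \<in> N \<Longrightarrow> g \<cdot> n \<cdot> iv g \<in> N" by blast+
qed

text \<open>The orbits of a normal subgroup are blocks. If they were points, \<open>N\<close> would
  fix one part pointwise and with it the whole tree.\<close>

lemma normal_transitive:
  assumes bp: bipartite_primitive and N: "N \<lhd> grp T G" "N \<noteq> {idt}" and v: "v \<in> V" and x: "x \<in> part v"
  obtains n where "n \<in> N" "n v = x"
proof -
  note NG = subgroupD[OF normalD(1)[OF N(1)]] and conj = normalD(2)[OF N(1)]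
  define R where "R = {(x, y). x \<in> part v \<and> y \<in> part v \<and> (\<exists>n\<in>N. n x = y)}"
  have "equiv (part v) R"
  proof (rule equivI)
    show "refl_on (part v) R" using NG(4) by (auto simp: R_def refl_on_def intro!: bexI[of _ idt])
    show "sym R"
    proof (rule symI)
      fix a b assume "(a, b) \<in> R"
      then obtain n where n: "a \<in> part v" "b \<in> part v" "n \<in> N" "n a = b" by (auto simp: R_def)
      then have "iv n b = a" using NG act_iv(1)[of n a] by auto
      then show "(b, a) \<in> R" using n NG(3) unfolding R_def by blast
    qed
    show "trans R"
    proof (rule transI)
      fix a b c assume "(a, b) \<in> R" "(b, c) \<in> R"
      then obtain n m where n: "a \<in> part v" "c \<in> part v" "n \<in> N" "n a = b" "m \<in> N" "m b = c" by (auto simp: R_def)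
      then have "(m \<cdot> n) a = c" using NG by auto
      then show "(a, c) \<in> R" using n NG(2) unfolding R_def by blast
    qed
  qed (auto simp: R_def)
  moreover have "\<forall>h\<in>G. \<forall>(x, y)\<in>R. (h x, h y) \<in> R"
  proof clarify
    fix h a b assume h: "h \<in> G" and "(a, b) \<in> R"
    then obtain n where n: "a \<in> part v" "b \<in> part v" "n \<in> N" "n a = b" by (auto simp: R_def)
    then have "(h \<cdot> n \<cdot> iv h) (h a) = h b" using NG h by auto
    moreover have "h a \<in> part v" "h b \<in> part v" using bipartite_primitiveD(3)[OF bp v h] n by blast+
    ultimately show "(h a, h b) \<in> R" using conj[OF h n(3)] unfolding R_def by blast
  qed
  ultimately have "R = Id_on (part v) \<or> R = part v \<times> part v"
    using bipartite_primitiveD(1)[OF bp v] unfolding primitive_on_def by blast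
  moreover have "R \<noteq> Id_on (part v)"
  proof
    assume R: "R = Id_on (part v)"
    have fix1: "n a = a" if "n \<in> N" "a \<in> part v" for n a
    proof -
      have "n a \<in> part v" using bipartite_primitiveD(3)[OF bp v NG(1)[OF that(1)] that(2)] .
      then have "(a, n a) \<in> R" using that unfolding R_def by blast
      then show ?thesis using R by auto
    qed
    have "n = idt" if n: "n \<in> N" for n
    proof (rule act_eqI)
      fix z assume z: "z \<in> V"
      show "n z = idt z"
      proof (cases "z \<in> part v")
        case False
        obtain a where a: "(z, a) \<in> E" using third_nbr[OF z] by blast
        obtain b where b: "(z, b) \<in> E" "b \<noteq> a" using third_nbr[OF z] by metis
        have ab: "a \<in> part v" "b \<in> part v" using part_adj[OF a v] part_adj[OF b(1) v] False by blast+
        have nz: "(a, n z) \<in> E" "(n z, b) \<in> E"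
          using act_adjI[OF NG(1)[OF n] adj_sym[OF a]] act_adjI[OF NG(1)[OF n] b(1)] fix1[OF n] ab by auto
        \<comment> \<open>A vertex is determined by two of its neighbours: \<open>z\<close> and
          \<open>n z\<close> both start the branch at \<open>a\<close> that contains
          \<open>b\<close>.\<close>
        have "b \<in> half T a z" using half_boundary[OF adj_sym[OF a] half_refl b(1)] b(2) by blast
        moreover have "b \<in> half T a (n z)" using half_boundary[OF nz(1) half_refl nz(2)] b(2) by blast
        ultimately have "z = n z" by (rule branch_unique[OF adj_sym[OF a] nz(1)])
        then show ?thesis using z by simp
      qed (use fix1 n z in simp)
    qed (use NG n in auto)
    then show False using N(2) NG(4) by blast
  qed
  ultimately have "(v, x) \<in> R" using x v by auto
  then show ?thesis using that by (auto simp: R_def)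
qed

text \<open>An element of \<open>N\<close> moving \<open>v\<close> to \<open>v'\<close> at distance
  2 is of the desired kind unless it fixes the midpoint \<open>u\<close>. In that case it is a
  rotation about \<open>u\<close>, and the product of rotations about two successive midpoints is a
  translation.\<close>

lemma normal_translation:
  assumes bp: bipartite_primitive and N: "N \<lhd> grp T G" "N \<noteq> {idt}" and v0: "v0 \<in> V"
  obtains v u v' n where "v \<in> part v0" "(v, u) \<in> E" "(u, v') \<in> E" "v' \<noteq> v" "n \<in> N"
    "half T (n v) (n u) \<subseteq> half T u v'"
proof -
  note NG = subgroupD[OF normalD(1)[OF N(1)]]
  \<comment> \<open>The parameter \<open>t\<close> forbids one midpoint, so that a second step does
    not turn back through the first.\<close>
  have step: "\<exists>u v' n. (v, u) \<in> E \<and> (u, v') \<in> E \<and> v' \<noteq> v \<and> v' \<in> part v0 \<and> n \<in> N \<and> n v = v' \<and> u \<noteq> t"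
    if v: "v \<in> part v0" for v t
  proof -
    have vV: "v \<in> V" using v by simp
    obtain u where u: "(v, u) \<in> E" "u \<noteq> t" using third_nbr[OF vV] by metis
    obtain v' where v': "(u, v') \<in> E" "v' \<noteq> v" using third_nbr[of u] adj_verts[OF u(1)] by metis
    have "v' \<in> part v" "v' \<in> part v0"
      using part_adj[OF u(1)] part_adj[OF v'(1)] vV v0 v mem_part_self by blast+
    moreover obtain n where "n \<in> N" "n v = v'"
      using normal_transitive[OF bp N vV \<open>v' \<in> part v\<close>] by blast
    ultimately show ?thesis using u v' by blast
  qed
  note res = that
  have good: thesis if "v \<in> part v0" "(v, u) \<in> E" "(u, v') \<in> E" "v' \<noteq> v" "n \<in> N" "n v = v'" "n u \<noteq> u" for v u v' n
  proof -
    have "(v', n u) \<in> E" using act_adjI[OF NG(1)[OF that(5)] that(2)] that(6) by simp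
    then have "half T v' (n u) \<subseteq> half T u v'" by (rule half_mono[OF _ that(3)]) (use that(7) in auto)
    then show thesis by (intro res[of v u v' n]) (use that in auto)
  qed
  obtain u v' n1 where 1: "(v0, u) \<in> E" "(u, v') \<in> E" "v' \<noteq> v0" "v' \<in> part v0" "n1 \<in> N" "n1 v0 = v'"
    using step[of v0 v0] v0 by auto
  obtain u' v'' n2 where 2: "(v', u') \<in> E" "(u', v'') \<in> E" "v'' \<noteq> v'" "v'' \<in> part v0" "n2 \<in> N" "n2 v' = v''" "u' \<noteq> u"
    using step[OF 1(4), of u] by auto
  show thesis
  proof (cases "n1 u = u \<and> n2 u' = u'")
    case False
    then show thesis using good[of v0 u v' n1] good[of v' u' v'' n2] 1 2 v0 by auto
  next
    case True
    have V: "u \<in> V" "u' \<in> V" using adj_verts 1 2 by auto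
    \<comment> \<open>Both elements fix their midpoints here. The product sends the half-tree at
      \<open>v0\<close> into one nested three steps further along the path \<open>v0\<close>,
      \<open>u\<close>, \<open>v'\<close>, \<open>u'\<close>, \<open>v''\<close>.\<close>
    have "n2 u \<noteq> u'" using act_inj[OF NG(1)[OF 2(5)] V] True 2(7) by metis
    moreover have "(v'', n2 u) \<in> E" using act_adjI[OF NG(1)[OF 2(5)] 1(2)] 2(6) adj_sym
      by (metis 1(2) 2(5) 2(6) NG(1) act_adjI)
    ultimately have "half T v'' (n2 u) \<subseteq> half T u' v''" using half_mono[OF _ 2(2)] by blast
    also have "\<dots> \<subseteq> half T v' u'" using half_mono[OF 2(2,1)] 2(3) by blast
    also have "\<dots> \<subseteq> half T u v'" using half_mono[OF 2(1) 1(2)] 2(7) by blast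
    finally have "half T ((n2 \<cdot> n1) v0) ((n2 \<cdot> n1) u) \<subseteq> half T u v'"
      using 1 2 True NG V v0 by simp
    then show thesis
      by (intro that[of v0 u v' "n2 \<cdot> n1"]) (use 1 2 NG v0 in auto)
  qed
qed

text \<open>The element \<open>k\<close> is the infinite product of the conjugates of \<open>g\<close> by the powers of \<open>n\<close>, whose
  supports are disjoint.\<close>
lemma commutator_swindle:
  assumes cl: "closedin (group_topology T (auts T)) G"
    and e: "(v, u) \<in> E" "(u, v') \<in> E" "v' \<noteq> v" "(u, z) \<in> E" "z \<noteq> v" "z \<noteq> v'"
    and n: "n \<in> G" "half T (n v) (n u) \<subseteq> half T u v'"
    and g: "g \<in> fixator G (half T z u)"
  obtains k where "k \<in> G" "g = k \<cdot> n \<cdot> iv k \<cdot> iv n"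
proof -
  \<comment> \<open>\<open>D\<close> contains the support of \<open>g\<close>, and \<open>X\<close>
    is a half-tree that \<open>n\<close> maps into itself with image disjoint from
    \<open>D\<close>.\<close>
  define D where "D = half T u z"
  define X where "X = half T v u"
  define m where "m = iv n"
  have gG: "g \<in> G" using g by (simp add: fixator_def)
  have mG: "m \<in> G" using n by (simp add: m_def)
  have nm [simp]: "n (m x) = x" "m (n x) = x" if "x \<in> V" for x using n that by (simp_all add: m_def)
  have DV: "D \<subseteq> V" unfolding D_def using half_verts e by blast
  have DX: "D \<subseteq> X" unfolding D_def X_def using half_mono[OF e(4,1)] e(5) by blast
  have X'X: "half T u v' \<subseteq> X" unfolding X_def using half_mono[OF e(2,1)] e(3) by blast
  have XV: "X \<subseteq> V" unfolding X_def using half_verts e by blast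
  have nX: "n x \<in> half T u v'" if "x \<in> X" for x
    using act_half[OF n(1) e(1), of x] that XV n(2) unfolding X_def by blast
  have disj: "half T u v' \<inter> D = {}" unfolding D_def using branches_disjoint[OF e(2,4)] e(6) by blast
  have gD: "g x = x" if "x \<in> V" "x \<notin> D" for x
  proof -
    have "x \<in> half T z u" using not_half_iff[OF e(4) that(1)] that(2) by (simp add: D_def)
    then show ?thesis using g by (simp add: fixator_def)
  qed
  have gDD: "g x \<in> D" if "x \<in> D" for x
  proof (rule ccontr)
    assume "g x \<notin> D"
    then have "g (g x) = g x" using gD gG DV that by auto
    then have "g x = x" using gG DV that act_inj[of g "g x" x] by auto
    then show False using that \<open>g x \<notin> D\<close> by simp
  qed
  have igDD: "iv g x \<in> D" if "x \<in> D" for x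
  proof (rule ccontr)
    assume "iv g x \<notin> D"
    moreover have "x \<in> V" using DV that by blast
    ultimately have "g (iv g x) = iv g x" by (intro gD) (use gG in auto)
    then show False using \<open>iv g x \<notin> D\<close> that gG \<open>x \<in> V\<close> by simp
  qed
  have nV: "(n ^^ i) x \<in> V" "(m ^^ i) x \<in> V" if "x \<in> V" for i x
    by (induction i) (use that n mG in auto)
  have nmi1: "(n ^^ i) ((m ^^ i) x) = x" if "x \<in> V" for i x
    using that
  proof (induction i arbitrary: x)
    case (Suc i)
    have "(m ^^ Suc i) x = (m ^^ i) (m x)" by (simp add: funpow_swap1)
    then show ?case using Suc mG by simp
  qed simp
  have nmi2: "(m ^^ i) ((n ^^ i) x) = x" if "x \<in> V" for i x
    using that
  proof (induction i arbitrary: x)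
    case (Suc i)
    have "(n ^^ Suc i) x = (n ^^ i) (n x)" by (simp add: funpow_swap1)
    then show ?case using Suc n by simp
  qed simp
  have out: "(n ^^ Suc i) x \<in> half T u v'" if "x \<in> D" for i x
  proof (induction i)
    case 0
    show ?case using nX DX that by auto
  next
    case (Suc i)
    then show ?case using nX X'X by auto
  qed
  have outD: "(n ^^ Suc i) x \<notin> D" if "x \<in> D" for i x using out[OF that, of i] disj by blast
  \<comment> \<open>Positive powers of \<open>n\<close> push \<open>D\<close> off itself, so the
    translates of \<open>D\<close> are pairwise disjoint.\<close>
  have uniq_less: False if "(m ^^ i) x \<in> D" "(m ^^ j) x \<in> D" "i < j" "x \<in> V" for i j x
  proof -
    from that(3) obtain t where t: "j = i + Suc t" using less_iff_Suc_add by auto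
    have "(m ^^ j) x = (m ^^ Suc t) ((m ^^ i) x)"
      unfolding t add.commute[of i] funpow_add comp_apply by simp
    then have "(n ^^ Suc t) ((m ^^ j) x) = (m ^^ i) x" using nmi1[of "(m ^^ i) x" "Suc t"] nV(2)[OF that(4)] by metis
    then show False using outD[OF that(2), of t] that(1) by simp
  qed
  have uniq: "i = j" if "(m ^^ i) x \<in> D" "(m ^^ j) x \<in> D" "x \<in> V" for i j x
    using uniq_less[of i x j] uniq_less[of j x i] that by (meson linorder_neqE_nat)
  \<comment> \<open>Partial products of the conjugates of \<open>g\<close>. Conjugating the previous
    product by \<open>n\<close> and putting \<open>g\<close> in front gives a recursion that
    survives the passage to the limit.\<close>
  define p where "p = rec_nat idt (\<lambda>_ q. g \<cdot> (n \<cdot> (q \<cdot> m)))"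
  have p0: "p 0 = idt" and pS: "p (Suc r) = g \<cdot> (n \<cdot> (p r \<cdot> m))" for r by (simp_all add: p_def)
  have pG: "p r \<in> G" for r by (induction r) (use gG n mG in \<open>simp_all add: p0 pS\<close>)
  have pSx: "p (Suc r) x = g (n (p r (m x)))" if "x \<in> V" for r x
    unfolding pS using pG gG n mG that by simp
  have px: "(\<forall>i<r. (m ^^ i) x \<in> D \<longrightarrow> p r x = (n ^^ i) (g ((m ^^ i) x))) \<and>
      ((\<forall>i<r. (m ^^ i) x \<notin> D) \<longrightarrow> p r x = x)" if "x \<in> V" for r x
    using that
  proof (induction r arbitrary: x)
    case 0
    then show ?case by (simp add: p0)
  next
    case (Suc r)
    have mx: "m x \<in> V" using Suc mG by simp
    have shift: "(m ^^ i) (m x) = (m ^^ Suc i) x" for i by (simp add: funpow_swap1)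
    show ?case
    proof (intro conjI allI impI)
      fix i assume i: "i < Suc r" "(m ^^ i) x \<in> D"
      show "p (Suc r) x = (n ^^ i) (g ((m ^^ i) x))"
      proof (cases i)
        case 0
        then have "(m ^^ j) (m x) \<notin> D" for j
          using uniq[OF i(2), of "Suc j"] Suc(2) shift by auto
        then have "p r (m x) = m x" using Suc(1)[OF mx] by blast
        then show ?thesis using pSx[OF Suc(2)] Suc(2) 0 by simp
      next
        case (Suc j)
        then have D: "(m ^^ j) (m x) \<in> D" "j < r" using i shift by auto
        then have "p r (m x) = (n ^^ j) (g ((m ^^ j) (m x)))" using Suc.IH[OF mx] by blast
        then have "n (p r (m x)) = (n ^^ Suc j) (g ((m ^^ j) (m x)))" by simp
        \<comment> \<open>After at least one application of \<open>n\<close> the point lies outside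
          \<open>D\<close>, so the leading factor \<open>g\<close> leaves it alone.\<close>
        moreover have "\<dots> \<notin> D" "\<dots> \<in> V" using outD gDD[OF D(1)] nV(1) DV by blast+
        ultimately show ?thesis using pSx[OF Suc.prems] gD shift Suc by simp
      qed
    next
      assume no: "\<forall>i<Suc r. (m ^^ i) x \<notin> D"
      then have "\<forall>i<r. (m ^^ i) (m x) \<notin> D" using shift by auto
      then have "p r (m x) = m x" using Suc.IH[OF mx] by blast
      moreover have "x \<notin> D" using no by auto
      ultimately show "p (Suc r) x = x" using pSx[OF Suc(2)] gD Suc(2) by simp
    qed
  qed
  \<comment> \<open>Each point lies in at most one translate of \<open>D\<close>, so the index is
    unique; points outside all translates are fixed.\<close>
  define k where "k = (\<lambda>x\<in>V. if \<exists>i. (m ^^ i) x \<in> D then p (Suc (THE i. (m ^^ i) x \<in> D)) x else x)"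
  have kI: "k x = (n ^^ i) (g ((m ^^ i) x))" if "x \<in> V" "(m ^^ i) x \<in> D" for i x
  proof -
    have "(THE i. (m ^^ i) x \<in> D) = i" using that uniq by blast
    then show ?thesis using that px[OF that(1), of "Suc i"] by (auto simp: k_def)
  qed
  have kN: "k x = x" if "x \<in> V" "\<And>i. (m ^^ i) x \<notin> D" for x using that by (simp add: k_def)
  \<comment> \<open>At a given point at most one factor is nontrivial, so the partial products are
    eventually constant. This makes \<open>k\<close> a limit of elements of
    \<open>G\<close>.\<close>
  have pk: "\<exists>R. \<forall>r\<ge>R. p r x = k x" if "x \<in> V" for x
  proof (cases "\<exists>i. (m ^^ i) x \<in> D")
    case True
    then obtain i where i: "(m ^^ i) x \<in> D" by blast
    then show ?thesis using px[OF that] kI[OF that i] by (intro exI[of _ "Suc i"]) auto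
  next
    case False
    then show ?thesis using px[OF that] kN[OF that] by auto
  qed
  have pkF: "\<exists>R. \<forall>r\<ge>R. \<forall>x\<in>F. p r x = k x" if "finite F" "F \<subseteq> V" for F
    using that
  proof (induction F)
    case (insert x F)
    then obtain R where R: "\<forall>r\<ge>R. \<forall>x\<in>F. p r x = k x" by auto
    obtain R' where R': "\<forall>r\<ge>R'. p r x = k x" using pk[of x] insert by auto
    show ?case using R R' by (intro exI[of _ "max R R'"]) auto
  qed simp
  have two: "\<exists>r. p r x = k x \<and> p r y = k y" if "x \<in> V" "y \<in> V" for x y
    using pkF[of "{x, y}"] that by auto
  have kV: "k x \<in> V" if "x \<in> V" for x using two[OF that that] act_closed[OF pG that] by metis
  have "k \<in> Bij V"
    unfolding Bij_def
  proof (intro IntI CollectI)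
    show "k \<in> extensional V" by (simp add: k_def)
    have "inj_on k V"
    proof (rule inj_onI)
      fix x y assume xy: "x \<in> V" "y \<in> V" "k x = k y"
      then show "x = y" using two[OF xy(1,2)] act_inj[OF pG xy(1,2)] by metis
    qed
    moreover have "y \<in> k ` V" if y: "y \<in> V" for y
    proof (cases "\<exists>i. (m ^^ i) y \<in> D")
      case True
      then obtain i where i: "(m ^^ i) y \<in> D" by blast
      define x where "x = (n ^^ i) (iv g ((m ^^ i) y))"
      have D: "iv g ((m ^^ i) y) \<in> D" using igDD[OF i] .
      then have mx: "(m ^^ i) x = iv g ((m ^^ i) y)" "x \<in> V" using nmi2 nV(1) DV by (auto simp: x_def)
      then have "k x = (n ^^ i) (g (iv g ((m ^^ i) y)))" using kI[of x i] D by simp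
      then have "k x = y" using gG nV(2)[OF y] nmi1[OF y] by simp
      then show ?thesis using mx by blast
    next
      case False
      then show ?thesis using kN[OF y] y by (metis imageI)
    qed
    ultimately show "bij_betw k V V" using kV by (auto simp: bij_betw_def)
  qed
  moreover have "(k x, k y) \<in> E \<longleftrightarrow> (x, y) \<in> E" if "x \<in> V" "y \<in> V" for x y
    using two[OF that] act_adj[OF pG that] by metis
  ultimately have "k \<in> auts T" by (simp add: auts_def)
  then have kG: "k \<in> G"
  proof (rule closed_limit[OF cl])
    show "\<exists>g\<in>G. \<forall>x\<in>F. g x = k x" if "finite F" "F \<subseteq> V" for F using pkF[OF that] pG by blast
  qed
  \<comment> \<open>The limit of the recursion says that \<open>k\<close> is \<open>g\<close> times
    the conjugate of \<open>k\<close> by \<open>n\<close>, which is solved for \<open>g\<close>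
    below.\<close>
  have krec: "k x = g (n (k (m x)))" if x: "x \<in> V" for x
  proof -
    have mx: "m x \<in> V" using mG x by simp
    obtain R R' where R: "\<forall>r\<ge>R. p r x = k x" "\<forall>r\<ge>R'. p r (m x) = k (m x)" using pk[OF x] pk[OF mx] by metis
    have "k x = p (Suc (max R R')) x" using R(1) by simp
    also have "\<dots> = g (n (k (m x)))" using pSx[OF x] R(2) by simp
    finally show ?thesis .
  qed
  show ?thesis
  proof (rule that[OF kG])
    show "g = k \<cdot> n \<cdot> iv k \<cdot> iv n"
    proof (rule act_eqI)
      fix y assume y: "y \<in> V"
      define w where "w = n (iv k (m y))"
      have my: "m y \<in> V" using mG y by simp
      have w: "w \<in> V" "m w = iv k (m y)" using my n kG by (auto simp: w_def)
      have "k w = g (n (k (iv k (m y))))" using krec[OF w(1)] w(2) by simp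
      then have "k w = g y" using kG my y by simp
      then show "g y = (k \<cdot> n \<cdot> iv k \<cdot> iv n) y" using kG n y mG by (simp add: w_def m_def)
    qed (use gG kG n in auto)
  qed
qed

text \<open>After conjugation the support of \<open>g\<close> lies in a branch avoided by a
  translation in \<open>N\<close>. There \<open>g\<close> becomes a commutator with an element of
  \<open>N\<close>, and normality brings it into \<open>N\<close>.\<close>

lemma normal_fixators:
  assumes cl: "closedin (group_topology T (auts T)) G" and bp: bipartite_primitive
    and N: "N \<lhd> grp T G" "N \<noteq> {idt}" and ba: "(b, a) \<in> E"
  shows "fixator G (half T a b) \<subseteq> N"
proof
  note NG = subgroupD[OF normalD(1)[OF N(1)]] and conj = normalD(2)[OF N(1)]
  fix g assume g: "g \<in> fixator G (half T a b)"
  then have gG: "g \<in> G" by (simp add: fixator_def)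
  have aV: "a \<in> V" using adj_verts ba by auto
  obtain v u v' n where *: "v \<in> part a" "(v, u) \<in> E" "(u, v') \<in> E" "v' \<noteq> v" "n \<in> N"
    "half T (n v) (n u) \<subseteq> half T u v'"
    using normal_translation[OF bp N aV] by blast
  have V: "u \<in> V" "v \<in> V" using adj_verts * by auto
  \<comment> \<open>A branch at \<open>u\<close> off both directions of the translation. Having
    \<open>v\<close> in \<open>part a\<close> ensures that \<open>z\<close> can be carried to
    \<open>a\<close>.\<close>
  obtain z where z: "(u, z) \<in> E" "z \<noteq> v" "z \<noteq> v'" using third_nbr[OF V(1)] by metis
  have "z \<in> part a" using part_adj[OF *(2) aV] part_adj[OF z(1) aV] *(1) by blast
  then have "a \<in> part z" using dist_sym aV by auto
  then obtain h where h: "h \<in> G" "h u = b" "h z = a" using edge_transitive[OF bp z(1) ba] by metis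
  have "iv h \<cdot> g \<cdot> h \<in> fixator G (half T z u)"
  proof -
    have "(iv h \<cdot> g \<cdot> h) x = x" if x: "x \<in> half T z u" for x
    proof -
      have xV: "x \<in> V" using half_verts[OF adj_sym[OF z(1)]] x by blast
      then have "h x \<in> half T a b" using act_half[OF h(1) adj_sym[OF z(1)] xV] x h by simp
      then show ?thesis using g h gG xV by (simp add: fixator_def)
    qed
    then show ?thesis using h gG by (simp add: fixator_def)
  qed
  then obtain k where k: "k \<in> G" "iv h \<cdot> g \<cdot> h = k \<cdot> n \<cdot> iv k \<cdot> iv n"
    using commutator_swindle[OF cl *(2,3,4) z NG(1)[OF *(5)] *(6)] by metis
  \<comment> \<open>The commutator is a conjugate of \<open>n\<close> times the inverse of
    \<open>n\<close>.\<close>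
  then have "iv h \<cdot> g \<cdot> h \<in> N" using NG conj *(5) by simp
  then have "h \<cdot> (iv h \<cdot> g \<cdot> h) \<cdot> iv h \<in> N" using conj h by blast
  moreover have "h \<cdot> (iv h \<cdot> g \<cdot> h) \<cdot> iv h = g" by (rule act_eqI) (use gG h in auto)
  ultimately show "g \<in> N" by simp
qed

text \<open>A nontrivial normal subgroup contains the fixators of both half-trees at each edge,
  hence by independence all edge stabilisers, hence all vertex stabilisers, and two adjacent ones
  generate.\<close>

lemma bipartite_primitive_simple:
  assumes cl: "closedin (group_topology T (auts T)) G" and P: "property_P T G" and bp: bipartite_primitive
  shows "is_simple (grp T G)"
  unfolding is_simple_def
proof (intro conjI allI impI)
  have loc: "\<And>v. v \<in> V \<Longrightarrow> locally_primitive v" by (rule bipartite_primitive_locally_primitive[OF bp])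
  obtain v where v: "v \<in> V" using tree unfolding is_tree_def by blast
  obtain w where vw: "(v, w) \<in> E" using third_nbr[OF v] by blast
  then have w: "w \<in> V" using adj_verts by blast
  have nle: "\<not> vstab T G v \<subseteq> vstab T G w"
    by (rule locally_primitive_stab_not_le[OF loc[OF v] v w adj_neq[OF vw]])
  show "group (grp T G)" by (rule K.is_group)
  show "carrier (grp T G) \<noteq> {\<one>\<^bsub>grp T G\<^esub>}"
    unfolding carrier_grp idt_def[symmetric]
  proof
    assume "G = {idt}"
    then have "g = idt" if "g \<in> G" for g using that by blast
    then have "vstab T G v \<subseteq> vstab T G w" using w by fastforce
    then show False using nle by simp
  qed
  fix N assume N: "N \<lhd> grp T G"
  have "N = G" if ne: "N \<noteq> {idt}"
  proof -
    have sub: "subgroup N (grp T G)" by (rule normalD[OF N])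
    have edge: "vstab T G x \<inter> vstab T G y \<subseteq> N" if "(x, y) \<in> E" for x y
      using edge_stab_le[OF P that sub] normal_fixators[OF cl bp N ne] that adj_sym by auto
    have stab: "vstab T G y \<subseteq> N" if y: "y \<in> V" for y
    proof -
      obtain x where x: "(y, x) \<in> E" using third_nbr[OF y] by blast
      obtain z where z: "(y, z) \<in> E" "z \<noteq> x" using third_nbr[OF y] by metis
      show ?thesis
        by (rule adjacent_edge_stabs_generate[OF loc[OF y] x z(1) _ sub]) (use z edge[OF x] edge[OF z(1)] in auto)
    qed
    show ?thesis
      by (rule two_maximal[OF bipartite_primitive_maximal[OF bp v] bipartite_primitive_maximal[OF bp w] _ sub
            stab[OF v] stab[OF w]]) (use nle in blast)
  qed
  then show "N = {\<one>\<^bsub>grp T G\<^esub>} \<or> N = carrier (grp T G)"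
    unfolding carrier_grp idt_def[symmetric] by blast
qed

section \<open>The quotient graph and the ends\<close>

lemma arc_eqI:
  assumes "a \<in> arcs T" "b \<in> arcs T" "orig T a = orig T b" "term_of T a = term_of T b"
  shows "a = b"
  using assms tree unfolding is_tree_def by blast

lemma arc_adj: "a \<in> arcs T \<Longrightarrow> (orig T a, term_of T a) \<in> E"
  by (auto simp: adj_rel_def)

lemma opp_arc:
  assumes "a \<in> arcs T"
  shows "opp T a \<in> arcs T" "opp T (opp T a) = a" "orig T (opp T a) = term_of T a" "term_of T (opp T a) = orig T a"
  using assms tree unfolding is_tree_def is_graph_def by (auto simp: term_of_def)

lemma aorbit_eqI:
  assumes a: "a \<in> arcs T" "b \<in> arcs T" and g: "g \<in> G" "g (orig T a) = orig T b" "g (term_of T a) = term_of T b"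
  shows "aorbit T G a = aorbit T G b"
proof -
  have V: "orig T a \<in> V" "term_of T a \<in> V" using arc_adj[OF a(1)] adj_verts by auto
  have act: "arc_act T h c = c'" if "h \<in> G" "c \<in> arcs T" "c' \<in> arcs T" "h (orig T c) = orig T c'" "h (term_of T c) = term_of T c'" for h c c'
    by (rule arc_eqI) (use arc_act[OF tree G_auts] that in auto)
  have "arc_act T h b = arc_act T (h \<cdot> g) a" if "h \<in> G" for h
    by (rule act[symmetric]) (use arc_act[OF tree G_auts[OF that] a(2)] a g V that in auto)
  moreover have "arc_act T h a = arc_act T (h \<cdot> iv g) b" if "h \<in> G" for h
  proof (rule act[symmetric])
    have "iv g (orig T b) = orig T a" "iv g (term_of T b) = term_of T a"
      using act_iv(1)[OF g(1)] V g(2,3) by metis+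
    moreover have "orig T b \<in> V" "term_of T b \<in> V" using arc_adj[OF a(2)] adj_verts by auto
    ultimately show "(h \<cdot> iv g) (orig T b) = orig T (arc_act T h a)" "(h \<cdot> iv g) (term_of T b) = term_of T (arc_act T h a)"
      using arc_act[OF tree G_auts[OF that] a(1)] that g by auto
  qed (use arc_act[OF tree G_auts[OF that] a(1)] a g that in auto)
  ultimately show ?thesis unfolding orbit_def carrier_grp using g by (metis (no_types, opaque_lifting) iv_closed mul_closed)
qed

lemma verts_quotient: "verts (quotient_graph T G) = vorbit T G ` V"
  by (auto simp: quotient_graph_def orbits_def)

lemma arcs_quotient: "arcs (quotient_graph T G) = aorbit T G ` arcs T"
  by (auto simp: quotient_graph_def orbits_def)

lemma bipartite_primitive_orbit:
  assumes bp: bipartite_primitive and v: "v \<in> V"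
  shows "vorbit T G v = part v"
proof
  show "vorbit T G v \<subseteq> part v"
    using bipartite_primitiveD(3)[OF bp v _ mem_part_self[OF v]] unfolding vorbit_iff[abs_def] by (auto simp: vorbit_iff)
  show "part v \<subseteq> vorbit T G v"
  proof
    fix x assume "x \<in> part v"
    then obtain g where "g \<in> G" "g v = x" using parts_transitive[OF bp v] by blast
    then show "x \<in> vorbit T G v" by (auto simp: vorbit_iff)
  qed
qed

lemma bipartite_primitive_quotient_verts:
  assumes bp: bipartite_primitive and vw: "(v, w) \<in> E"
  shows "verts (quotient_graph T G) = {vorbit T G v, vorbit T G w}" "vorbit T G v \<noteq> vorbit T G w"
proof -
  have V: "v \<in> V" "w \<in> V" using adj_verts vw by auto
  have "verts (quotient_graph T G) = bipartition T"
    unfolding verts_quotient bipartition_eq_image using bipartite_primitive_orbit[OF bp] by (intro image_cong) auto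
  then show "verts (quotient_graph T G) = {vorbit T G v, vorbit T G w}"
    unfolding bipartition_eq[OF vw] using bipartite_primitive_orbit[OF bp] V by simp
  have "w \<notin> part v" using part_adj[OF vw V(1)] V mem_part_self by blast
  then show "vorbit T G v \<noteq> vorbit T G w"
    unfolding bipartite_primitive_orbit[OF bp V(1)] bipartite_primitive_orbit[OF bp V(2)]
    using mem_part_self[OF V(2)] by blast
qed

text \<open>Transitivity on the parts and on each star leaves one orbit of arcs for each choice of
  the part in which the arc ends, and reversal exchanges the two.\<close>

lemma bipartite_primitive_single_edge:
  assumes bp: bipartite_primitive
  shows "is_single_edge (quotient_graph T G)"
proof -
  let ?\<Gamma> = "quotient_graph T G"
  have GA: "G \<subseteq> auts T" using G_auts by blast
  obtain v where v: "v \<in> V" using tree unfolding is_tree_def by blast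
  obtain w where vw: "(v, w) \<in> E" using third_nbr[OF v] by blast
  then obtain e where e: "e \<in> arcs T" "orig T e = v" "term_of T e = w" by (auto simp: adj_rel_def)
  note oe = opp_arc[OF e(1)]
  have w: "w \<in> V" using adj_verts vw by blast
  have "aorbit T G f = aorbit T G e \<or> aorbit T G f = aorbit T G (opp T e)" if f: "f \<in> arcs T" for f
  proof (cases "term_of T f \<in> part w")
    case True
    obtain h where "h \<in> G" "h v = orig T f" "h w = term_of T f" using edge_transitive[OF bp vw arc_adj[OF f] True] by metis
    then show ?thesis using aorbit_eqI[OF e(1) f] e by simp
  next
    case False
    then have "term_of T f \<in> part v"
      using part_adj[OF vw, of "term_of T f"] dist_sym[of _ "term_of T f"] adj_verts[OF arc_adj[OF f]] v w by auto
    then obtain h where "h \<in> G" "h w = orig T f" "h v = term_of T f" using edge_transitive[OF bp adj_sym[OF vw] arc_adj[OF f]] by metis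
    then show ?thesis using aorbit_eqI[OF oe(1) f] oe e by simp
  qed
  then have arcs: "arcs ?\<Gamma> = {aorbit T G e, aorbit T G (opp T e)}"
    unfolding arcs_quotient using e(1) oe(1) by blast
  have opp: "opp ?\<Gamma> (aorbit T G e) = aorbit T G (opp T e)" "opp ?\<Gamma> (aorbit T G (opp T e)) = aorbit T G e"
    using quotient_graph_opp[OF tree GA] e(1) oe by auto
  show ?thesis
    unfolding is_single_edge_def
  proof (intro exI conjI)
    show "verts ?\<Gamma> = {vorbit T G v, vorbit T G w}" "vorbit T G v \<noteq> vorbit T G w"
      using bipartite_primitive_quotient_verts[OF bp vw] by auto
    show "arcs ?\<Gamma> = {aorbit T G e, opp ?\<Gamma> (aorbit T G e)}" using arcs opp by simp
    show "opp ?\<Gamma> (opp ?\<Gamma> (aorbit T G e)) = aorbit T G e" using opp by simp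
    show "orig ?\<Gamma> (aorbit T G e) = vorbit T G v" using quotient_graph_orig[OF tree GA e(1)] e by simp
    show "term_of ?\<Gamma> (aorbit T G e) = vorbit T G w"
      unfolding term_of_def opp using quotient_graph_orig[OF tree GA oe(1)] oe e by simp
  qed
qed

section \<open>Ends of the tree\<close>

lemma ray_in_branch:
  assumes "r \<in> rays T"
  shows "r (Suc n) \<in> half T (r 0) (r 1)"
proof (induction n)
  case (Suc n)
  have r: "inj r" "\<And>n. (r n, r (Suc n)) \<in> E" using assms by (auto simp: rays_def)
  then have "r (Suc (Suc n)) \<noteq> r 0" by (simp add: inj_eq)
  then show ?case using half_boundary[OF r(2)[of 0, simplified] _ r(2)[of "Suc n"]] Suc by auto
qed simp

text \<open>Rotating about the first vertex of a ray so that the second one moves sends the ray into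
  another branch, where it meets the old ray only in its origin.\<close>

lemma locally_primitive_no_fixed_end:
  assumes loc: "\<And>v. v \<in> V \<Longrightarrow> locally_primitive v" and e: "e \<in> ends T"
  shows "\<not> fixes_end T G e"
proof
  assume fx: "fixes_end T G e"
  define \<rho> where "\<rho> = {(r, s). r \<in> rays T \<and> s \<in> rays T \<and> infinite (range r \<inter> range s)}"
  obtain r where r: "r \<in> rays T" "e = \<rho> `` {r}" using e unfolding ends_def \<rho>_def quotient_def by blast
  have rE: "(r n, r (Suc n)) \<in> E" and rV: "r n \<in> V" and ri: "inj r" for n using r(1) by (auto simp: rays_def)
  have "range r \<inter> range r = range r" by simp
  then have "r \<in> e" using r range_inj_infinite[OF ri] by (simp add: \<rho>_def)
  obtain y where y: "(r 0, y) \<in> E" "y \<noteq> r 1" using third_nbr[OF rV] by metis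
  obtain g where g: "g \<in> G" "g (r 0) = r 0" "g (r 1) = y"
    using locally_primitive_trans[OF loc[OF rV[of 0]] _ y(1)] rE[of 0] by (metis One_nat_def)
  have "g \<circ> r \<in> e" using fx g(1) \<open>r \<in> e\<close> unfolding fixes_end_def by blast
  then have s: "g \<circ> r \<in> rays T" "infinite (range r \<inter> range (g \<circ> r))" using r(2) by (auto simp: \<rho>_def)
  have r01: "(r 0, r 1) \<in> E" using rE[of 0] by simp
  have "range r \<inter> range (g \<circ> r) \<subseteq> {r 0}"
  proof
    fix x assume "x \<in> range r \<inter> range (g \<circ> r)"
    then have "\<exists>i. x = r i" "\<exists>j. x = g (r j)" by auto
    then obtain i j where ij: "x = r i" "x = g (r j)" by blast
    show "x \<in> {r 0}"
    proof (rule ccontr)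
      assume ne: "x \<notin> {r 0}"
      then obtain i' where "i = Suc i'" using ij by (cases i) auto
      then have "x \<in> half T (r 0) (r 1)" using ray_in_branch[OF r(1)] ij by simp
      moreover obtain j' where "j = Suc j'" using ne ij g by (cases j) auto
      then have "x \<in> half T (r 0) y" using ray_in_branch[OF s(1), of j'] ij g by simp
      ultimately show False using branch_unique[OF r01 y(1)] y(2) by metis
    qed
  qed
  then show False using s(2) finite_subset by blast
qed

end

section \<open>The amalgamated product\<close>

context tree_action
begin

abbreviation letter :: "('v \<Rightarrow> 'v) + ('v \<Rightarrow> 'v) \<Rightarrow> 'v \<Rightarrow> 'v" where
  "letter l \<equiv> case_sum id id l"

primrec word_value :: "(('v \<Rightarrow> 'v) + ('v \<Rightarrow> 'v)) list \<Rightarrow> 'v \<Rightarrow> 'v" where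
  "word_value [] = idt"
| "word_value (l # u) = letter l \<cdot> word_value u"

lemma mult_grp_carrier: "mult ((grp T G)\<lparr>carrier := A\<rparr>) = mul"
  by (simp add: mul_def fun_eq_iff)

lemma one_grp_carrier: "one ((grp T G)\<lparr>carrier := A\<rparr>) = idt"
  by (simp add: idt_def)

lemma carrier_grp_carrier: "carrier ((grp T G)\<lparr>carrier := A\<rparr>) = A"
  by simp

lemma mul_assoc: "f \<in> G \<Longrightarrow> g \<in> G \<Longrightarrow> h \<in> G \<Longrightarrow> f \<cdot> g \<cdot> h = f \<cdot> (g \<cdot> h)"
  by (rule act_eqI) auto

lemma mul_idt [simp]: "g \<in> G \<Longrightarrow> idt \<cdot> g = g" "g \<in> G \<Longrightarrow> g \<cdot> idt = g"
  by (rule act_eqI; auto)+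

lemma astab_eq:
  assumes "a \<in> arcs T"
  shows "astab T G a = vstab T G (orig T a) \<inter> vstab T G (term_of T a)"
proof -
  have "arc_act T g a = a \<longleftrightarrow> g (orig T a) = orig T a \<and> g (term_of T a) = term_of T a" if g: "g \<in> G" for g
    using arc_act[OF tree G_auts[OF g] assms] assms tree unfolding is_tree_def by metis
  then show ?thesis by (auto simp: stabilizer_def)
qed

end

locale stabiliser_amalgam = tree_action T G for T :: "('v, 'a) arc_graph" and G +
  fixes v w :: 'v
  assumes vw: "(v, w) \<in> E"
begin

abbreviation "Gv \<equiv> vstab T G v"
abbreviation "Gw \<equiv> vstab T G w"
abbreviation "C \<equiv> Gv \<inter> Gw"
abbreviation "KA \<equiv> (grp T G)\<lparr>carrier := Gv\<rparr>"
abbreviation "KB \<equiv> (grp T G)\<lparr>carrier := Gw\<rparr>"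
abbreviation cong (infix "\<sim>" 50) where "u \<sim> u' \<equiv> amalg_cong KA KB C u u'"

lemma vwV: "v \<in> V" "w \<in> V"
  using adj_verts vw by auto

lemma words: "amalg_words KA KB = lists (Gv <+> Gw)"
  unfolding amalg_words_def carrier_grp_carrier ..

lemma letter_G: "l \<in> Gv <+> Gw \<Longrightarrow> letter l \<in> G"
  by auto

lemma word_value_G: "u \<in> lists (Gv <+> Gw) \<Longrightarrow> word_value u \<in> G"
  by (induction u) (use letter_G in auto)

lemma word_value_append:
  "u \<in> lists (Gv <+> Gw) \<Longrightarrow> u' \<in> lists (Gv <+> Gw) \<Longrightarrow> word_value (u @ u') = word_value u \<cdot> word_value u'"
proof (induction u)
  case (Cons l u)
  then have "letter l \<in> G" "word_value u \<in> G" "word_value u' \<in> G" using letter_G word_value_G by auto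
  then show ?case using Cons mul_assoc by auto
qed (use word_value_G in simp)

lemma singleton_word:
  shows "a \<in> Gv \<Longrightarrow> [Inl a] \<in> lists (Gv <+> Gw)" "a \<in> Gv \<Longrightarrow> word_value [Inl a] = a"
    and "b \<in> Gw \<Longrightarrow> [Inr b] \<in> lists (Gv <+> Gw)" "b \<in> Gw \<Longrightarrow> word_value [Inr b] = b"
  by auto

lemma cong_value:
  "u \<sim> u' \<Longrightarrow> u \<in> lists (Gv <+> Gw) \<and> u' \<in> lists (Gv <+> Gw) \<and> word_value u = word_value u'"
proof (induction rule: amalg_cong.induct)
  case (append u u' x x')
  then show ?case using word_value_append by auto
next
  case (mult_left a a')
  then have "a \<in> Gv" "a' \<in> Gv" unfolding carrier_grp_carrier by auto
  then show ?case unfolding mult_grp_carrier using vwV by auto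
next
  case (mult_right a a')
  then have "a \<in> Gw" "a' \<in> Gw" unfolding carrier_grp_carrier by auto
  then show ?case unfolding mult_grp_carrier using vwV by auto
qed (use vwV in \<open>auto simp only: words one_grp_carrier\<close>, use vwV in auto)

lemma cong_one: "[Inl idt] \<sim> []" "[Inr idt] \<sim> []"
  using amalg_cong.one_left[of KA KB C] amalg_cong.one_right[of KA KB C] unfolding one_grp_carrier .

lemma cong_mult:
  shows "a \<in> Gv \<Longrightarrow> a' \<in> Gv \<Longrightarrow> [Inl a, Inl a'] \<sim> [Inl (a \<cdot> a')]"
  "b \<in> Gw \<Longrightarrow> b' \<in> Gw \<Longrightarrow> [Inr b, Inr b'] \<sim> [Inr (b \<cdot> b')]"
  using amalg_cong.mult_left[of a KA a' KB C] amalg_cong.mult_right[of b KB b' KA C]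
  unfolding mult_grp_carrier carrier_grp_carrier by blast+

lemma cong_refl: "u \<in> lists (Gv <+> Gw) \<Longrightarrow> u \<sim> u"
  using amalg_cong.refl[of u KA KB C] unfolding words .

lemma cong_context:
  assumes "u \<sim> u'" "p \<in> lists (Gv <+> Gw)" "q \<in> lists (Gv <+> Gw)"
  shows "p @ u @ q \<sim> p @ u' @ q"
  by (intro amalg_cong.append assms(1) cong_refl assms(2,3))

text \<open>The alternation condition of normal forms in an amalgam. It does not constrain words
  with one letter, whence the separate clauses for \<open>[l]\<close> below.\<close>

definition reduced_pair where
  "reduced_pair l l' \<longleftrightarrow> isl l \<noteq> isl l' \<and> letter l \<notin> C \<and> letter l' \<notin> C"

text \<open>A letter in \<open>C\<close> may be read in either factor, so a pair that is not reduced
  can be brought into one factor and multiplied.\<close>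

lemma merge_letters:
  assumes "l \<in> Gv <+> Gw" "l' \<in> Gv <+> Gw" "\<not> reduced_pair l l'"
  shows "\<exists>l''. [l, l'] \<sim> [l'']"
proof -
  have switch: "\<exists>x. [l] \<sim> [x] \<and> isl x = s \<and> x \<in> Gv <+> Gw" if l: "l \<in> Gv <+> Gw" "letter l \<in> C \<or> isl l = s" for l s
  proof (cases "isl l = s")
    case True
    then show ?thesis using l cong_refl[of "[l]"] by auto
  next
    case False
    then have c: "letter l \<in> C" using l by blast
    show ?thesis
    proof (cases l)
      case (Inl c)
      then have "[l] \<sim> [Inr c]" "isl (Inr c) = s" "Inr c \<in> Gv <+> Gw"
        using amalg_cong.amalg[of c C KA KB] c False by auto
      then show ?thesis by blast
    next
      case (Inr c)
      then have "[l] \<sim> [Inl c]" "isl (Inl c) = s" "Inl c \<in> Gv <+> Gw"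
        using amalg_cong.sym[OF amalg_cong.amalg[of c C KA KB]] c False by auto
      then show ?thesis by blast
    qed
  qed
  have same: "\<exists>l''. [x, x'] \<sim> [l'']" if "x \<in> Gv <+> Gw" "x' \<in> Gv <+> Gw" "isl x = isl x'" for x x'
  proof (cases x)
    case (Inl a)
    from this that(3) obtain a' where "x' = Inl a'" by (cases x') auto
    then show ?thesis using cong_mult(1)[of a a'] that(1,2) Inl by blast
  next
    case (Inr a)
    from this that(3) obtain a' where "x' = Inr a'" by (cases x') auto
    then show ?thesis using cong_mult(2)[of a a'] that(1,2) Inr by blast
  qed
  have "\<exists>s. (letter l \<in> C \<or> isl l = s) \<and> (letter l' \<in> C \<or> isl l' = s)"
    using assms(3) unfolding reduced_pair_def by blast
  then obtain x x' where x: "[l] \<sim> [x]" "[l'] \<sim> [x']" "isl x = isl x'" "x \<in> Gv <+> Gw" "x' \<in> Gv <+> Gw"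
    using switch[OF assms(1)] switch[OF assms(2)] by metis
  obtain l'' where "[x, x'] \<sim> [l'']" using same x by blast
  moreover have "[l, l'] \<sim> [x, x']" using amalg_cong.append[OF x(1,2)] by simp
  ultimately show ?thesis using amalg_cong.trans by blast
qed

text \<open>A shortest congruent word works: an unreduced pair could be merged, and a single trivial
  letter could be deleted.\<close>

lemma reduce_word:
  assumes "u \<in> lists (Gv <+> Gw)"
  shows "\<exists>u'. u \<sim> u' \<and> successively reduced_pair u' \<and> (\<forall>l. u' = [l] \<longrightarrow> letter l \<notin> C \<or> letter l \<noteq> idt)"
proof -
  define L where "L = (LEAST n. \<exists>u'. u \<sim> u' \<and> length u' = n)"
  have "\<exists>n u'. u \<sim> u' \<and> length u' = n" using cong_refl[OF assms] by blast
  then have "\<exists>u'. u \<sim> u' \<and> length u' = L" unfolding L_def by (rule LeastI_ex)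
  then obtain u' where u': "u \<sim> u'" "length u' = L" by blast
  have min: "L \<le> length u''" if "u' \<sim> u''" for u''
    unfolding L_def using amalg_cong.trans[OF u'(1) that] by (intro Least_le) blast
  have W: "u' \<in> lists (Gv <+> Gw)" using cong_value[OF u'(1)] by blast
  have "successively reduced_pair u'"
    unfolding successively_conv_nth
  proof (intro allI impI)
    fix i assume i: "Suc i < length u'"
    have dec: "u' = take i u' @ [u' ! i, u' ! Suc i] @ drop (Suc (Suc i)) u'"
      using i by (simp add: Cons_nth_drop_Suc)
    show "reduced_pair (u' ! i) (u' ! Suc i)"
    proof (rule ccontr)
      assume "\<not> reduced_pair (u' ! i) (u' ! Suc i)"
      moreover have "\<forall>l\<in>set u'. l \<in> Gv <+> Gw" using W by blast
      then have "u' ! i \<in> Gv <+> Gw" "u' ! Suc i \<in> Gv <+> Gw" using i by auto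
      ultimately have "\<exists>l''. [u' ! i, u' ! Suc i] \<sim> [l'']" using merge_letters by metis
      then obtain l'' where "[u' ! i, u' ! Suc i] \<sim> [l'']" ..
      then have "take i u' @ [u' ! i, u' ! Suc i] @ drop (Suc (Suc i)) u' \<sim> take i u' @ [l''] @ drop (Suc (Suc i)) u'"
        using W by (intro cong_context) (auto simp: in_lists_conv_set dest: in_set_takeD in_set_dropD)
      then have "L \<le> length (take i u' @ [l''] @ drop (Suc (Suc i)) u')" using min dec by metis
      then show False using i u'(2) by simp
    qed
  qed
  moreover have "letter l \<noteq> idt" if l: "u' = [l]" for l
  proof
    assume "letter l = idt"
    then have "[l] \<sim> []" using cong_one by (cases l) auto
    then show False using min[of "[]"] l u'(2) by simp
  qed
  ultimately show ?thesis using u'(1) by blast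
qed

text \<open>Ping-pong on the two half-trees at the edge.\<close>
lemma reduced_word_moves:
  assumes "u \<in> lists (Gv <+> Gw)" "u \<noteq> []" "successively reduced_pair u" "\<forall>l. u = [l] \<longrightarrow> letter l \<notin> C"
  shows "word_value u (if isl (last u) then w else v) \<in> (if isl (hd u) then half T w v - {v} else half T v w - {w})"
  using assms
proof (induction u rule: induct_list012)
  case (2 l)
  have wv: "(w, v) \<in> E" using adj_sym vw .
  show ?case
  proof (cases l)
    case (Inl a)
    then have a: "a \<in> G" "a v = v" "a w \<noteq> w" using 2 vwV by auto
    have e: "(v, a w) \<in> E" using act_adjI[OF a(1) vw] a(2) by simp
    have "a w \<in> half T w v" using half_boundary[OF wv half_refl e] a(3) by blast
    moreover have "a w \<noteq> v" using adj_neq[OF e] by simp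
    ultimately show ?thesis using Inl a vwV by simp
  next
    case (Inr b)
    then have b: "b \<in> G" "b w = w" "b v \<noteq> v" using 2 vwV by auto
    have e: "(w, b v) \<in> E" using act_adjI[OF b(1) wv] b(2) by simp
    have "b v \<in> half T v w" using half_boundary[OF vw half_refl e] b(3) by blast
    moreover have "b v \<noteq> w" using adj_neq[OF e] by simp
    ultimately show ?thesis using Inr b vwV by simp
  qed
next
  case (3 l l' u)
  have wv: "(w, v) \<in> E" using adj_sym vw .
  have red: "reduced_pair l l'" using "3.prems"(3) by simp
  have mem: "l \<in> Gv <+> Gw" "l' # u \<in> lists (Gv <+> Gw)"
    using "3.prems"(1) unfolding Cons_in_lists_iff by blast+
  \<comment> \<open>The starting vertex is the end of the edge that the last letter may move:
    \<open>w\<close> for an element fixing \<open>v\<close>, and \<open>v\<close> for one fixing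
    \<open>w\<close>.\<close>
  define x where "x = (if isl (last (l' # u)) then w else v)"
  define y where "y = word_value (l' # u) x"
  have IH: "y \<in> (if isl l' then half T w v - {v} else half T v w - {w})"
  proof -
    have "successively reduced_pair (l' # u)" using "3.prems"(3) by simp
    moreover have "\<forall>k. l' # u = [k] \<longrightarrow> letter k \<notin> C" using red by (auto simp: reduced_pair_def)
    ultimately show ?thesis using "3.IH"(2) mem(2) unfolding y_def x_def by simp
  qed
  have xV: "x \<in> V" using vwV by (simp add: x_def)
  have uG: "word_value (l' # u) \<in> G" "letter l \<in> G" by (rule word_value_G[OF mem(2)], rule letter_G[OF mem(1)])
  have eq: "word_value (l # l' # u) (if isl (last (l # l' # u)) then w else v) = letter l y"
    using uG xV act_mul[OF uG(2,1) xV] by (simp add: x_def y_def)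
  have yV: "y \<in> V" using uG xV unfolding y_def by (metis act_closed)
  show ?case
  proof (cases l)
    case (Inl a)
    then have y: "y \<in> half T v w" using IH red by (auto simp: reduced_pair_def split: if_splits)
    have a: "a \<in> G" "a v = v" "a w \<noteq> w" using Inl mem(1) red vwV by (auto simp: reduced_pair_def)
    have e: "(v, a w) \<in> E" using act_adjI[OF a(1) vw] a(2) by simp
    have "a y \<in> half T v (a w)" using act_half[OF a(1) vw yV] y a(2) by simp
    moreover have "half T v (a w) \<subseteq> half T w v" using half_mono[OF e wv] a(3) by metis
    \<comment> \<open>The image lies in a branch at \<open>v\<close>, which never contains
      \<open>v\<close> itself.\<close>
    ultimately have "a y \<in> half T w v - {v}" using bridge[OF e] by blast
    then show ?thesis unfolding eq using Inl by simp
  next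
    case (Inr b)
    then have y: "y \<in> half T w v" using IH red by (auto simp: reduced_pair_def split: if_splits)
    have b: "b \<in> G" "b w = w" "b v \<noteq> v" using Inr mem(1) red vwV by (auto simp: reduced_pair_def)
    have e: "(w, b v) \<in> E" using act_adjI[OF b(1) wv] b(2) by simp
    have "b y \<in> half T w (b v)" using act_half[OF b(1) wv yV] y b(2) by simp
    moreover have "half T w (b v) \<subseteq> half T v w" using half_mono[OF e vw] b(3) by metis
    ultimately have "b y \<in> half T v w - {w}" using bridge[OF e] by blast
    then show ?thesis unfolding eq using Inr by simp
  qed
qed simp

lemma trivial_word:
  assumes u: "u \<in> lists (Gv <+> Gw)" "word_value u = idt"
  shows "u \<sim> []"
proof -
  obtain u' where u': "u \<sim> u'" "successively reduced_pair u'" "\<forall>l. u' = [l] \<longrightarrow> letter l \<notin> C \<or> letter l \<noteq> idt"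
    using reduce_word[OF u(1)] by blast
  have W: "u' \<in> lists (Gv <+> Gw)" "word_value u' = idt" using cong_value[OF u'(1)] u(2) by auto
  have one: "letter l = idt" if "u' = [l]" for l using W that letter_G[of l] by auto
  have "u' = []"
  proof (rule ccontr)
    assume ne: "u' \<noteq> []"
    have "\<forall>l. u' = [l] \<longrightarrow> letter l \<notin> C" using u'(3) one by blast
    from reduced_word_moves[OF W(1) ne u'(2) this]
    \<comment> \<open>If the first and last letters come from the same factor, the starting vertex
      would be on the wrong side of the edge; otherwise it would be the very vertex removed from the
      half-tree.\<close>
    show False using W(2) vwV bridge[OF vw] bridge[OF adj_sym[OF vw]] by (auto split: if_splits)
  qed
  then show ?thesis using u' by simp
qed

text \<open>Evaluating words is injective by the ping-pong argument and surjective because the two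
  stabilisers generate.\<close>

lemma amalgamated:
  assumes gen: "\<And>H. subgroup H (grp T G) \<Longrightarrow> Gv \<subseteq> H \<Longrightarrow> Gw \<subseteq> H \<Longrightarrow> H = G"
  shows "is_amalgamated_product (grp T G) Gv Gw C"
proof -
  let ?P = "amalg_product KA KB C"
  let ?cl = "amalg_class KA KB C"
  let ?W = "lists (Gv <+> Gw)"
  have subs: "subgroup Gv (grp T G)" "subgroup Gw (grp T G)" using vstab_subgroup vwV by auto
  have subC: "subgroup C (grp T G)" by (rule K.subgroups_Inter_pair[OF subs])
  have grpP: "group ?P"
    by (rule group_amalg_product) (use K.subgroup_imp_group subs in blast)+
  \<comment> \<open>A class is evaluated at an arbitrary representative; congruent words have equal
    values.\<close>
  define f where "f = (\<lambda>U. word_value (SOME u. u \<in> U))"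
  have f: "f (?cl u) = word_value u" if u: "u \<in> ?W" for u
  proof -
    have "u \<in> ?cl u" using cong_refl[OF u] by (simp add: amalg_class_def)
    then have "(SOME x. x \<in> ?cl u) \<in> ?cl u" by (rule someI)
    then show ?thesis using cong_value by (auto simp: f_def amalg_class_def)
  qed
  have car: "carrier ?P = ?cl ` ?W" unfolding words[symmetric] by (simp add: amalg_product_def)
  have hom: "f \<in> hom ?P (grp T G)"
  proof (rule homI)
    fix U assume "U \<in> carrier ?P"
    then obtain u where "u \<in> ?W" "U = ?cl u" unfolding car by blast
    then have "f U \<in> G" using f word_value_G by metis
    then show "f U \<in> carrier (grp T G)" unfolding carrier_grp .
  next
    fix U U' assume "U \<in> carrier ?P" "U' \<in> carrier ?P"
    then obtain u u' where u: "u \<in> ?W" "U = ?cl u" "u' \<in> ?W" "U' = ?cl u'" unfolding car by blast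
    then have "U \<otimes>\<^bsub>?P\<^esub> U' = ?cl (u @ u')" using amalg_product_mult[of u KA KB u' C] unfolding words by simp
    then have "f (U \<otimes>\<^bsub>?P\<^esub> U') = f U \<cdot> f U'" using u f word_value_append by simp
    then show "f (U \<otimes>\<^bsub>?P\<^esub> U') = f U \<otimes>\<^bsub>grp T G\<^esub> f U'" unfolding mul_def .
  qed
  interpret h: group_hom ?P "grp T G" f
    using grpP K.is_group hom by (simp add: group_hom_def group_hom_axioms_def)
  have "inj_on f (carrier ?P)"
  proof (rule h.inj_on_one_iff[THEN iffD2], intro allI impI)
    fix U assume "U \<in> carrier ?P" and 1: "f U = \<one>\<^bsub>grp T G\<^esub>"
    then obtain u where u: "u \<in> ?W" "U = ?cl u" unfolding car by blast
    then have "word_value u = idt" using f 1 unfolding idt_def by simp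
    then have "u \<sim> []" using trivial_word u by blast
    then show "U = \<one>\<^bsub>?P\<^esub>" using amalg_class_eq u by (simp add: amalg_product_def)
  qed
  moreover have single1: "f (?cl [Inl a]) = a" if "a \<in> Gv" for a
    by (rule HOL.trans[OF f[OF singleton_word(1)[OF that]] singleton_word(2)[OF that]])
  have single2: "f (?cl [Inr b]) = b" if "b \<in> Gw" for b
    by (rule HOL.trans[OF f[OF singleton_word(3)[OF that]] singleton_word(4)[OF that]])
  have "f ` carrier ?P = G"
  proof (rule gen)
    show "subgroup (f ` carrier ?P) (grp T G)" by (rule h.img_is_subgroup)
    show "Gv \<subseteq> f ` carrier ?P"
    proof
      fix a assume a: "a \<in> Gv"
      have "?cl [Inl a] \<in> carrier ?P" unfolding car using singleton_word(1)[OF a] by (rule imageI)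
      then have "f (?cl [Inl a]) \<in> f ` carrier ?P" by (rule imageI)
      then show "a \<in> f ` carrier ?P" unfolding single1[OF a] .
    qed
    show "Gw \<subseteq> f ` carrier ?P"
    proof
      fix b assume b: "b \<in> Gw"
      have "?cl [Inr b] \<in> carrier ?P" unfolding car using singleton_word(3)[OF b] by (rule imageI)
      then have "f (?cl [Inr b]) \<in> f ` carrier ?P" by (rule imageI)
      then show "b \<in> f ` carrier ?P" unfolding single2[OF b] .
    qed
  qed
  ultimately have "f \<in> iso ?P (grp T G)"
    using hom unfolding iso_def bij_betw_def carrier_grp by blast
  moreover have "\<forall>a\<in>Gv. f (?cl [Inl a]) = a" "\<forall>b\<in>Gw. f (?cl [Inr b]) = b"
    using single1 single2 by blast+
  ultimately show ?thesis
    unfolding is_amalgamated_product_def Let_def using subs subC by blast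
qed

end

section \<open>Local action diagrams\<close>

context thick_tree_action
begin

text \<open>The diagram records one vertex of each orbit; conjugation carries its local action to
  the remaining ones.\<close>

lemma locally_primitive_transport:
  assumes loc: "locally_primitive v" and g: "g \<in> G" and v: "v \<in> V"
  shows "locally_primitive (g v)"
  unfolding locally_primitive_def
proof
  let ?c = "\<lambda>k. g \<cdot> k \<cdot> iv g"
  have igv: "iv g (g v) = v" using g v by simp
  have bij: "bij_betw g (nbrs T v) (nbrs T (g v))"
    unfolding bij_betw_def
  proof
    show "inj_on g (nbrs T v)" using nbrs_verts g by (auto intro!: inj_onI dest!: subsetD[OF nbrs_verts])
    show "g ` nbrs T v = nbrs T (g v)"
    proof
      show "g ` nbrs T v \<subseteq> nbrs T (g v)" using act_adjI[OF g, of v] by auto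
      show "nbrs T (g v) \<subseteq> g ` nbrs T v"
      proof
        fix y assume "y \<in> nbrs T (g v)"
        then have y: "(g v, y) \<in> E" by simp
        then have "(v, iv g y) \<in> E" using act_adjI[OF iv_closed[OF g] y] igv by simp
        moreover have "y = g (iv g y)" using adj_verts[OF y] g by simp
        ultimately show "y \<in> g ` nbrs T v" by (metis image_eqI nbrs_iff)
      qed
    qed
  qed
  have sub: "?c k \<in> vstab T G (g v)" if "k \<in> vstab T G v" for k using that g v igv by simp
  have eqv: "?c k (g x) = g (k x)" if "k \<in> vstab T G v" "(v, x) \<in> E" for k x
    using that adj_verts[OF that(2)] g by simp
  have "primitive_on (nbrs T (g v)) (?c ` vstab T G v)"
  proof (rule primitive_on_transfer[OF bij_betw_imp_surj_on[OF bij, symmetric], of _ id])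
    show "id k x \<in> nbrs T v \<and> g (id k x) = ?c k (g x)" if "k \<in> vstab T G v" "x \<in> nbrs T v" for k x
      using vstab_nbrs[OF that] eqv[OF that(1), of x] that(2) by simp
    show "primitive_on (nbrs T v) (id ` vstab T G v)" using loc by (simp add: locally_primitive_def)
  qed
  then show "primitive_on (nbrs T (g v)) (vstab T G (g v))"
    by (rule primitive_on_mono) (use sub in blast)
  obtain k x y where k: "k \<in> vstab T G v" "(v, x) \<in> E" "(v, y) \<in> E" "k x = x" "k y \<noteq> y"
    using loc unfolding locally_primitive_def by auto
  have V: "x \<in> V" "y \<in> V" "k y \<in> V" using adj_verts k by auto
  have "?c k (g x) = g x" "?c k (g y) \<noteq> g y"
    using eqv[OF k(1,2)] eqv[OF k(1,3)] k(4,5) act_inj[OF g V(3,2)] by auto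
  moreover have "g x \<in> nbrs T (g v)" "g y \<in> nbrs T (g v)" using act_adjI[OF g] k by auto
  ultimately show "\<exists>h\<in>vstab T G (g v). \<exists>x\<in>nbrs T (g v). \<exists>y\<in>nbrs T (g v). h x = x \<and> h y \<noteq> y"
    using sub[OF k(1)] by blast
qed

text \<open>The diagram acts on outgoing arcs and takes a closure. Arcs at \<open>v\<close>
  correspond to neighbours through their terminal vertices, and neither primitivity nor regularity
  distinguishes the closure from the induced group once that group is transitive.\<close>

lemma locally_primitive_iff_diagram:
  assumes v: "v \<in> V"
  defines "X \<equiv> out_arcs T v"
  defines "C \<equiv> perm_topology X closure_of ((\<lambda>g. restrict (arc_act T g) X) ` vstab T G v)"
  shows "locally_primitive v \<longleftrightarrow> primitive_on X C \<and> \<not> regular_on X C"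
proof -
  let ?\<rho> = "\<lambda>g. restrict (arc_act T g) X"
  let ?H = "?\<rho> ` vstab T G v"
  have X: "a \<in> X \<longleftrightarrow> a \<in> arcs T \<and> orig T a = v" for a by (simp add: X_def out_arcs_def)
  have bij: "bij_betw (term_of T) X (nbrs T v)"
    unfolding bij_betw_def
  proof
    show "inj_on (term_of T) X" using arc_eqI X by (auto intro!: inj_onI)
    show "term_of T ` X = nbrs T v" by (auto simp: X adj_rel_def)
  qed
  have act: "arc_act T g a \<in> X" "term_of T (arc_act T g a) = g (term_of T a)" if "g \<in> vstab T G v" "a \<in> X" for g a
    using arc_act[OF tree G_auts, of g a] that X by auto
  have act_act: "arc_act T g (arc_act T h a) = a" if "g \<in> vstab T G v" "h \<in> vstab T G v" "a \<in> X" "\<And>x. x \<in> V \<Longrightarrow> g (h x) = x" for g h a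
  proof (rule inj_onD[OF bij_betw_imp_inj_on[OF bij]])
    have "term_of T a \<in> V" using that(3) X adj_verts arc_adj by blast
    then show "term_of T (arc_act T g (arc_act T h a)) = term_of T a"
      using act that by simp
  qed (use act that in auto)
  have ivst: "iv g \<in> vstab T G v" if "g \<in> vstab T G v" for g using that v iv_fix by simp
  have HB: "?H \<subseteq> Bij X"
  proof
    fix h assume "h \<in> ?H"
    then obtain g where g: "g \<in> vstab T G v" "h = ?\<rho> g" by blast
    have "bij_betw (arc_act T g) X X"
      by (rule bij_betw_byWitness[of _ "arc_act T (iv g)"])
        (use act_act[OF g(1) ivst[OF g(1)]] act_act[OF ivst[OF g(1)] g(1)] act g ivst[OF g(1)] in auto)
    then have "bij_betw h X X" using g(2) bij_betw_cong[of X "?\<rho> g" "arc_act T g" X] by simp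
    then show "h \<in> Bij X" using g by (simp add: Bij_def)
  qed
  have "?\<rho> idt = (\<lambda>x\<in>X. x)"
  proof (rule restrict_ext)
    fix a assume a: "a \<in> X"
    have "idt \<in> vstab T G v" using v by simp
    moreover have "term_of T a \<in> V" using a X adj_verts arc_adj by blast
    ultimately show "arc_act T idt a = a"
      using inj_onD[OF bij_betw_imp_inj_on[OF bij]] act[of idt a] a by simp
  qed
  then have idH: "(\<lambda>x\<in>X. x) \<in> ?H" using v by (metis act_one idt_closed image_eqI vstab_iff)
  have prim: "primitive_on X ?H \<longleftrightarrow> primitive_on (nbrs T v) (vstab T G v)"
  proof
    assume "primitive_on X ?H"
    then have "primitive_on (nbrs T v) (id ` vstab T G v)"
      by (rule primitive_on_transfer[OF bij_betw_imp_surj_on[OF bij, symmetric], rotated]) (use act in auto)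
    then show "primitive_on (nbrs T v) (vstab T G v)" by simp
  next
    let ?\<beta> = "inv_into X (term_of T)"
    assume "primitive_on (nbrs T v) (vstab T G v)"
    then have *: "primitive_on (nbrs T v) (id ` vstab T G v)" by simp
    show "primitive_on X ?H"
    proof (rule primitive_on_transfer[OF bij_betw_imp_surj_on[OF bij_betw_inv_into[OF bij], symmetric] _ *])
      fix k x assume k: "k \<in> vstab T G v" "x \<in> nbrs T v"
      have b: "?\<beta> x \<in> X" "term_of T (?\<beta> x) = x"
        using k(2) bij bij_betw_inv_into_right[OF bij] by (metis bij_betw_def inv_into_into, blast)
      have "?\<beta> (k x) = ?\<beta> (term_of T (arc_act T k (?\<beta> x)))" using act[OF k(1) b(1)] b(2) by simp
      also have "\<dots> = arc_act T k (?\<beta> x)" using bij_betw_inv_into_left[OF bij] act[OF k(1) b(1)] by blast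
      finally show "id k x \<in> nbrs T v \<and> ?\<beta> (id k x) = ?\<rho> k (?\<beta> x)" using vstab_nbrs[OF k] b(1) by simp
    qed
  qed
  have moves: "(\<exists>g\<in>vstab T G v. \<exists>x\<in>nbrs T v. \<exists>y\<in>nbrs T v. g x = x \<and> g y \<noteq> y) \<longleftrightarrow>
      \<not> (\<forall>h\<in>?H. \<forall>x\<in>X. \<forall>y\<in>X. h x = x \<longrightarrow> h y = y)"
  proof -
    have "arc_act T g a = a \<longleftrightarrow> g (term_of T a) = term_of T a" if "g \<in> vstab T G v" "a \<in> X" for g a
      using act[OF that] inj_onD[OF bij_betw_imp_inj_on[OF bij]] that(2) by metis
    moreover have "nbrs T v = term_of T ` X" using bij by (simp add: bij_betw_def)
    ultimately show ?thesis by auto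
  qed
  \<comment> \<open>The criterion for regularity of the closure presupposes transitivity, so the
    imprimitive case is settled by primitivity alone.\<close>
  show ?thesis
  proof (cases "primitive_on X ?H")
    case True
    then have "transitive_on X ?H" by (simp add: primitive_on_def)
    then show ?thesis
      unfolding locally_primitive_def C_def primitive_on_closure[OF HB]
      using prim True moves regular_on_closure[OF HB idH] by simp
  next
    case False
    then show ?thesis
      unfolding locally_primitive_def C_def primitive_on_closure[OF HB] using prim by simp
  qed
qed

end

theorem theorem1p11:
  fixes T :: "('v, 'a) arc_graph"
    and G :: "('v \<Rightarrow> 'v) set"
    and s :: "'v set \<Rightarrow> 'v"
  assumes "is_tree T"
    and "\<forall>v\<in>verts T. infinite (nbrs T v) \<or> 3 \<le> card (nbrs T v)"
    and "subgroup G (aut_group T)"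
    and "nondiscrete T G"
    and "P_closed T G"
    and "preserves_no_proper_subtree T G"
    and "is_transversal T G s"
  shows
    "let cond_i =
           ((\<forall>H. subgroup H (grp T G) \<and> H \<noteq> G \<and> openin (group_topology T G) H
               \<longrightarrow> bounded_action T H) \<and>
            (\<forall>v\<in>verts T. \<forall>w\<in>verts T. v \<noteq> w \<longrightarrow>
               \<not> vstab T G v \<subseteq> vstab T G w \<and> \<not> vstab T G w \<subseteq> vstab T G v));
         good_pair = (\<lambda>v w. vstab T G v \<noteq> vstab T G w \<and>
            maximal_subgroup (vstab T G v) (grp T G) \<and>
            maximal_subgroup (vstab T G w) (grp T G));
         cond_ii = (\<exists>v w. (v, w) \<in> adj_rel T \<and> good_pair v w);
         cond_iii =
           (\<forall>P\<in>bipartition T. (\<forall>g\<in>G. g ` P = P) \<and> primitive_on P ((\<lambda>g. restrict g P) ` G));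
         \<Delta> = diagram_of T G s;
         \<Gamma> = base_graph \<Delta>;
         cond_iv =
           (card (verts \<Gamma>) = 2 \<and>
            (\<forall>v\<in>verts \<Gamma>. primitive_on (vertex_colours \<Delta> v) (local_action \<Delta> v) \<and>
                         \<not> regular_on (vertex_colours \<Delta> v) (local_action \<Delta> v)))
     in (cond_i \<longleftrightarrow> cond_ii) \<and> (cond_ii \<longleftrightarrow> cond_iii) \<and> (cond_iii \<longleftrightarrow> cond_iv) \<and>
        (cond_i \<and> cond_ii \<and> cond_iii \<and> cond_iv \<longrightarrow>
           is_simple (grp T G) \<and>
           is_single_edge \<Gamma> \<and>
           geometrically_dense T G \<and>
           (\<forall>a\<in>arcs T. good_pair (orig T a) (term_of T a) \<longrightarrow>
              is_amalgamated_product (grp T G)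
                (vstab T G (orig T a)) (vstab T G (term_of T a)) (astab T G a)))"
proof -
  interpret thick_tree_action T G
    by (intro thick_tree_action.intro tree_action.intro tree_graph.intro tree_action_axioms.intro
        thick_tree_action_axioms.intro) (fact assms)+
  have cl: "closedin (group_topology T (auts T)) G" and P: "property_P T G"
    using assms(5) by (simp_all add: P_closed_def)
  define i where "i \<longleftrightarrow> ((\<forall>H. subgroup H (grp T G) \<and> H \<noteq> G \<and> openin (group_topology T G) H
               \<longrightarrow> bounded_action T H) \<and>
            (\<forall>v\<in>verts T. \<forall>w\<in>verts T. v \<noteq> w \<longrightarrow>
               \<not> vstab T G v \<subseteq> vstab T G w \<and> \<not> vstab T G w \<subseteq> vstab T G v))"
  define good_pair where "good_pair = (\<lambda>v w. vstab T G v \<noteq> vstab T G w \<and>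
            maximal_subgroup (vstab T G v) (grp T G) \<and>
            maximal_subgroup (vstab T G w) (grp T G))"
  define \<Delta> where "\<Delta> = diagram_of T G s"
  define iv where "iv \<longleftrightarrow> card (verts (base_graph \<Delta>)) = 2 \<and>
            (\<forall>v\<in>verts (base_graph \<Delta>). primitive_on (vertex_colours \<Delta> v) (local_action \<Delta> v) \<and>
                         \<not> regular_on (vertex_colours \<Delta> v) (local_action \<Delta> v))"
  let ?\<Gamma> = "quotient_graph T G"
  have \<Gamma>: "base_graph \<Delta> = ?\<Gamma>" by (simp add: \<Delta>_def diagram_of_def)
  obtain v0 where v0: "v0 \<in> V" using tree unfolding is_tree_def by blast
  obtain w0 where vw0: "(v0, w0) \<in> E" using third_nbr[OF v0] by blast
  have w0: "w0 \<in> V" using adj_verts vw0 by blast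
  have iii: "(\<forall>P\<in>bipartition T. (\<forall>g\<in>G. g ` P = P) \<and> primitive_on P ((\<lambda>g. restrict g P) ` G)) \<longleftrightarrow>
      bipartite_primitive"
    unfolding bipartite_primitive_def primitive_on_restrict ..
  have local: "primitive_on (vertex_colours \<Delta> u) (local_action \<Delta> u) \<and>
      \<not> regular_on (vertex_colours \<Delta> u) (local_action \<Delta> u) \<longleftrightarrow> locally_primitive (s u)"
    if u: "u \<in> verts ?\<Gamma>" for u
  proof -
    have "s u \<in> V" using assms(7) u by (simp add: is_transversal_def)
    moreover have "vertex_colours \<Delta> u = out_arcs T (s u)"
      unfolding \<Delta>_def using vertex_colours_diagram_of[OF tree _ assms(7) u] G_auts by blast
    moreover have "local_action \<Delta> u = perm_topology (out_arcs T (s u)) closure_of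
        ((\<lambda>g. restrict (arc_act T g) (out_arcs T (s u))) ` vstab T G (s u))"
      by (simp add: \<Delta>_def diagram_of_def Let_def)
    ultimately show ?thesis using locally_primitive_iff_diagram[of "s u"] by simp
  qed
  have i_ii: "\<exists>v w. (v, w) \<in> E \<and> good_pair v w" if i
  proof -
    have bd: "bounded_action T H" if "subgroup H (grp T G)" "H \<noteq> G" "openin (group_topology T G) H" for H
      using \<open>i\<close> that unfolding i_def by blast
    have inc: "\<not> vstab T G v \<subseteq> vstab T G w" if "v \<in> V" "w \<in> V" "v \<noteq> w" for v w
      using \<open>i\<close> that unfolding i_def by blast
    have "maximal_subgroup (vstab T G v) (grp T G)" if "v \<in> V" for v
      by (rule open_bounded_imp_maximal[OF bd inc that])
    moreover have "vstab T G v0 \<noteq> vstab T G w0" using inc[OF v0 w0 adj_neq[OF vw0]] by blast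
    ultimately have "good_pair v0 w0" using v0 w0 by (simp add: good_pair_def)
    then show ?thesis using vw0 by blast
  qed
  have ii_iii: bipartite_primitive if "\<exists>v w. (v, w) \<in> E \<and> good_pair v w"
    using that maximal_pair_imp_bipartite_primitive[OF _ _ _ _ assms(6)] unfolding good_pair_def by blast
  have iii_ii: "\<exists>v w. (v, w) \<in> E \<and> good_pair v w" if bp: bipartite_primitive
  proof -
    have "\<not> vstab T G v0 \<subseteq> vstab T G w0"
      by (rule locally_primitive_stab_not_le[OF bipartite_primitive_locally_primitive[OF bp v0] v0 w0 adj_neq[OF vw0]])
    then have "good_pair v0 w0"
      using bipartite_primitive_maximal[OF bp] v0 w0 unfolding good_pair_def by blast
    then show ?thesis using vw0 by blast
  qed
  have iii_i: i if bp: bipartite_primitive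
    unfolding i_def
  proof (intro conjI allI impI ballI)
    show "bounded_action T H" if "subgroup H (grp T G) \<and> H \<noteq> G \<and> openin (group_topology T G) H" for H
      using open_unbounded_whole[OF P bp] that by blast
    show "\<not> vstab T G v \<subseteq> vstab T G w" "\<not> vstab T G w \<subseteq> vstab T G v" if "v \<in> V" "w \<in> V" "v \<noteq> w" for v w
      using locally_primitive_stab_not_le bipartite_primitive_locally_primitive[OF bp] that by metis+
  qed
  have iii_iv: iv if bp: bipartite_primitive
    unfolding iv_def \<Gamma>
  proof (intro conjI ballI)
    show "card (verts ?\<Gamma>) = 2" using bipartite_primitive_quotient_verts[OF bp vw0] by simp
    fix u assume u: "u \<in> verts ?\<Gamma>"
    have "s u \<in> V" using assms(7) u by (simp add: is_transversal_def)
    then have "locally_primitive (s u)" by (rule bipartite_primitive_locally_primitive[OF bp])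
    then show "primitive_on (vertex_colours \<Delta> u) (local_action \<Delta> u)"
      "\<not> regular_on (vertex_colours \<Delta> u) (local_action \<Delta> u)" using local[OF u] by auto
  qed
  have iv_iii: bipartite_primitive if iv
  proof -
    have card: "card (verts ?\<Gamma>) = 2" and loc: "locally_primitive (s u)" if "u \<in> verts ?\<Gamma>" for u
      using \<open>iv\<close> local that unfolding iv_def \<Gamma> by auto
    have all: "\<forall>v\<in>V. locally_primitive v"
    proof
      fix v assume v: "v \<in> V"
      then have u: "vorbit T G v \<in> verts ?\<Gamma>" by (simp add: verts_quotient)
      then have su: "s (vorbit T G v) \<in> V" "vorbit T G (s (vorbit T G v)) = vorbit T G v"
        using assms(7) by (auto simp: is_transversal_def)
      then obtain g where "g \<in> G" "g (s (vorbit T G v)) = v" using vorbit_eq_iff[OF su(1) v] by blast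
      then show "locally_primitive v" using locally_primitive_transport[OF loc[OF u] _ su(1)] by metis
    qed
    have "card (verts ?\<Gamma>) = 2" using \<open>iv\<close> unfolding iv_def \<Gamma> by blast
    then obtain A B where AB: "vorbit T G ` V = {A, B}" "A \<noteq> B" unfolding verts_quotient card_2_iff by blast
    have "A \<in> vorbit T G ` V" "B \<in> vorbit T G ` V" using AB(1) by simp_all
    then obtain x0 y0 where xy: "x0 \<in> V" "y0 \<in> V" "vorbit T G x0 = A" "vorbit T G y0 = B"
      unfolding image_iff by metis
    have "V = vorbit T G x0 \<union> vorbit T G y0"
    proof
      show "vorbit T G x0 \<union> vorbit T G y0 \<subseteq> V" using xy by (auto simp: vorbit_iff)
      show "V \<subseteq> vorbit T G x0 \<union> vorbit T G y0"
      proof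
        fix x assume x: "x \<in> V"
        then have "x \<in> vorbit T G x" by (auto simp: vorbit_iff intro!: bexI[of _ idt])
        moreover have "vorbit T G x \<in> {A, B}" using AB x by blast
        ultimately show "x \<in> vorbit T G x0 \<union> vorbit T G y0" using xy by blast
      qed
    qed
    then show ?thesis
      using locally_primitive_imp_bipartite_primitive[OF P all xy(1,2)] xy(3,4) AB(2) by blast
  qed
  have conc: "is_simple (grp T G) \<and> is_single_edge ?\<Gamma> \<and> geometrically_dense T G \<and>
      (\<forall>a\<in>arcs T. good_pair (orig T a) (term_of T a) \<longrightarrow>
        is_amalgamated_product (grp T G) (vstab T G (orig T a)) (vstab T G (term_of T a)) (astab T G a))"
    if bp: bipartite_primitive
  proof (intro conjI ballI impI)
    show "is_simple (grp T G)" by (rule bipartite_primitive_simple[OF cl P bp])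
    show "is_single_edge ?\<Gamma>" by (rule bipartite_primitive_single_edge[OF bp])
    show "geometrically_dense T G"
      unfolding geometrically_dense_def
      using assms(6) locally_primitive_no_fixed_end[OF bipartite_primitive_locally_primitive[OF bp]] by blast
    fix a assume a: "a \<in> arcs T" and gp: "good_pair (orig T a) (term_of T a)"
    \<comment> \<open>Each arc with distinct maximal end stabilisers is treated on its own;
      maximality supplies the generation that surjectivity requires.\<close>
    interpret stabiliser_amalgam T G "orig T a" "term_of T a"
      by unfold_locales (rule arc_adj[OF a])
    show "is_amalgamated_product (grp T G) (vstab T G (orig T a)) (vstab T G (term_of T a)) (astab T G a)"
      unfolding astab_eq[OF a]
      by (rule amalgamated) (use gp two_maximal in \<open>unfold good_pair_def, blast\<close>)
  qed
  have "(i \<longleftrightarrow> (\<exists>v w. (v, w) \<in> E \<and> good_pair v w)) \<and>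
      ((\<exists>v w. (v, w) \<in> E \<and> good_pair v w) \<longleftrightarrow> bipartite_primitive) \<and> (bipartite_primitive \<longleftrightarrow> iv) \<and>
      (i \<and> (\<exists>v w. (v, w) \<in> E \<and> good_pair v w) \<and> bipartite_primitive \<and> iv \<longrightarrow>
        is_simple (grp T G) \<and> is_single_edge ?\<Gamma> \<and> geometrically_dense T G \<and>
        (\<forall>a\<in>arcs T. good_pair (orig T a) (term_of T a) \<longrightarrow>
          is_amalgamated_product (grp T G) (vstab T G (orig T a)) (vstab T G (term_of T a)) (astab T G a)))"
    using i_ii ii_iii iii_ii iii_i iii_iv iv_iii conc by meson
  then show ?thesis
    unfolding Let_def iii \<Gamma>[unfolded \<Delta>_def] i_def iv_def[unfolded \<Gamma>] good_pair_def \<Delta>_def .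
qed

end
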